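(* Let $(M,F)$ be a compact Finsler manifold of dimension $n$. Then, for any $p\in(1,n]$, there exists a constant $C:=C(n,p,\kappa_F,[F])$ depending only on the dimension $n$, on $p$, on the reversibility constant $\kappa_F$ and on the conformal class $[F]$ of $F$ such that $$\lambda_{1,p}(M,F)\,\mathrm{Vol}(M,F)^{\frac{p}{n}}\leq C(n,p,\kappa_F,[F]).$$
   Context: $M$ is a connected smooth $n$-dimensional manifold without boundary. A Finsler metric on $M$ is a function $F:TM\to[0,\infty)$ that is $C^\infty$ on $TM$ minus the zero section, satisfies $F(cv)=cF(v)$ for all $v\in TM$, $c\ge 0$, and such that for every $v\in T_xM\setminus\{0\}$ the matrix $g_{ij}(v)=\frac12\frac{\partial^2 (F^2)}{\partial v^i\partial v^j}(v)$ is positive definite ($F$ need not be reversible). The reversibility constant is $\kappa_F:=\sup_{x\in M}\sup_{v\in T_xM\setminus\{0\}}\frac{F(v)}{F(-v)}\in[1,\infty]$. The conformal class $[F]$ is the set of Finsler metrics $\varphi F$ with $\varphi$ a positive smooth function on $M$. The dual metric is $F^*(\alpha):=\sup_{v\in T_xM,\,F(v)\le 1}\alpha(v)$ for $\alpha\in T_x^*M$. The Legendre transform $J^*:T^*M\to TM$ sends $\alpha\in T^*_xM$ to the unique maximizer of $v\mapsto\alpha(v)-\frac12F^2(v)$ on $T_xM$; the gradient of $f$ is $\nabla f(x):=J^*(x,df(x))$, so $F(\nabla f)=F^*(df)$. The Busemann–Hausdorff measure of $F$ is, in local coordinates, $d\mathfrak m_F=\frac{\omega_n}{\mathrm{Vol}(B_xM)}dx^1\cdots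 dx^n$, where $B_xM=\{v\in T_xM: F(x,v)<1\}$, $\mathrm{Vol}(B_xM)$ is its Lebesgue volume in the coordinates $(v^i)$, and $\omega_n$ is the volume of the unit ball of Euclidean $\mathbb R^n$. $\mathrm{Vol}(M,F)$ is the total Busemann–Hausdorff volume of $M$. The first eigenvalue of the Finsler $p$-Laplacian ($p>1$), taken with respect to the measure $\mathfrak m=\mathfrak m_F$, is $$\lambda_{1,p}(M,F):=\inf_{f\in\mathcal H_0^p}\frac{\int_M F(\nabla f)^p\,d\mathfrak m}{\int_M|f|^p\,d\mathfrak m},\qquad \mathcal H_0^p:=\Big\{f\in W^{1,p}(M)\setminus\{0\}:\int_M|f|^{p-2}f\,d\mathfrak m=0\Big\},$$ where $W^{1,p}(M)$ is the usual Sobolev space, the completion of $C^\infty(M)$. *)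

theory Defs
  imports "HOL-Analysis.Analysis"
begin

section \<open>Smooth maps and smooth manifolds\<close>

text \<open>Meaningful for open \<open>S\<close> in a Euclidean space.\<close>

fun Ck_on :: "nat \<Rightarrow> 'a::real_normed_vector set \<Rightarrow> ('a \<Rightarrow> 'b::real_normed_vector) \<Rightarrow> bool" where
  "Ck_on 0 S f \<longleftrightarrow> continuous_on S f"
| "Ck_on (Suc k) S f \<longleftrightarrow>
     (\<forall>x\<in>S. f differentiable (at x)) \<and> (\<forall>u. Ck_on k S (\<lambda>x. frechet_derivative f (at x) u))"

definition smooth_on :: "'a::real_normed_vector set \<Rightarrow> ('a \<Rightarrow> 'b::real_normed_vector) \<Rightarrow> bool" where
  "smooth_on S f \<longleftrightarrow> (\<forall>k. Ck_on k S f)"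

text \<open>The manifold is the whole type \<open>'m\<close>.  A chart is a pair of its domain and its map into
  \<open>\<real>\<^sup>n\<close>, \<open>n = CARD('n)\<close>; the map is irrelevant outside the domain.  The atlas is an arbitrary
  (not necessarily maximal) smooth atlas.\<close>

type_synonym ('m, 'n) chart = "'m set \<times> ('m \<Rightarrow> real ^ 'n)"

abbreviation chart_dom :: "('m, 'n::finite) chart \<Rightarrow> 'm set" where
  "chart_dom c \<equiv> fst c"

abbreviation chart_map :: "('m, 'n::finite) chart \<Rightarrow> 'm \<Rightarrow> real ^ 'n" where
  "chart_map c \<equiv> snd c"

abbreviation chart_img :: "('m, 'n::finite) chart \<Rightarrow> (real ^ 'n) set" where
  "chart_img c \<equiv> chart_map c ` chart_dom c"

abbreviation chart_inv :: "('m, 'n::finite) chart \<Rightarrow> real ^ 'n \<Rightarrow> 'm" where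
  "chart_inv c \<equiv> inv_into (chart_dom c) (chart_map c)"

definition smooth_atlas :: "('m::topological_space, 'n::finite) chart set \<Rightarrow> bool" where
  "smooth_atlas A \<longleftrightarrow>
     (\<Union>c\<in>A. chart_dom c) = UNIV \<and>
     (\<forall>c\<in>A. open (chart_dom c) \<and> open (chart_img c) \<and>
        homeomorphism (chart_dom c) (chart_img c) (chart_map c) (chart_inv c)) \<and>
     (\<forall>c\<in>A. \<forall>d\<in>A. smooth_on (chart_map c ` (chart_dom c \<inter> chart_dom d))
        (chart_map d \<circ> chart_inv c))"

definition smooth_functions :: "('m, 'n::finite) chart set \<Rightarrow> ('m \<Rightarrow> real) set" where
  "smooth_functions A = {f. \<forall>c\<in>A. smooth_on (chart_img c) (f \<circ> chart_inv c)}"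

section \<open>Tangent vectors\<close>

text \<open>A tangent vector acts on the smooth functions as a directional derivative; it is set to \<open>0\<close>
  on all other functions, so that equality of tangent vectors is equality of functions and the
  vector space operations are pointwise.  \<open>coord_vector A c x u\<close> is
  \<open>\<Sum>i. u\<^sub>i \<partial>/\<partial>x\<^sub>i\<close> at \<open>x\<close> in the coordinates of \<open>c\<close>.\<close>

type_synonym 'm tangent = "('m \<Rightarrow> real) \<Rightarrow> real"

definition coord_vector ::
  "('m, 'n::finite) chart set \<Rightarrow> ('m, 'n) chart \<Rightarrow> 'm \<Rightarrow> real ^ 'n \<Rightarrow> 'm tangent" where
  "coord_vector A c x u = (\<lambda>f. if f \<in> smooth_functions A
     then frechet_derivative (f \<circ> chart_inv c) (at (chart_map c x)) u else 0)"

definition tangent_space :: "('m, 'n::finite) chart set \<Rightarrow> 'm \<Rightarrow> 'm tangent set" where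
  "tangent_space A x = {coord_vector A c x u | c u. c \<in> A \<and> x \<in> chart_dom c}"

text \<open>Covectors at \<open>x\<close> are functions on tangent vectors, relevant only on the tangent space
  at \<open>x\<close>.\<close>

definition differential :: "('m \<Rightarrow> real) \<Rightarrow> 'm \<Rightarrow> 'm tangent \<Rightarrow> real" where
  "differential f x = (\<lambda>v. v f)"

section \<open>Finsler metrics\<close>

text \<open>\<open>F x v\<close> is the value of the metric at \<open>v\<close> in the tangent space at \<open>x\<close>; all other values
  are irrelevant.\<close>

type_synonym 'm finsler = "'m \<Rightarrow> 'm tangent \<Rightarrow> real"

definition coord_finsler ::
  "('m, 'n::finite) chart set \<Rightarrow> ('m, 'n) chart \<Rightarrow> 'm finsler \<Rightarrow> real ^ 'n \<Rightarrow> real ^ 'n \<Rightarrow> real" where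
  "coord_finsler A c F y u = F (chart_inv c y) (coord_vector A c (chart_inv c y) u)"

definition fundamental_tensor ::
  "('m, 'n::finite) chart set \<Rightarrow> ('m, 'n) chart \<Rightarrow> 'm finsler \<Rightarrow> real ^ 'n \<Rightarrow> real ^ 'n \<Rightarrow> real ^ 'n ^ 'n"
  where
  "fundamental_tensor A c F y u = (\<chi> i j. 1 / 2 *
     frechet_derivative
       (\<lambda>w. frechet_derivative (\<lambda>z. (coord_finsler A c F y z)\<^sup>2) (at w) (axis j 1))
       (at u) (axis i 1))"

definition finsler_metric :: "('m, 'n::finite) chart set \<Rightarrow> 'm finsler \<Rightarrow> bool" where
  "finsler_metric A F \<longleftrightarrow>
     (\<forall>x. \<forall>v\<in>tangent_space A x. F x v \<ge> 0) \<and>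
     (\<forall>x. \<forall>v\<in>tangent_space A x. \<forall>a\<ge>0. F x (\<lambda>f. a * v f) = a * F x v) \<and>
     (\<forall>c\<in>A. smooth_on (chart_img c \<times> (UNIV - {0})) (\<lambda>(y, u). coord_finsler A c F y u)) \<and>
     (\<forall>c\<in>A. \<forall>y\<in>chart_img c. \<forall>u. u \<noteq> 0 \<longrightarrow>
        (\<forall>w. w \<noteq> 0 \<longrightarrow> w \<bullet> (fundamental_tensor A c F y u *v w) > 0))"

definition reversibility :: "('m, 'n::finite) chart set \<Rightarrow> 'm finsler \<Rightarrow> ereal" where
  "reversibility A F =
     (SUP x. SUP v\<in>tangent_space A x - {\<lambda>_. 0}. ereal (F x v / F x (\<lambda>f. - v f)))"

definition conformal_class :: "('m, 'n::finite) chart set \<Rightarrow> 'm finsler \<Rightarrow> 'm finsler set" where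
  "conformal_class A F =
     {\<lambda>x v. \<phi> x * F x v | \<phi>. \<phi> \<in> smooth_functions A \<and> (\<forall>x. \<phi> x > 0)}"

definition dual_metric ::
  "('m, 'n::finite) chart set \<Rightarrow> 'm finsler \<Rightarrow> 'm \<Rightarrow> ('m tangent \<Rightarrow> real) \<Rightarrow> real" where
  "dual_metric A F x \<alpha> = (SUP v\<in>{v \<in> tangent_space A x. F x v \<le> 1}. \<alpha> v)"

definition legendre ::
  "('m, 'n::finite) chart set \<Rightarrow> 'm finsler \<Rightarrow> 'm \<Rightarrow> ('m tangent \<Rightarrow> real) \<Rightarrow> 'm tangent" where
  "legendre A F x \<alpha> = (THE v. v \<in> tangent_space A x \<and>
     (\<forall>w\<in>tangent_space A x. \<alpha> w - 1 / 2 * (F x w)\<^sup>2 \<le> \<alpha> v - 1 / 2 * (F x v)\<^sup>2))"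

section \<open>The Busemann--Hausdorff measure\<close>

definition bh_density ::
  "('m, 'n::finite) chart set \<Rightarrow> ('m, 'n) chart \<Rightarrow> 'm finsler \<Rightarrow> real ^ 'n \<Rightarrow> real" where
  "bh_density A c F y =
     measure lborel (ball (0 :: real ^ 'n) 1) / measure lborel {u. coord_finsler A c F y u < 1}"

text \<open>The unique Borel measure with the prescribed density in every chart.\<close>

definition bh_measure ::
  "('m::topological_space, 'n::finite) chart set \<Rightarrow> 'm finsler \<Rightarrow> 'm measure" where
  "bh_measure A F = (THE m. sets m = sets borel \<and>
     (\<forall>c\<in>A. \<forall>B\<in>sets borel. B \<subseteq> chart_dom c \<longrightarrow>
        emeasure m B =
          (\<integral>\<^sup>+y. ennreal (bh_density A c F y) * indicator (chart_map c ` B) y \<partial>lborel)))"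

definition finsler_volume ::
  "('m::topological_space, 'n::finite) chart set \<Rightarrow> 'm finsler \<Rightarrow> real" where
  "finsler_volume A F = measure (bh_measure A F) UNIV"

section \<open>Sobolev space and first eigenvalue\<close>

definition measurable_covector_field ::
  "('m::topological_space, 'n::finite) chart set \<Rightarrow> ('m \<Rightarrow> 'm tangent \<Rightarrow> real) \<Rightarrow> bool" where
  "measurable_covector_field A \<omega> \<longleftrightarrow>
     (\<forall>c\<in>A. (\<forall>x\<in>chart_dom c. linear (\<lambda>u. \<omega> x (coord_vector A c x u))) \<and>
        (\<forall>u. (\<lambda>x. \<omega> x (coord_vector A c x u)) \<in>
           borel_measurable (restrict_space borel (chart_dom c))))"

text \<open>On a compact manifold, the completion of the smooth functions in the \<open>W\<^sup>1\<^sup>,\<^sup>p\<close> norm is the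
  closure of the graph of \<open>differential\<close> in the \<open>L\<^sup>p\<close> functions times the \<open>L\<^sup>p\<close> covector fields.
  An element is thus a pair \<open>(f, \<omega>)\<close> of a function and its weak differential, up to equality
  almost everywhere.  As the metric need not be reversible, the dual metric is symmetrised
  to obtain a norm.\<close>

definition sobolev ::
  "('m::topological_space, 'n::finite) chart set \<Rightarrow> 'm finsler \<Rightarrow> real \<Rightarrow>
     (('m \<Rightarrow> real) \<times> ('m \<Rightarrow> 'm tangent \<Rightarrow> real)) set" where
  "sobolev A F p = {(f, \<omega>). f \<in> borel_measurable borel \<and> measurable_covector_field A \<omega> \<and>
     (\<exists>h. (\<forall>k::nat. h k \<in> smooth_functions A) \<and>
        (\<lambda>k. \<integral>\<^sup>+x. ennreal (\<bar>h k x - f x\<bar> powr p) \<partial>bh_measure A F) \<longlonglongrightarrow> 0 \<and>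
        (\<lambda>k. \<integral>\<^sup>+x. ennreal
             (dual_metric A F x (\<lambda>v. differential (h k) x v - \<omega> x v) powr p +
              dual_metric A F x (\<lambda>v. \<omega> x v - differential (h k) x v) powr p)
           \<partial>bh_measure A F) \<longlonglongrightarrow> 0)}"

definition sobolev_mean_zero ::
  "('m::topological_space, 'n::finite) chart set \<Rightarrow> 'm finsler \<Rightarrow> real \<Rightarrow>
     (('m \<Rightarrow> real) \<times> ('m \<Rightarrow> 'm tangent \<Rightarrow> real)) set" where
  "sobolev_mean_zero A F p = {(f, \<omega>) \<in> sobolev A F p.
     \<not> (AE x in bh_measure A F. f x = 0) \<and>
     (\<integral>x. \<bar>f x\<bar> powr (p - 2) * f x \<partial>bh_measure A F) = 0}"

definition first_eigenvalue ::
  "('m::topological_space, 'n::finite) chart set \<Rightarrow> 'm finsler \<Rightarrow> real \<Rightarrow> ennreal" where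
  "first_eigenvalue A F p = (INF (f, \<omega>)\<in>sobolev_mean_zero A F p.
     (\<integral>\<^sup>+x. ennreal (F x (legendre A F x (\<omega> x)) powr p) \<partial>bh_measure A F) /
     (\<integral>\<^sup>+x. ennreal (\<bar>f x\<bar> powr p) \<partial>bh_measure A F))"

end

theory Submission
  imports Defs
begin

text \<open>
  Let \<open>F\<close> range over the conformal class of \<open>F\<^sub>1\<close>, so \<open>F = \<phi> F\<^sub>1\<close>, let \<open>\<mu>\<close> be the measure of
  \<open>F\<close> and \<open>V\<close> its total mass.  A single test function of the form \<open>f = u - t\<close> bounds the
  eigenvalue, where \<open>u\<close> is a smooth bump function with values in \<open>[0,1]\<close> that is bounded below by a
  constant \<open>\<alpha> > 0\<close> on a small coordinate ball, vanishes outside the ball of twice the radius \<open>r\<close>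
  and has slope \<open>O(1/r)\<close>, and \<open>t\<close> is chosen by the intermediate value theorem so that \<open>f\<close> has
  vanishing \<open>p\<close>-mean.  Two facts make this work uniformly in \<open>\<phi>\<close>.

  The energy.  The density of \<open>\<mu>\<close> is \<open>\<phi>\<^sup>n\<close> times that of \<open>F\<^sub>1\<close>, while gradients scale with
  \<open>\<phi>\<^sup>-\<^sup>1\<close>, so the integral of \<open>F(\<nabla>f)\<^sup>n\<close> does not depend on \<open>\<phi>\<close>; it is of order
  \<open>r\<^sup>-\<^sup>n\<close> times the volume of a ball of radius \<open>2r\<close>, hence bounded.  For \<open>p \<le> n\<close> the elementary
  inequality \<open>s\<^sup>p \<le> 1 + s\<^sup>n\<close>, applied to \<open>s = F(\<nabla>f) V\<^bsup>1/n\<^esup>\<close>, turns this into a bound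
  of the \<open>p\<close>-energy by a constant times \<open>V\<^bsup>1-p/n\<^esup>\<close> (lemma \<open>energy_le\<close>).

  The mass.  Whatever \<open>t\<close> is, \<open>f\<close> is at least \<open>\<alpha>/2\<close> in absolute value on the small ball or outside
  the big one, so it suffices that both sets carry a fixed fraction of \<open>V\<close>.  By compactness one of
  finitely many coordinate balls has mass at least \<open>V/k\<close>.  In its chart,
  take a ball of a radius \<open>r\<close> that has a fixed fraction of that mass, while no ball of radius
  \<open>r/2\<close> has.  The doubled ball is covered by \<open>N\<close> balls of radius \<open>r/2\<close>, so at least half of
  the mass lies outside it (lemmas \<open>concentrated_ball\<close> and
  \<open>concentrated_chart_ball\<close>).  Such a radius exists because the density of \<open>\<mu>\<close> is locally bounded.

  Together, the Rayleigh quotient of \<open>f\<close> is at most a constant times \<open>V\<^bsup>1-p/n\<^esup> / V\<close>, where the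
  constant depends on \<open>p\<close>, on \<open>F\<^sub>1\<close> and on the charts only.

  Before that, the objects of the statement have to be shown to exist.  The Legendre transform is
  well defined because \<open>F\<^sup>2\<close> is strictly convex away from the origin and grows quadratically.  The
  Busemann--Hausdorff measure is glued from the charts; the change of variables formula shows that
  the pieces agree.
\<close>

section \<open>Calculus of iterated directional derivatives\<close>

lemma Ck_on_cong:
  assumes "open S" "\<And>x. x \<in> S \<Longrightarrow> f x = g x" "Ck_on k S f"
  shows "Ck_on k S g"
  using assms(2,3)
proof (induction k arbitrary: f g)
  case 0
  then show ?case by (simp cong: continuous_on_cong)
next
  case (Suc k)
  have eq: "frechet_derivative f (at x) = frechet_derivative g (at x)" and d: "g differentiable (at x)"
    if "x \<in> S" for x
  proof -
    have "(f has_derivative frechet_derivative f (at x)) (at x)"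
      using Suc.prems that by (simp add: frechet_derivative_works)
    then have "(g has_derivative frechet_derivative f (at x)) (at x)"
      by (rule has_derivative_transform_within_open[OF _ assms(1) that Suc.prems(1)])
    then show "frechet_derivative f (at x) = frechet_derivative g (at x)" "g differentiable (at x)"
      by (auto simp: frechet_derivative_at differentiable_def)
  qed
  have "Ck_on k S (\<lambda>x. frechet_derivative g (at x) u)" for u
    by (rule Suc.IH[of "\<lambda>x. frechet_derivative f (at x) u"]) (use Suc.prems eq in auto)
  then show ?case using d by simp
qed

lemma Ck_on_local:
  assumes "\<And>x. x \<in> S \<Longrightarrow> \<exists>T. open T \<and> x \<in> T \<and> Ck_on k T f"
  shows "Ck_on k S f"
  using assms
proof (induction k arbitrary: f)
  case 0
  have "isCont f x" if "x \<in> S" for x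
    using 0[OF that] by (auto simp: continuous_on_eq_continuous_at)
  then show ?case by (simp add: continuous_at_imp_continuous_on)
next
  case (Suc k)
  have "f differentiable (at x)" if "x \<in> S" for x
    using Suc.prems[OF that] by auto
  moreover have "Ck_on k S (\<lambda>x. frechet_derivative f (at x) u)" for u
    by (rule Suc.IH) (use Suc.prems in fastforce)
  ultimately show ?case by simp
qed

lemma Ck_on_Suc_imp: "Ck_on (Suc k) S f \<Longrightarrow> Ck_on k S f"
proof (induction k arbitrary: f)
  case 0
  then show ?case
    by (auto intro!: continuous_at_imp_continuous_on differentiable_imp_continuous_within)
next
  case (Suc k)
  then show ?case by (auto simp del: Ck_on.simps(1))
qed

lemma Ck_on_const: "Ck_on k S (\<lambda>x. c)"
  by (induction k arbitrary: c) auto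

text \<open>For an open set, the Frechet derivative may be replaced by any explicit formula for it; the
  closure properties below are inductions with this rule.\<close>

lemma Ck_on_SucI:
  assumes "open S" "\<And>x. x \<in> S \<Longrightarrow> (f has_derivative D x) (at x)"
    "\<And>u. Ck_on k S (\<lambda>x. D x u)"
  shows "Ck_on (Suc k) S f"
proof -
  have "Ck_on k S (\<lambda>x. frechet_derivative f (at x) u)" for u
    by (rule Ck_on_cong[OF assms(1) _ assms(3)[of u]]) (metis assms(2) frechet_derivative_at)
  then show ?thesis using assms(2) by (auto simp: differentiable_def)
qed

lemma Ck_on_has_derivative:
  "Ck_on (Suc k) S f \<Longrightarrow> x \<in> S \<Longrightarrow> (f has_derivative frechet_derivative f (at x)) (at x)"
  by (simp add: frechet_derivative_works)

lemma Ck_on_add: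
  assumes "open S"
  shows "Ck_on k S f \<Longrightarrow> Ck_on k S g \<Longrightarrow> Ck_on k S (\<lambda>x. f x + g x)"
proof (induction k arbitrary: f g)
  case 0
  then show ?case by (auto intro: continuous_intros)
next
  case (Suc k)
  show ?case
    by (rule Ck_on_SucI[OF assms has_derivative_add[OF Ck_on_has_derivative Ck_on_has_derivative]])
      (use Suc in auto)
qed

lemma Ck_on_sum:
  assumes "open S" "\<And>i. i \<in> I \<Longrightarrow> Ck_on k S (f i)"
  shows "Ck_on k S (\<lambda>x. \<Sum>i\<in>I. f i x)"
  using assms(2)
proof (induction I rule: infinite_finite_induct)
  case (insert i I)
  then show ?case by (simp add: Ck_on_add[OF assms(1)])
qed (simp_all add: Ck_on_const)

lemma Ck_on_mult:
  fixes f g :: "'a::real_normed_vector \<Rightarrow> real"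
  assumes "open S"
  shows "Ck_on k S f \<Longrightarrow> Ck_on k S g \<Longrightarrow> Ck_on k S (\<lambda>x. f x * g x)"
proof (induction k arbitrary: f g)
  case 0
  then show ?case by (auto intro: continuous_intros)
next
  case (Suc k)
  show ?case
  proof (rule Ck_on_SucI[OF assms has_derivative_mult[OF Ck_on_has_derivative Ck_on_has_derivative]])
    fix u
    show "Ck_on k S (\<lambda>x. f x * frechet_derivative g (at x) u + frechet_derivative f (at x) u * g x)"
      by (intro Ck_on_add[OF assms] Suc.IH Ck_on_Suc_imp[OF Suc.prems(1)] Ck_on_Suc_imp[OF Suc.prems(2)])
        (use Suc.prems in auto)
  qed (use Suc.prems in auto)
qed

lemma Ck_on_bounded_linear:
  assumes "open S" "bounded_linear L"
  shows "Ck_on k S f \<Longrightarrow> Ck_on k S (\<lambda>x. L (f x))"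
proof (induction k arbitrary: f)
  case 0
  then show ?case by (auto intro: bounded_linear.continuous_on[OF assms(2)])
next
  case (Suc k)
  show ?case
    by (rule Ck_on_SucI[OF assms(1) bounded_linear.has_derivative[OF assms(2) Ck_on_has_derivative]])
      (use Suc in auto)
qed

lemma Ck_on_ident:
  assumes "open S"
  shows "Ck_on k S (\<lambda>x. x)"
  by (cases k) (auto simp: Ck_on_const continuous_on_id intro!: Ck_on_SucI[OF assms has_derivative_ident])

text \<open>The derivative of a composition is expanded in a basis of the intermediate space, so that
  it becomes a sum of products to which the induction hypothesis applies.\<close>

lemma Ck_on_compose:
  fixes f :: "'a::real_normed_vector \<Rightarrow> 'b::euclidean_space" and g :: "'b \<Rightarrow> real"
  assumes "open S" "f ` S \<subseteq> T"
  shows "Ck_on k S f \<Longrightarrow> Ck_on k T g \<Longrightarrow> Ck_on k S (\<lambda>x. g (f x))"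
proof (induction k arbitrary: g)
  case 0
  then show ?case using assms continuous_on_compose2 by (metis Ck_on.simps(1))
next
  case (Suc k)
  have dg: "(g has_derivative frechet_derivative g (at (f x))) (at (f x))" if "x \<in> S" for x
    using Ck_on_has_derivative[OF Suc.prems(2)] that assms(2) by blast
  have df: "(f has_derivative frechet_derivative f (at x)) (at x)" if "x \<in> S" for x
    using Ck_on_has_derivative[OF Suc.prems(1)] that by blast
  let ?D = "\<lambda>x u. \<Sum>b\<in>Basis. (frechet_derivative f (at x) u \<bullet> b) * frechet_derivative g (at (f x)) b"
  have eq: "frechet_derivative g (at (f x)) (frechet_derivative f (at x) u) = ?D x u" if "x \<in> S" for x u
  proof -
    have lin: "linear (frechet_derivative g (at (f x)))"
      using dg[OF that] has_derivative_linear by blast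
    have "frechet_derivative g (at (f x)) (\<Sum>b\<in>Basis. (frechet_derivative f (at x) u \<bullet> b) *\<^sub>R b) = ?D x u"
      by (simp add: linear_sum[OF lin] linear_scale[OF lin])
    then show ?thesis by (simp add: euclidean_representation)
  qed
  show ?case
  proof (rule Ck_on_SucI[OF assms(1)])
    fix x assume "x \<in> S"
    then show "((\<lambda>x. g (f x)) has_derivative ?D x) (at x)"
      using has_derivative_compose[OF df dg] by (simp add: eq)
  next
    fix u
    have "Ck_on k S (\<lambda>x. frechet_derivative f (at x) u \<bullet> b)" for b
      by (rule Ck_on_bounded_linear[OF assms(1) bounded_linear_inner_left]) (use Suc.prems in auto)
    moreover have "Ck_on k S (\<lambda>x. frechet_derivative g (at (f x)) b)" for b
      by (rule Suc.IH) (use Suc.prems Ck_on_Suc_imp in auto)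
    ultimately show "Ck_on k S (\<lambda>x. ?D x u)"
      by (intro Ck_on_sum Ck_on_mult assms(1))
  qed
qed

lemma smooth_on_continuous: "smooth_on S f \<Longrightarrow> continuous_on S f"
  unfolding smooth_on_def by (metis Ck_on.simps(1))

lemma smooth_on_has_derivative:
  "smooth_on S f \<Longrightarrow> x \<in> S \<Longrightarrow> (f has_derivative frechet_derivative f (at x)) (at x)"
  unfolding smooth_on_def using Ck_on_has_derivative by blast

lemma smooth_on_derivative:
  "smooth_on S f \<Longrightarrow> smooth_on S (\<lambda>x. frechet_derivative f (at x) u)"
  unfolding smooth_on_def by (metis Ck_on.simps(2))

section \<open>Smoothness of the flat exponential\<close>

text \<open>These functions are closed under differentiation: in the variable \<open>s = 1/x\<close> the derivative of
  \<open>P(s) e\<^sup>-\<^sup>s\<close> with respect to \<open>x\<close> is \<open>s\<^sup>2 (P(s) - P'(s)) e\<^sup>-\<^sup>s\<close>.\<close>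

definition flat_exp :: "real poly \<Rightarrow> real \<Rightarrow> real" where
  "flat_exp P x = (if 0 < x then poly P (1 / x) * exp (- (1 / x)) else 0)"

text \<open>This makes all difference quotients at \<open>0\<close> converge to \<open>0\<close> after the substitution \<open>s = 1/x\<close>.\<close>

lemma poly_times_exp_neg_tendsto_0:
  "((\<lambda>s::real. poly P s * exp (- s)) \<longlongrightarrow> 0) at_top"
proof -
  have "((\<lambda>s::real. \<Sum>i\<le>degree P. coeff P i * (s ^ i / exp s)) \<longlongrightarrow> (\<Sum>i\<le>degree P. coeff P i * 0)) at_top"
    by (intro tendsto_intros tendsto_power_div_exp_0)
  moreover have "(\<lambda>s::real. \<Sum>i\<le>degree P. coeff P i * (s ^ i / exp s)) = (\<lambda>s. poly P s * exp (- s))"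
    by (auto simp: poly_altdef exp_minus divide_inverse sum_distrib_right mult.assoc)
  ultimately show ?thesis by simp
qed

lemma flat_exp_has_derivative:
  "(flat_exp P has_field_derivative flat_exp ([:0, 0, 1:] * (P - pderiv P)) x) (at x)"
proof -
  consider "x > 0" | "x < 0" | "x = 0" by linarith
  then show ?thesis
  proof cases
    case 1
    have "((\<lambda>x. poly P (1 / x) * exp (- (1 / x))) has_field_derivative
        flat_exp ([:0, 0, 1:] * (P - pderiv P)) x) (at x)"
      using 1 by (auto intro!: derivative_eq_intros DERIV_chain'[OF _ poly_DERIV]
          simp: flat_exp_def field_simps power2_eq_square)
    then show ?thesis
      by (rule has_field_derivative_transform_within_open[where S="{0<..}"])
        (use 1 in \<open>auto simp: flat_exp_def\<close>)
  next
    case 2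
    have "((\<lambda>x. 0) has_field_derivative flat_exp ([:0, 0, 1:] * (P - pderiv P)) x) (at x)"
      using 2 by (simp add: flat_exp_def)
    then show ?thesis
      by (rule has_field_derivative_transform_within_open[where S="{..<0}"])
        (use 2 in \<open>auto simp: flat_exp_def\<close>)
  next
    case 3
    have "((\<lambda>h. flat_exp P h / h) \<longlongrightarrow> 0) (at_right 0)"
    proof (rule Lim_transform_eventually)
      show "((\<lambda>h. poly (pCons 0 P) (inverse h) * exp (- inverse h)) \<longlongrightarrow> 0) (at_right 0)"
        by (rule filterlim_compose[OF poly_times_exp_neg_tendsto_0 filterlim_inverse_at_top_right])
      show "\<forall>\<^sub>F h in at_right 0. poly (pCons 0 P) (inverse h) * exp (- inverse h) = flat_exp P h / h"
        by (auto simp: eventually_at_filter flat_exp_def field_simps)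
    qed
    moreover have "((\<lambda>h. flat_exp P h / h) \<longlongrightarrow> 0) (at_left 0)"
      by (rule Lim_transform_eventually[OF tendsto_const])
        (auto simp: eventually_at_filter flat_exp_def)
    ultimately have "((\<lambda>h. flat_exp P h / h) \<longlongrightarrow> 0) (at 0)"
      by (simp add: filterlim_split_at)
    then show ?thesis using 3 by (simp add: DERIV_def flat_exp_def)
  qed
qed

lemma Ck_on_flat_exp: "Ck_on k UNIV (flat_exp P)"
proof (induction k arbitrary: P)
  case 0
  then show ?case
    using flat_exp_has_derivative DERIV_isCont continuous_at_imp_continuous_on by (metis Ck_on.simps(1))
next
  case (Suc k)
  show ?case
    by (rule Ck_on_SucI[OF open_UNIV, where D = "\<lambda>x u. flat_exp ([:0, 0, 1:] * (P - pderiv P)) x * u"])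
      (use flat_exp_has_derivative[of P] in \<open>auto simp: has_field_derivative_def
        intro!: Ck_on_mult Ck_on_const Suc.IH\<close>)
qed

section \<open>Change of variables for nonnegative integrals\<close>

text \<open>Jacobian determinants are taken over a well-ordered index type.  Every finite type has a
  well-ordered copy, and renaming coordinates preserves Lebesgue measure, so the change of variables
  formula carries over to all finite index types.\<close>

typedef 'a wo = "UNIV :: 'a set" ..

instance wo :: (finite) finite
proof
  have "range (Abs_wo :: 'a \<Rightarrow> 'a wo) = UNIV"
    by (metis Rep_wo_inverse surjI)
  then show "finite (UNIV :: 'a wo set)"
    using finite_imageI[OF finite, of Abs_wo "UNIV :: 'a set"] by simp
qed

definition wo_rank :: "'a::finite wo \<Rightarrow> nat" where
  "wo_rank = (SOME r. inj r)"

lemma inj_wo_rank: "inj (wo_rank :: 'a::finite wo \<Rightarrow> nat)"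
proof -
  have "\<exists>r :: 'a wo \<Rightarrow> nat. inj r"
    using finite_imp_inj_to_nat_seg[OF finite, of "UNIV :: 'a wo set"] by blast
  then show ?thesis unfolding wo_rank_def by (rule someI_ex)
qed

instantiation wo :: (finite) wellorder
begin

definition "x \<le> y \<longleftrightarrow> wo_rank x \<le> wo_rank y"

definition "x < y \<longleftrightarrow> wo_rank x < wo_rank y"

instance
proof
  fix x y :: "'a wo"
  show "x \<le> y \<Longrightarrow> y \<le> x \<Longrightarrow> x = y"
    by (simp add: less_eq_wo_def inj_eq[OF inj_wo_rank])
next
  fix P :: "'a wo \<Rightarrow> bool" and a
  assume H: "\<And>x. (\<And>y. y < x \<Longrightarrow> P y) \<Longrightarrow> P x"
  show "P a"
    by (induction a rule: measure_induct_rule[of wo_rank]) (rule H, simp add: less_wo_def)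
qed (auto simp: less_eq_wo_def less_wo_def)

end

definition to_wo :: "real ^ 'n \<Rightarrow> real ^ ('n::finite wo)" where
  "to_wo x = (\<chi> i. x $ Rep_wo i)"

definition of_wo :: "real ^ ('n::finite wo) \<Rightarrow> real ^ 'n" where
  "of_wo x = (\<chi> i. x $ Abs_wo i)"

lemma to_wo_of_wo [simp]: "to_wo (of_wo x) = x" "of_wo (to_wo y) = y"
  by (simp_all add: to_wo_def of_wo_def vec_eq_iff Rep_wo_inverse Abs_wo_inverse)

lemma linear_to_wo: "linear to_wo"
  by (auto intro!: linearI simp: to_wo_def vec_eq_iff)

lemma linear_of_wo: "linear of_wo"
  by (auto intro!: linearI simp: of_wo_def vec_eq_iff)

lemma borel_of_wo [measurable]: "of_wo \<in> borel \<rightarrow>\<^sub>M borel"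
  by (intro borel_measurable_continuous_onI linear_continuous_on linear_of_wo[unfolded linear_conv_bounded_linear])

text \<open>A permutation of the coordinates maps boxes to boxes with the same side lengths.\<close>

lemma distr_of_wo: "distr lborel borel of_wo = (lborel :: (real ^ 'n::finite) measure)"
proof (rule lborel_eqI[symmetric])
  fix l u :: "real ^ 'n"
  assume le: "\<And>b. b \<in> Basis \<Longrightarrow> l \<bullet> b \<le> u \<bullet> b"
  have le': "l $ i \<le> u $ i" for i
    using le[of "axis i 1"] by (auto simp: inner_axis Basis_vec_def)
  have pre: "of_wo -` box l u = box (to_wo l) (to_wo u)"
    by (auto simp: mem_box_cart to_wo_def of_wo_def) (metis Abs_wo_inverse UNIV_I Rep_wo_inverse)+
  have prod_axis: "(\<Prod>b\<in>Basis. (x :: real ^ 'k::finite) \<bullet> b) = (\<Prod>i\<in>UNIV. x $ i)" for x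
    by (subst Basis_vec_def)
       (simp add: prod.UNION_disjoint image_Union inner_axis prod.reindex inj_on_def axis_eq_axis UNION_singleton_eq_range)
  have "(\<Prod>i\<in>UNIV. (u - l) $ i) = (\<Prod>i\<in>UNIV. (to_wo u - to_wo l) $ i)"
    by (rule prod.reindex_bij_witness[of _ Rep_wo Abs_wo]) (auto simp: to_wo_def Rep_wo_inverse Abs_wo_inverse)
  moreover have "to_wo l \<bullet> b \<le> to_wo u \<bullet> b" if "b \<in> Basis" for b
    using that le' by (auto simp: Basis_vec_def inner_axis to_wo_def)
  ultimately show "emeasure (distr lborel borel of_wo) (box l u) = ennreal (\<Prod>b\<in>Basis. (u - l) \<bullet> b)"
    by (simp add: emeasure_distr pre emeasure_lborel_box prod_axis)
qed simp

text \<open>The absolute value of the determinant, computed in the well-ordered copy.\<close>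

definition absdet :: "(real ^ 'n \<Rightarrow> real ^ 'n::finite) \<Rightarrow> real" where
  "absdet L = \<bar>det (matrix (\<lambda>x. to_wo (L (of_wo x))))\<bar>"

lemma to_wo_image: "to_wo ` S = of_wo -` S"
  by (auto simp: image_iff) (metis to_wo_of_wo)+

lemma measure_linear_image_absdet:
  fixes L :: "real ^ 'n \<Rightarrow> real ^ 'n::finite"
  assumes "linear L" "B \<in> sets borel" "L ` B \<in> sets borel" "emeasure lborel B < \<infinity>"
  shows "measure lborel (L ` B) = absdet L * measure lborel B"
proof -
  have em: "emeasure lborel (to_wo ` C) = emeasure lborel C" if "C \<in> sets borel" for C :: "(real ^ 'n) set"
  proof -
    have "emeasure lborel C = emeasure (distr lborel borel of_wo) C"
      by (simp add: distr_of_wo)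
    also have "\<dots> = emeasure lborel (to_wo ` C)"
      using that by (subst emeasure_distr) (auto simp: to_wo_image)
    finally show ?thesis by simp
  qed
  have b: "to_wo ` C \<in> sets borel" if "C \<in> sets borel" for C :: "(real ^ 'n) set"
    unfolding to_wo_image using measurable_sets[OF borel_of_wo that] by simp
  have lin: "linear (\<lambda>x. to_wo (L (of_wo x)))"
    using linear_compose[OF linear_compose[OF linear_of_wo assms(1)] linear_to_wo] by (simp add: o_def)
  have "to_wo ` B \<in> lmeasurable"
    using assms b em by (auto simp: fmeasurable_def)
  then have "measure lebesgue ((\<lambda>x. to_wo (L (of_wo x))) ` to_wo ` B) = absdet L * measure lebesgue (to_wo ` B)"
    by (simp add: measure_linear_image[OF lin] absdet_def)
  moreover have "(\<lambda>x. to_wo (L (of_wo x))) ` to_wo ` B = to_wo ` L ` B"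
    by (simp add: image_comp o_def)
  ultimately show ?thesis
    using assms b em by (simp add: measure_def)
qed

lemma nn_integral_eq_integral_on:
  fixes f :: "'a::euclidean_space \<Rightarrow> real"
  assumes "f absolutely_integrable_on S" "\<And>x. 0 \<le> f x"
  shows "(\<integral>\<^sup>+x. ennreal (f x * indicator S x) \<partial>lborel) = ennreal (integral S f)"
proof -
  have "(\<integral>\<^sup>+x. ennreal (f x * indicator S x) \<partial>lebesgue) = ennreal (\<integral>x. f x * indicator S x \<partial>lebesgue)"
    using assms by (intro nn_integral_eq_integral) (auto simp: set_integrable_def mult.commute)
  also have "(\<integral>x. f x * indicator S x \<partial>lebesgue) = integral S f"
    using set_lebesgue_integral_eq_integral(2)[OF assms(1)]
    by (simp add: set_lebesgue_integral_def mult.commute)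
  finally show ?thesis by (simp add: nn_integral_completion)
qed

lemma nn_integral_eq_top_on:
  fixes f :: "'a::euclidean_space \<Rightarrow> real"
  assumes "\<not> f absolutely_integrable_on S" "\<And>x. 0 \<le> f x"
    "(\<lambda>x. f x * indicator S x) \<in> borel_measurable borel"
  shows "(\<integral>\<^sup>+x. ennreal (f x * indicator S x) \<partial>lborel) = \<infinity>"
proof (rule ccontr)
  assume "(\<integral>\<^sup>+x. ennreal (f x * indicator S x) \<partial>lborel) \<noteq> \<infinity>"
  then have "integrable lborel (\<lambda>x. f x * indicator S x)"
    using assms by (intro integrableI_bounded) (auto simp: less_top)
  then have "integrable lebesgue (\<lambda>x. f x * indicator S x)"
    by (simp add: integrable_completion assms(3))
  then show False
    using assms(1) by (simp add: set_integrable_def mult.commute)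
qed

text \<open>The formula for absolutely integrable functions says that both sides are finite together and then
  equal; if they are not finite, both nonnegative integrals are \<open>\<infinity>\<close>.\<close>

lemma nn_integral_change_of_variables_wellorder:
  fixes g :: "real ^ 'n::{finite,wellorder} \<Rightarrow> real ^ 'n::_" and f :: "real ^ 'n::_ \<Rightarrow> real"
  assumes "S \<in> sets borel" "\<And>x. x \<in> S \<Longrightarrow> (g has_derivative g' x) (at x)" "inj_on g S"
    "\<And>x. 0 \<le> f x" "(\<lambda>x. f x * indicator (g ` S) x) \<in> borel_measurable borel"
    "(\<lambda>x. \<bar>det (matrix (g' x))\<bar> * f (g x) * indicator S x) \<in> borel_measurable borel"
  shows "(\<integral>\<^sup>+x. ennreal (f x * indicator (g ` S) x) \<partial>lborel) =
    (\<integral>\<^sup>+x. ennreal (\<bar>det (matrix (g' x))\<bar> * f (g x) * indicator S x) \<partial>lborel)"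
proof -
  let ?k = "\<lambda>x. \<bar>det (matrix (g' x))\<bar> * f (g x)"
  let ?f = "\<lambda>x. vec (f x) :: real ^ 1"
  have cov: "(\<lambda>x. \<bar>det (matrix (g' x))\<bar> *\<^sub>R ?f (g x)) absolutely_integrable_on S \<and>
      integral S (\<lambda>x. \<bar>det (matrix (g' x))\<bar> *\<^sub>R ?f (g x)) = b
    \<longleftrightarrow> ?f absolutely_integrable_on (g ` S) \<and> integral (g ` S) ?f = b" for b
    by (rule has_absolute_integral_change_of_variables)
      (use assms in \<open>auto intro: has_derivative_at_withinI\<close>)
  have *: "(?k absolutely_integrable_on S \<and> integral S ?k = b) \<longleftrightarrow>
     (f absolutely_integrable_on (g ` S) \<and> integral (g ` S) f = b)" for b
    using cov[of "vec b"] by (simp add: absolutely_integrable_on_1_iff integral_on_1_eq vec_eq_iff)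
  show ?thesis
  proof (cases "f absolutely_integrable_on (g ` S)")
    case True
    then have "?k absolutely_integrable_on S" "integral S ?k = integral (g ` S) f" using * by auto
    then show ?thesis
      using nn_integral_eq_integral_on[OF True] nn_integral_eq_integral_on[where f = ?k and S = S] assms(4) by simp
  next
    case False
    then have "\<not> ?k absolutely_integrable_on S" using * by auto
    then show ?thesis
      using nn_integral_eq_top_on[OF False] nn_integral_eq_top_on[where f = ?k and S = S] assms by simp
  qed
qed

lemma nn_integral_change_of_variables:
  fixes g :: "real ^ 'n \<Rightarrow> real ^ 'n::finite" and f :: "real ^ 'n \<Rightarrow> real"
  assumes S: "S \<in> sets borel" and g: "\<And>x. x \<in> S \<Longrightarrow> (g has_derivative g' x) (at x)"
    and inj: "inj_on g S" and f0: "\<And>x. 0 \<le> f x"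
    and [measurable]: "(\<lambda>x. f x * indicator (g ` S) x) \<in> borel_measurable borel"
      "(\<lambda>x. absdet (g' x) * f (g x) * indicator S x) \<in> borel_measurable borel"
  shows "(\<integral>\<^sup>+x. ennreal (f x * indicator (g ` S) x) \<partial>lborel) =
    (\<integral>\<^sup>+x. ennreal (absdet (g' x) * f (g x) * indicator S x) \<partial>lborel)"
proof -
  let ?g = "\<lambda>x. to_wo (g (of_wo x))" and ?f = "\<lambda>x. f (of_wo x)" and ?S = "to_wo ` S"
  let ?g' = "\<lambda>x u. to_wo (g' (of_wo x) (of_wo u))"
  have im: "?g ` ?S = to_wo ` g ` S" by (simp add: image_comp o_def)
  have ind: "indicator (to_wo ` C) x = (indicator C (of_wo x) :: real)" for C :: "(real ^ 'n) set" and x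
    by (simp add: to_wo_image indicator_def)
  have "(\<integral>\<^sup>+x. ennreal (?f x * indicator (?g ` ?S) x) \<partial>lborel) =
    (\<integral>\<^sup>+x. ennreal (\<bar>det (matrix (?g' x))\<bar> * ?f (?g x) * indicator ?S x) \<partial>lborel)"
  proof (rule nn_integral_change_of_variables_wellorder)
    show "?S \<in> sets borel"
      unfolding to_wo_image using measurable_sets[OF borel_of_wo S] by simp
    show "(?g has_derivative ?g' x) (at x)" if "x \<in> ?S" for x
    proof -
      have "(g has_derivative g' (of_wo x)) (at (of_wo x))" using that g by auto
      moreover have "(of_wo has_derivative of_wo) (at x)"
        using linear_imp_has_derivative linear_of_wo by blast
      ultimately have "((\<lambda>x. g (of_wo x)) has_derivative (\<lambda>u. g' (of_wo x) (of_wo u))) (at x)"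
        using has_derivative_compose by blast
      then show ?thesis
        using bounded_linear.has_derivative linear_to_wo by (auto simp: linear_conv_bounded_linear)
    qed
    show "inj_on ?g ?S" using inj by (auto simp: inj_on_def) (metis to_wo_of_wo)
    show "(\<lambda>x. ?f x * indicator (?g ` ?S) x) \<in> borel_measurable borel"
      unfolding im ind by measurable
    have "(\<lambda>x. absdet (g' (of_wo x)) * f (g (of_wo x)) * indicator S (of_wo x)) \<in> borel_measurable borel"
      by measurable
    then show "(\<lambda>x. \<bar>det (matrix (?g' x))\<bar> * ?f (?g x) * indicator ?S x) \<in> borel_measurable borel"
      by (simp add: absdet_def ind)
  qed (use f0 in auto)
  then have *: "(\<integral>\<^sup>+x. ennreal (f (of_wo x) * indicator (g ` S) (of_wo x)) \<partial>lborel) =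
     (\<integral>\<^sup>+x. ennreal (absdet (g' (of_wo x)) * f (g (of_wo x)) * indicator S (of_wo x)) \<partial>lborel)"
    unfolding im ind by (simp add: absdet_def)
  have "(\<integral>\<^sup>+x. h (of_wo x) \<partial>lborel) = (\<integral>\<^sup>+x. h x \<partial>lborel)"
    if [measurable]: "h \<in> borel_measurable borel" for h :: "real ^ 'n \<Rightarrow> ennreal"
  proof -
    have "(\<integral>\<^sup>+x. h x \<partial>distr lborel borel of_wo) = (\<integral>\<^sup>+x. h (of_wo x) \<partial>lborel)"
      by (rule nn_integral_distr) auto
    then show ?thesis by (simp add: distr_of_wo)
  qed
  note this[of "\<lambda>x. ennreal (f x * indicator (g ` S) x)"]
    this[of "\<lambda>x. ennreal (absdet (g' x) * f (g x) * indicator S x)"]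
  with * show ?thesis by simp
qed

section \<open>Charts and tangent vectors\<close>

locale smooth_manifold =
  fixes A :: "('m::{t2_space, second_countable_topology}, 'n::finite) chart set"
  assumes atlas: "smooth_atlas A"
begin

lemma
  assumes "c \<in> A"
  shows open_chart_dom: "open (chart_dom c)" and open_chart_img: "open (chart_img c)"
    and chart_inv_map [simp]: "\<And>x. x \<in> chart_dom c \<Longrightarrow> chart_inv c (chart_map c x) = x"
    and chart_map_inv [simp]: "\<And>y. y \<in> chart_img c \<Longrightarrow> chart_map c (chart_inv c y) = y"
    and chart_inv_in_dom [simp]: "\<And>y. y \<in> chart_img c \<Longrightarrow> chart_inv c y \<in> chart_dom c"
    and continuous_on_chart_map: "continuous_on (chart_dom c) (chart_map c)"
    and continuous_on_chart_inv: "continuous_on (chart_img c) (chart_inv c)"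
proof -
  have *: "open (chart_dom c)" "open (chart_img c)"
    "homeomorphism (chart_dom c) (chart_img c) (chart_map c) (chart_inv c)"
    using atlas assms by (auto simp: smooth_atlas_def)
  then show "open (chart_dom c)" "open (chart_img c)" 
    "\<And>x. x \<in> chart_dom c \<Longrightarrow> chart_inv c (chart_map c x) = x"
    "\<And>y. y \<in> chart_img c \<Longrightarrow> chart_map c (chart_inv c y) = y"
    "\<And>y. y \<in> chart_img c \<Longrightarrow> chart_inv c y \<in> chart_dom c"
    "continuous_on (chart_dom c) (chart_map c)"
    "continuous_on (chart_img c) (chart_inv c)"
    by (auto simp: homeomorphism_def inv_into_into)
qed

lemma chart_at: obtains c where "c \<in> A" "x \<in> chart_dom c"
proof -
  have "x \<in> (\<Union>c\<in>A. chart_dom c)" using atlas unfolding smooth_atlas_def by blast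
  then show ?thesis using that by blast
qed

lemma open_chart_map_image:
  assumes "c \<in> A" "open U"
  shows "open (chart_map c ` (chart_dom c \<inter> U))"
proof -
  have "chart_map c ` (chart_dom c \<inter> U) = chart_img c \<inter> chart_inv c -` U"
    using assms(1) by force
  then show ?thesis
    using continuous_open_preimage[OF continuous_on_chart_inv open_chart_img] assms by simp
qed

lemma transition_smooth:
  assumes "c \<in> A" "d \<in> A"
  shows "smooth_on (chart_map c ` (chart_dom c \<inter> chart_dom d)) (chart_map d \<circ> chart_inv c)"
  using atlas assms by (auto simp: smooth_atlas_def)

definition transition_derivative ::
  "('m, 'n) chart \<Rightarrow> ('m, 'n) chart \<Rightarrow> real ^ 'n \<Rightarrow> real ^ 'n \<Rightarrow> real ^ 'n" where
  "transition_derivative c d y = frechet_derivative (chart_map d \<circ> chart_inv c) (at y)"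

lemma transition_has_derivative:
  assumes "c \<in> A" "d \<in> A" "x \<in> chart_dom c" "x \<in> chart_dom d"
  shows "(chart_map d \<circ> chart_inv c has_derivative transition_derivative c d (chart_map c x))
    (at (chart_map c x))"
  unfolding transition_derivative_def
  by (rule smooth_on_has_derivative[OF transition_smooth[OF assms(1,2)]]) (use assms in blast)

lemma transition_derivative_inverse:
  assumes "c \<in> A" "d \<in> A" "x \<in> chart_dom c" "x \<in> chart_dom d"
  shows "transition_derivative c d (chart_map c x) (transition_derivative d c (chart_map d x) w) = w"
proof -
  have "((\<lambda>y. (chart_map d \<circ> chart_inv c) ((chart_map c \<circ> chart_inv d) y)) has_derivative
     (\<lambda>w. transition_derivative c d (chart_map c x) (transition_derivative d c (chart_map d x) w)))
     (at (chart_map d x))"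
  proof (rule has_derivative_compose[OF transition_has_derivative[OF assms(2,1,4,3)]])
    show "(chart_map d \<circ> chart_inv c has_derivative transition_derivative c d (chart_map c x))
        (at ((chart_map c \<circ> chart_inv d) (chart_map d x)))"
      using transition_has_derivative[OF assms] assms by simp
  qed
  moreover have "((\<lambda>y. (chart_map d \<circ> chart_inv c) ((chart_map c \<circ> chart_inv d) y)) has_derivative
     (\<lambda>w. w)) (at (chart_map d x))"
    by (rule has_derivative_transform_within_open[OF has_derivative_ident
          open_chart_map_image[OF assms(2) open_chart_dom[OF assms(1)]]])
      (use assms in auto)
  ultimately show ?thesis
    by (rule has_derivative_unique[THEN fun_cong])
qed

lemma smooth_function_has_derivative:
  assumes "f \<in> smooth_functions A" "c \<in> A" "x \<in> chart_dom c"
  shows "(f \<circ> chart_inv c has_derivative frechet_derivative (f \<circ> chart_inv c) (at (chart_map c x)))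
    (at (chart_map c x))"
  using assms by (intro smooth_on_has_derivative[where S = "chart_img c"]) (auto simp: smooth_functions_def)

lemma linear_coord_vector:
  assumes "c \<in> A" "x \<in> chart_dom c"
  shows "linear (\<lambda>u. coord_vector A c x u f)"
proof (cases "f \<in> smooth_functions A")
  case True
  then show ?thesis
    using has_derivative_linear[OF smooth_function_has_derivative[OF True assms]]
    by (simp add: coord_vector_def)
next
  case False
  then show ?thesis by (simp add: coord_vector_def linear_zero)
qed

lemma coord_vector_scale:
  assumes "c \<in> A" "x \<in> chart_dom c"
  shows "coord_vector A c x (a *\<^sub>R u) = (\<lambda>f. a * coord_vector A c x u f)"
  using linear_scale[OF linear_coord_vector[OF assms]] by auto

text \<open>The chain rule; it makes the tangent space the range of the coordinate vectors of any one chart.\<close>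

lemma coord_vector_change:
  assumes "c \<in> A" "d \<in> A" "x \<in> chart_dom c" "x \<in> chart_dom d"
  shows "coord_vector A c x u = coord_vector A d x (transition_derivative c d (chart_map c x) u)"
proof
  fix f
  let ?y = "chart_map c x"
  show "coord_vector A c x u f = coord_vector A d x (transition_derivative c d ?y u) f"
  proof (cases "f \<in> smooth_functions A")
    case True
    have "((\<lambda>y. (f \<circ> chart_inv d) ((chart_map d \<circ> chart_inv c) y)) has_derivative
       (\<lambda>u. frechet_derivative (f \<circ> chart_inv d) (at (chart_map d x)) (transition_derivative c d ?y u))) (at ?y)"
    proof (rule has_derivative_compose[OF transition_has_derivative[OF assms]])
      show "(f \<circ> chart_inv d has_derivative frechet_derivative (f \<circ> chart_inv d) (at (chart_map d x)))
          (at ((chart_map d \<circ> chart_inv c) ?y))"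
        using smooth_function_has_derivative[OF True assms(2,4)] assms by simp
    qed
    then have "(f \<circ> chart_inv c has_derivative
       (\<lambda>u. frechet_derivative (f \<circ> chart_inv d) (at (chart_map d x)) (transition_derivative c d ?y u))) (at ?y)"
      by (rule has_derivative_transform_within_open[OF _
          open_chart_map_image[OF assms(1) open_chart_dom[OF assms(2)]]])
        (use assms in auto)
    then show ?thesis
      using True by (simp add: coord_vector_def frechet_derivative_at[symmetric])
  qed (simp add: coord_vector_def)
qed

lemma tangent_space_eq:
  assumes "c \<in> A" "x \<in> chart_dom c"
  shows "tangent_space A x = range (coord_vector A c x)"
proof
  show "tangent_space A x \<subseteq> range (coord_vector A c x)"
    unfolding tangent_space_def using coord_vector_change[OF _ assms(1) _ assms(2)] by blast
  show "range (coord_vector A c x) \<subseteq> tangent_space A x"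
    unfolding tangent_space_def using assms by blast
qed

lemma smooth_functions_const: "(\<lambda>x. a) \<in> smooth_functions A"
  by (simp add: smooth_functions_def smooth_on_def o_def Ck_on_const)

lemma smooth_functions_diff_const:
  assumes "f \<in> smooth_functions A"
  shows "(\<lambda>x. f x - a) \<in> smooth_functions A"
  unfolding smooth_functions_def
proof (intro CollectI ballI)
  fix c assume c: "c \<in> A"
  have "Ck_on k (chart_img c) (\<lambda>y. (f \<circ> chart_inv c) y + - a)" for k
    by (intro Ck_on_add open_chart_img c Ck_on_const)
      (use assms c in \<open>simp add: smooth_functions_def smooth_on_def del: o_apply comp_apply\<close>)
  then show "smooth_on (chart_img c) ((\<lambda>x. f x - a) \<circ> chart_inv c)"
    by (simp add: smooth_on_def o_def)
qed

lemma smooth_function_continuous: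
  assumes "f \<in> smooth_functions A"
  shows "continuous_on UNIV f"
proof (rule continuous_at_imp_continuous_on, intro ballI)
  fix x
  obtain c where c: "c \<in> A" "x \<in> chart_dom c" by (rule chart_at)
  have "continuous_on (chart_dom c) (\<lambda>x. (f \<circ> chart_inv c) (chart_map c x))"
    by (rule continuous_on_compose2[OF smooth_on_continuous continuous_on_chart_map, where t = "chart_img c"])
      (use assms c in \<open>auto simp: smooth_functions_def simp del: o_apply comp_apply\<close>)
  then have "continuous_on (chart_dom c) f"
    by (rule continuous_on_eq) (use c in auto)
  then show "isCont f x"
    using c open_chart_dom continuous_on_eq_continuous_at by blast
qed

end

section \<open>Finsler metrics in coordinates\<close>

locale finsler_manifold = smooth_manifold A
  for A :: "('m::{t2_space, second_countable_topology}, 'n::finite) chart set" +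
  fixes F :: "'m finsler"
  assumes finsler: "finsler_metric A F"
begin

abbreviation "G \<equiv> \<lambda>c. coord_finsler A c F"

lemma G_chart_map:
  assumes "c \<in> A" "x \<in> chart_dom c"
  shows "G c (chart_map c x) u = F x (coord_vector A c x u)"
  using assms by (simp add: coord_finsler_def)

lemma G_nonneg: "c \<in> A \<Longrightarrow> y \<in> chart_img c \<Longrightarrow> 0 \<le> G c y u"
  using finsler by (auto simp: finsler_metric_def coord_finsler_def tangent_space_eq)

lemma G_scale:
  assumes "c \<in> A" "y \<in> chart_img c" "0 \<le> a"
  shows "G c y (a *\<^sub>R u) = a * G c y u"
proof -
  have "coord_vector A c (chart_inv c y) u \<in> tangent_space A (chart_inv c y)"
    using assms by (simp add: tangent_space_eq)
  then have "F (chart_inv c y) (\<lambda>f. a * coord_vector A c (chart_inv c y) u f) =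
      a * F (chart_inv c y) (coord_vector A c (chart_inv c y) u)"
    using finsler assms(3) unfolding finsler_metric_def by blast
  then show ?thesis using assms by (simp add: coord_finsler_def coord_vector_scale)
qed

lemma G_zero [simp]: "c \<in> A \<Longrightarrow> y \<in> chart_img c \<Longrightarrow> G c y 0 = 0"
  using G_scale[of c y 0 0] by simp

lemma G_smooth: "c \<in> A \<Longrightarrow> smooth_on (chart_img c \<times> (UNIV - {0})) (\<lambda>(y, u). G c y u)"
  using finsler by (simp add: finsler_metric_def)

lemma G_fibre_smooth:
  assumes "c \<in> A" "y \<in> chart_img c"
  shows "smooth_on (UNIV - {0}) (\<lambda>u. (G c y u)\<^sup>2)"
  unfolding smooth_on_def
proof
  fix k
  have o: "open (UNIV - {0 :: real ^ 'n})" by auto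
  have lin: "bounded_linear (\<lambda>u :: real ^ 'n. (0 :: real ^ 'n, u))"
    by (intro bounded_linear_intros)
  have "Ck_on k (UNIV - {0}) (\<lambda>u :: real ^ 'n. (y, 0) + (0, u))"
    by (intro Ck_on_add[OF o] Ck_on_const Ck_on_bounded_linear[OF o lin] Ck_on_ident[OF o])
  then have "Ck_on k (UNIV - {0}) (\<lambda>u. (\<lambda>(y, u). G c y u) ((y, 0) + (0, u)))"
    by (rule Ck_on_compose[OF o, where T = "chart_img c \<times> (UNIV - {0})", rotated])
      (use assms G_smooth in \<open>auto simp: smooth_on_def\<close>)
  then have "Ck_on k (UNIV - {0}) (G c y)" by simp
  then show "Ck_on k (UNIV - {0}) (\<lambda>u. (G c y u)\<^sup>2)"
    unfolding power2_eq_square by (intro Ck_on_mult[OF o])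
qed

abbreviation "Q' c y u w \<equiv> frechet_derivative (\<lambda>u. (G c y u)\<^sup>2) (at u) w"

text \<open>The fundamental tensor is defined by partial derivatives along the coordinate axes.  Linearity of
  both derivatives turns its quadratic form into half the second derivative of \<open>F\<^sup>2\<close> in the
  direction \<open>w\<close>.\<close>

lemma energy_second_derivative_pos:
  assumes "c \<in> A" "y \<in> chart_img c" "u \<noteq> 0" "w \<noteq> 0"
  shows "frechet_derivative (\<lambda>z. Q' c y z w) (at u) w > 0"
proof -
  note sm = G_fibre_smooth[OF assms(1,2)]
  have lin: "linear (Q' c y z)" if "z \<noteq> 0" for z
    using has_derivative_linear[OF smooth_on_has_derivative[OF sm]] that by auto
  have d2: "((\<lambda>z. Q' c y z v) has_derivative frechet_derivative (\<lambda>z. Q' c y z v) (at u)) (at u)" for v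
    using smooth_on_has_derivative[OF smooth_on_derivative[OF sm]] assms(3) by auto
  have exp: "h w = (\<Sum>j\<in>UNIV. w $ j * h (axis j 1))" if "linear h" for h :: "real ^ 'n \<Rightarrow> real"
  proof -
    have "h w = h (\<Sum>j\<in>UNIV. w $ j *\<^sub>R axis j 1)"
      by (simp add: basis_expansion flip: scalar_mult_eq_scaleR)
    then show ?thesis by (simp add: linear_sum[OF that] linear_scale[OF that])
  qed
  have "((\<lambda>z. \<Sum>j\<in>UNIV. w $ j * Q' c y z (axis j 1)) has_derivative
     (\<lambda>v. \<Sum>j\<in>UNIV. w $ j * frechet_derivative (\<lambda>z. Q' c y z (axis j 1)) (at u) v)) (at u)"
    by (intro has_derivative_sum has_derivative_mult_right d2)
  then have "((\<lambda>z. Q' c y z w) has_derivative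
     (\<lambda>v. \<Sum>j\<in>UNIV. w $ j * frechet_derivative (\<lambda>z. Q' c y z (axis j 1)) (at u) v)) (at u)"
    by (rule has_derivative_transform_within_open[where s = "UNIV - {0}"])
      (use assms(3) in \<open>auto simp: exp[OF lin]\<close>)
  then have "frechet_derivative (\<lambda>z. Q' c y z w) (at u) w =
      (\<Sum>j\<in>UNIV. w $ j * frechet_derivative (\<lambda>z. Q' c y z (axis j 1)) (at u) w)"
    by (rule fun_cong[OF frechet_derivative_at, symmetric])
  also have "\<dots> = (\<Sum>j\<in>UNIV. w $ j * (\<Sum>i\<in>UNIV. w $ i * frechet_derivative (\<lambda>z. Q' c y z (axis j 1)) (at u) (axis i 1)))"
    by (subst exp[OF has_derivative_linear[OF d2]]) (rule refl)
  also have "\<dots> = 2 * (w \<bullet> (fundamental_tensor A c F y u *v w))"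
  proof -
    have "2 * (w \<bullet> (fundamental_tensor A c F y u *v w)) = (\<Sum>i\<in>UNIV. \<Sum>j\<in>UNIV.
        w $ j * (w $ i * frechet_derivative (\<lambda>z. Q' c y z (axis j 1)) (at u) (axis i 1)))"
      unfolding inner_vec_def matrix_vector_mult_def fundamental_tensor_def
      by (simp add: sum_distrib_left mult_ac)
    also have "\<dots> = (\<Sum>j\<in>UNIV. \<Sum>i\<in>UNIV.
        w $ j * (w $ i * frechet_derivative (\<lambda>z. Q' c y z (axis j 1)) (at u) (axis i 1)))"
      by (rule sum.swap)
    finally show ?thesis by (simp add: sum_distrib_left)
  qed
  moreover have "w \<bullet> (fundamental_tensor A c F y u *v w) > 0"
    using finsler assms unfolding finsler_metric_def by blast
  ultimately show ?thesis by simp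
qed

lemma energy_line_derivatives:
  assumes "c \<in> A" "y \<in> chart_img c" "p + t *\<^sub>R w \<noteq> 0"
  shows "((\<lambda>s. (G c y (p + s *\<^sub>R w))\<^sup>2) has_field_derivative Q' c y (p + t *\<^sub>R w) w) (at t)"
    and "((\<lambda>s. Q' c y (p + s *\<^sub>R w) w) has_field_derivative
       frechet_derivative (\<lambda>z. Q' c y z w) (at (p + t *\<^sub>R w)) w) (at t)"
proof -
  note sm = G_fibre_smooth[OF assms(1,2)]
  have line: "((\<lambda>s. p + s *\<^sub>R w) has_derivative (\<lambda>s. s *\<^sub>R w)) (at t)"
    by (auto intro!: derivative_eq_intros)
  have *: "((\<lambda>s. h (p + s *\<^sub>R w)) has_field_derivative h' w) (at t)"
    if "(h has_derivative h') (at (p + t *\<^sub>R w))" for h h'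
  proof -
    have "(\<lambda>s. h' (s *\<^sub>R w)) = (*) (h' w)"
      using linear_scale[OF has_derivative_linear[OF that]] by (auto simp: mult.commute)
    with has_derivative_compose[OF line that] show ?thesis
      by (simp only: has_field_derivative_def)
  qed
  show "((\<lambda>s. (G c y (p + s *\<^sub>R w))\<^sup>2) has_field_derivative Q' c y (p + t *\<^sub>R w) w) (at t)"
    by (rule *[OF smooth_on_has_derivative[OF sm]]) (use assms in auto)
  show "((\<lambda>s. Q' c y (p + s *\<^sub>R w) w) has_field_derivative
       frechet_derivative (\<lambda>z. Q' c y z w) (at (p + t *\<^sub>R w)) w) (at t)"
    by (rule *[OF smooth_on_has_derivative[OF smooth_on_derivative[OF sm]]]) (use assms in auto)
qed

text \<open>If \<open>F\<close> vanished at a nonzero vector, then by homogeneity \<open>F\<^sup>2\<close> would vanish along the whole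
  ray, so its second derivative in the direction of the ray would be zero.\<close>

lemma G_pos:
  assumes "c \<in> A" "y \<in> chart_img c" "u \<noteq> 0"
  shows "0 < G c y u"
proof (rule ccontr)
  assume "\<not> 0 < G c y u"
  then have 0: "G c y u = 0" using G_nonneg[OF assms(1,2), of u] by simp
  have nz: "u + t *\<^sub>R u \<noteq> 0" if "t > - 1" for t
  proof -
    have "u + t *\<^sub>R u = (1 + t) *\<^sub>R u" by (simp add: scaleR_left_distrib)
    then show ?thesis using that assms(3) by simp
  qed
  have ray: "(G c y (u + t *\<^sub>R u))\<^sup>2 = 0" if "t > - 1" for t
    using G_scale[OF assms(1,2), of "1 + t" u] that 0 by (simp add: scaleR_left_distrib)
  have "Q' c y (u + t *\<^sub>R u) u = 0" if "t > - 1" for t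
  proof -
    have "((\<lambda>s. 0) has_field_derivative Q' c y (u + t *\<^sub>R u) u) (at t)"
      by (rule has_field_derivative_transform_within_open[OF energy_line_derivatives(1)[OF assms(1,2) nz[OF that]],
            where S = "{-1<..}"]) (use that ray in auto)
    then show ?thesis by (rule DERIV_unique[OF _ DERIV_const])
  qed
  then have "((\<lambda>s. 0) has_field_derivative
       frechet_derivative (\<lambda>z. Q' c y z u) (at (u + 0 *\<^sub>R u)) u) (at 0)"
    by (intro has_field_derivative_transform_within_open[OF energy_line_derivatives(2)[OF assms(1,2) nz],
            where S = "{-1<..}"]) auto
  then have "frechet_derivative (\<lambda>z. Q' c y z u) (at (u + 0 *\<^sub>R u)) u = 0"
    by (rule DERIV_unique[OF _ DERIV_const])
  then have "frechet_derivative (\<lambda>z. Q' c y z u) (at u) u = 0" by simp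
  then show False using energy_second_derivative_pos[OF assms assms(3)] by simp
qed

text \<open>Comparison of \<open>F\<close> with the Euclidean norm of the coordinates, by homogeneity from the extrema of
  \<open>F\<close> on the compact product of \<open>K\<close> with the unit sphere.\<close>

lemma G_bounds:
  assumes "c \<in> A" "compact K" "K \<subseteq> chart_img c"
  obtains a b where "0 < a" "0 < b"
    "\<forall>y\<in>K. \<forall>u. a * norm u \<le> G c y u \<and> G c y u \<le> b * norm u"
proof (cases "K = {}")
  case True
  show ?thesis by (rule that[of 1 1]) (use True in auto)
next
  case False
  let ?S = "K \<times> sphere (0 :: real ^ 'n) 1"
  have S: "compact ?S" "?S \<noteq> {}"
    using assms False by (auto intro: compact_Times)
  have cont: "continuous_on ?S (\<lambda>(y, u). G c y u)"
    by (rule continuous_on_subset[OF smooth_on_continuous[OF G_smooth[OF assms(1)]]]) (use assms in auto)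
  obtain p where p: "p \<in> ?S" "\<And>q. q \<in> ?S \<Longrightarrow> (\<lambda>(y, u). G c y u) p \<le> (\<lambda>(y, u). G c y u) q"
    using continuous_attains_inf[OF S cont] by blast
  obtain r where r: "r \<in> ?S" "\<And>q. q \<in> ?S \<Longrightarrow> (\<lambda>(y, u). G c y u) q \<le> (\<lambda>(y, u). G c y u) r"
    using continuous_attains_sup[OF S cont] by blast
  let ?a = "G c (fst p) (snd p)" and ?b = "G c (fst r) (snd r)"
  have pos: "?a > 0" "?b > 0"
    using p(1) r(1) assms by (auto intro!: G_pos)
  have "?a * norm u \<le> G c y u \<and> G c y u \<le> ?b * norm u" if "y \<in> K" for y u
  proof (cases "u = 0")
    case True
    then show ?thesis using that assms by (auto simp: subset_iff)
  next
    case False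
    have "(y, u /\<^sub>R norm u) \<in> ?S" using that False by simp
    then have "?a \<le> G c y (u /\<^sub>R norm u)" "G c y (u /\<^sub>R norm u) \<le> ?b"
      using p(2) r(2) by (auto simp: case_prod_beta)
    moreover have "G c y u = norm u * G c y (u /\<^sub>R norm u)"
      using False G_scale[OF assms(1), of y "norm u" "u /\<^sub>R norm u"] that assms by auto
    ultimately show ?thesis by (simp add: mult.commute mult_left_mono)
  qed
  then show ?thesis using that[OF pos] by blast
qed

lemma G_bounds_at:
  assumes "c \<in> A" "y \<in> chart_img c"
  obtains a b where "0 < a" "0 < b" "\<forall>u. a * norm u \<le> G c y u \<and> G c y u \<le> b * norm u"
proof -
  have K: "compact {y}" "{y} \<subseteq> chart_img c" using assms(2) by auto
  obtain a b where "0 < a" "0 < b"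
    "\<forall>y'\<in>{y}. \<forall>u. a * norm u \<le> G c y' u \<and> G c y' u \<le> b * norm u"
    by (rule G_bounds[OF assms(1) K])
  then show ?thesis using that by simp
qed

text \<open>At the origin, where \<open>F\<close> need not be smooth, continuity follows from the comparison with the norm.\<close>

lemma continuous_on_G:
  assumes "c \<in> A" "y \<in> chart_img c"
  shows "continuous_on UNIV (G c y)"
proof (rule continuous_at_imp_continuous_on, intro ballI)
  fix u :: "real ^ 'n"
  obtain a b where b: "0 < b" "\<And>u. G c y u \<le> b * norm u"
    using G_bounds_at[OF assms] by metis
  show "isCont (G c y) u"
  proof (cases "u = 0")
    case True
    have lim: "((\<lambda>u :: real ^ 'n. b * norm u) \<longlongrightarrow> b * norm (0 :: real ^ 'n)) (at 0)"
      by (rule tendsto_mult[OF tendsto_const tendsto_norm[OF tendsto_ident_at]])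
    have "(G c y \<longlongrightarrow> 0) (at 0)"
    proof (rule tendsto_sandwich[OF _ _ tendsto_const])
      show "\<forall>\<^sub>F u in at 0. 0 \<le> G c y u" using G_nonneg[OF assms] by simp
      show "\<forall>\<^sub>F u in at 0. G c y u \<le> b * norm u" using b(2) by simp
      show "((\<lambda>u :: real ^ 'n. b * norm u) \<longlongrightarrow> 0) (at 0)" using lim by simp
    qed
    then show ?thesis using True assms by (simp add: isCont_def)
  next
    case False
    have "continuous_on (UNIV - {0}) (\<lambda>u. (\<lambda>(y, u). G c y u) (y, u))"
      by (rule continuous_on_compose2[OF smooth_on_continuous[OF G_smooth[OF assms(1)]]])
        (use assms in \<open>auto intro!: continuous_intros\<close>)
    then have "continuous_on (UNIV - {0}) (G c y)" by simp
    moreover have "open (UNIV - {0 :: real ^ 'n})" by auto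
    ultimately show ?thesis using False by (simp add: continuous_on_eq_continuous_at)
  qed
qed

text \<open>The objective is \<open>0\<close> at the origin and at most \<open>0\<close> outside a large ball, because the
  quadratic term dominates there.\<close>

lemma legendre_objective_attains_max:
  assumes "c \<in> A" "y \<in> chart_img c" "linear \<beta>"
  obtains u where "\<And>w. \<beta> w - 1 / 2 * (G c y w)\<^sup>2 \<le> \<beta> u - 1 / 2 * (G c y u)\<^sup>2"
proof -
  obtain a b where a: "0 < a" "\<And>u. a * norm u \<le> G c y u"
    using G_bounds_at[OF assms(1,2)] by metis
  obtain K where K: "K > 0" "\<And>u. \<bar>\<beta> u\<bar> \<le> norm u * K"
    using bounded_linear.pos_bounded[of \<beta>] assms(3) by (auto simp: linear_conv_bounded_linear)
  let ?J = "\<lambda>w. \<beta> w - 1 / 2 * (G c y w)\<^sup>2"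
  define R where "R = 2 * K / a\<^sup>2"
  have R: "R > 0" using K a by (simp add: R_def)
  have cont: "continuous_on (cball 0 R) ?J"
    by (intro continuous_intros continuous_on_subset[OF continuous_on_G[OF assms(1,2)]]
        linear_continuous_on) (use assms in \<open>auto simp: linear_conv_bounded_linear\<close>)
  have "cball (0 :: real ^ 'n) R \<noteq> {}" using R by simp
  from continuous_attains_sup[OF compact_cball this cont]
  obtain u where u: "\<And>w. w \<in> cball 0 R \<Longrightarrow> ?J w \<le> ?J u" by blast
  have 0: "0 \<le> ?J u"
    using u[of 0] R assms by (simp add: linear_0)
  have "?J w \<le> ?J u" for w
  proof (cases "w \<in> cball 0 R")
    case False
    then have w: "norm w > R" by simp
    have "(a * norm w)\<^sup>2 \<le> (G c y w)\<^sup>2"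
      using a by (intro power_mono) auto
    moreover have "2 * norm w * K \<le> (a * norm w)\<^sup>2"
    proof -
      have "2 * K \<le> a\<^sup>2 * norm w" using w a(1) by (simp add: R_def field_simps)
      then have "norm w * (2 * K) \<le> norm w * (a\<^sup>2 * norm w)" by (intro mult_left_mono) auto
      then show ?thesis by (simp add: power2_eq_square algebra_simps)
    qed
    ultimately have "?J w \<le> 0" using K(2)[of w] by (simp add: abs_le_iff)
    then show ?thesis using 0 by simp
  qed (rule u)
  then show ?thesis using that by blast
qed

text \<open>Stationarity of the objective along the ray through the maximizer \<open>u\<close>, where it is
  \<open>t \<beta>(u) - t\<^sup>2 F(u)\<^sup>2 / 2\<close>.\<close>

lemma legendre_maximizer_value:
  assumes "c \<in> A" "y \<in> chart_img c" "linear \<beta>"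
    "\<And>w. \<beta> w - 1 / 2 * (G c y w)\<^sup>2 \<le> \<beta> u - 1 / 2 * (G c y u)\<^sup>2"
  shows "(G c y u)\<^sup>2 = \<beta> u"
proof -
  have *: "t * \<beta> u - 1 / 2 * t\<^sup>2 * (G c y u)\<^sup>2 \<le> \<beta> u - 1 / 2 * (G c y u)\<^sup>2" if "t \<ge> 0" for t
    using assms(4)[of "t *\<^sub>R u"] that G_scale[OF assms(1,2) that] linear_scale[OF assms(3)]
    by (simp add: power_mult_distrib)
  have "((\<lambda>t. t * \<beta> u - 1 / 2 * t\<^sup>2 * (G c y u)\<^sup>2) has_field_derivative \<beta> u - (G c y u)\<^sup>2) (at 1)"
    by (auto intro!: derivative_eq_intros)
  then have "\<beta> u - (G c y u)\<^sup>2 = 0"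
    by (rule DERIV_local_max[where d = 1]) (use * in auto)
  then show ?thesis by simp
qed

text \<open>At a maximizer the objective is \<open>\<beta>/2 = F\<^sup>2/2\<close>, so \<open>\<beta>\<close> is nonnegative and takes the same value
  at two of them.  If the origin were on the segment between them, this value would be \<open>0\<close> and both
  maximizers would be the origin.  So \<open>F\<^sup>2\<close> is smooth along the segment, and the objective is strictly
  concave there, which leaves only one maximum.\<close>

lemma legendre_maximizer_unique:
  assumes "c \<in> A" "y \<in> chart_img c" "linear \<beta>"
    and u: "\<And>w. \<beta> w - 1 / 2 * (G c y w)\<^sup>2 \<le> \<beta> u - 1 / 2 * (G c y u)\<^sup>2"
    and v: "\<And>w. \<beta> w - 1 / 2 * (G c y w)\<^sup>2 \<le> \<beta> v - 1 / 2 * (G c y v)\<^sup>2"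
  shows "u = v"
proof (rule ccontr)
  assume "u \<noteq> v"
  have vals: "(G c y u)\<^sup>2 = \<beta> u" "(G c y v)\<^sup>2 = \<beta> v"
    by (rule legendre_maximizer_value[OF assms(1-3) u], rule legendre_maximizer_value[OF assms(1-3) v])
  have zero: "w = 0" if "\<beta> w = 0" "(G c y w)\<^sup>2 = \<beta> w" for w
  proof -
    have "G c y w = 0" using that by simp
    then show "w = 0" using G_pos[OF assms(1,2), of w] by force
  qed
  define w where "w = v - u"
  have w: "w \<noteq> 0" using \<open>u \<noteq> v\<close> by (simp add: w_def)
  have nz: "u + t *\<^sub>R w \<noteq> 0" if "0 \<le> t" "t \<le> 1" for t
  proof
    assume "u + t *\<^sub>R w = 0"
    then have "(1 - t) * \<beta> u + t * \<beta> v = 0"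
    proof -
      have "(1 - t) * \<beta> u + t * \<beta> v = \<beta> (u + t *\<^sub>R w)"
        by (simp add: w_def linear_add[OF assms(3)] linear_scale[OF assms(3)] linear_diff[OF assms(3)]
            algebra_simps)
      then show ?thesis using \<open>u + t *\<^sub>R w = 0\<close> linear_0[OF assms(3)] by simp
    qed
    moreover have "(1 - t) * \<beta> u \<ge> 0" "t * \<beta> v \<ge> 0"
      using that by (auto simp flip: vals)
    moreover have "\<beta> u = \<beta> v"
      using u[of v] v[of u] vals by simp
    ultimately have "\<beta> u = 0" "\<beta> v = 0" by (auto simp: algebra_simps)
    then have "u = 0" "v = 0" using zero vals by blast+
    then show False using \<open>u \<noteq> v\<close> by simp
  qed
  let ?g = "\<lambda>t. \<beta> u + t * \<beta> w - 1 / 2 * (G c y (u + t *\<^sub>R w))\<^sup>2"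
  let ?g' = "\<lambda>t. \<beta> w - 1 / 2 * Q' c y (u + t *\<^sub>R w) w"
  have g: "?g t = \<beta> (u + t *\<^sub>R w) - 1 / 2 * (G c y (u + t *\<^sub>R w))\<^sup>2" for t
    using linear_add[OF assms(3)] linear_scale[OF assms(3)] by simp
  have g': "(?g has_field_derivative ?g' t) (at t)" if "0 \<le> t" "t \<le> 1" for t
    using DERIV_diff[OF DERIV_add[OF DERIV_const DERIV_cmult_right[OF DERIV_ident]]
        DERIV_cmult[OF energy_line_derivatives(1)[OF assms(1,2) nz[OF that]], of "1 / 2"]]
    by simp
  have g'': "(?g' has_field_derivative - 1 / 2 * frechet_derivative (\<lambda>z. Q' c y z w) (at (u + t *\<^sub>R w)) w) (at t)"
    if "0 \<le> t" "t \<le> 1" for t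
    using DERIV_diff[OF DERIV_const
        DERIV_cmult[OF energy_line_derivatives(2)[OF assms(1,2) nz[OF that]], of "1 / 2"]]
    by simp
  have "?g 1 = ?g 0" using u[of v] v[of u] unfolding g by (simp add: w_def)
  then obtain \<xi> where \<xi>: "0 < \<xi>" "\<xi> < 1" "?g' \<xi> = 0"
    using MVT2[of 0 1 ?g ?g'] g' by auto
  have dec: "?g' t > ?g' \<xi>" if "0 \<le> t" "t < \<xi>" for t
  proof (rule DERIV_neg_imp_decreasing[OF that(2)])
    fix x assume "t \<le> x" "x \<le> \<xi>"
    then have x: "0 \<le> x" "x \<le> 1" using that \<xi> by auto
    show "\<exists>y. (?g' has_field_derivative y) (at x) \<and> y < 0"
      using g''[OF x] energy_second_derivative_pos[OF assms(1,2) nz[OF x] w] by fastforce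
  qed
  have "?g \<xi> > ?g 0"
  proof -
    obtain s where s: "0 < s" "s < \<xi>" "?g \<xi> - ?g 0 = (\<xi> - 0) * ?g' s"
      using MVT2[of 0 \<xi> ?g ?g'] g' \<xi> by auto
    have "0 < ?g' s" using dec[of s] s \<xi> by linarith
    then have "0 < (\<xi> - 0) * ?g' s" using \<xi>(1) by simp
    then show ?thesis using s(3) by linarith
  qed
  then show False using u[of "u + \<xi> *\<^sub>R w"] g[of 0] g[of \<xi>] by simp
qed

lemma legendre_coord:
  assumes "c \<in> A" "x \<in> chart_dom c" "linear (\<lambda>u. \<alpha> (coord_vector A c x u))"
  obtains u where "legendre A F x \<alpha> = coord_vector A c x u"
    "(F x (legendre A F x \<alpha>))\<^sup>2 = \<alpha> (coord_vector A c x u)"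
proof -
  let ?\<beta> = "\<lambda>u. \<alpha> (coord_vector A c x u)" and ?y = "chart_map c x"
  have y: "?y \<in> chart_img c" using assms by simp
  have G: "F x (coord_vector A c x u) = G c ?y u" for u
    using G_chart_map[OF assms(1,2)] by simp
  obtain u where u: "\<And>w. ?\<beta> w - 1 / 2 * (G c ?y w)\<^sup>2 \<le> ?\<beta> u - 1 / 2 * (G c ?y u)\<^sup>2"
    using legendre_objective_attains_max[OF assms(1) y assms(3)] by blast
  have "legendre A F x \<alpha> = coord_vector A c x u"
    unfolding legendre_def
  proof (rule the_equality)
    fix v assume v: "v \<in> tangent_space A x \<and>
      (\<forall>w\<in>tangent_space A x. \<alpha> w - 1 / 2 * (F x w)\<^sup>2 \<le> \<alpha> v - 1 / 2 * (F x v)\<^sup>2)"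
    then obtain u' where u': "v = coord_vector A c x u'" using tangent_space_eq[OF assms(1,2)] by auto
    have "u' = u"
      by (rule legendre_maximizer_unique[OF assms(1) y assms(3)])
        (use u v u' G tangent_space_eq[OF assms(1,2)] in auto)
    then show "v = coord_vector A c x u" using u' by simp
  qed (use u tangent_space_eq[OF assms(1,2)] in \<open>auto simp: G\<close>)
  then show ?thesis
    using that legendre_maximizer_value[OF assms(1) y assms(3) u] by (simp add: G)
qed

end

section \<open>The Busemann--Hausdorff measure\<close>

context smooth_manifold
begin

lemma measurable_chart_inv:
  assumes "c \<in> A"
  shows "chart_inv c \<in> borel_measurable (restrict_space borel (chart_img c))"
  by (rule borel_measurable_continuous_on_restrict[OF continuous_on_chart_inv[OF assms]])

lemma chart_map_image_eq:
  assumes "c \<in> A"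
  shows "chart_map c ` (B \<inter> chart_dom c) = chart_inv c -` B \<inter> chart_img c"
  using assms by force

lemma chart_map_image_subset_eq:
  assumes "c \<in> A" "B \<subseteq> chart_dom c"
  shows "chart_map c ` B = chart_inv c -` B \<inter> chart_img c"
  using chart_map_image_eq[OF assms(1), of B] assms(2) by (simp add: Int_absorb2)

lemma borel_chart_map_image:
  assumes "c \<in> A" "B \<in> sets borel" "B \<subseteq> chart_dom c"
  shows "chart_map c ` B \<in> sets borel"
proof -
  have "chart_inv c -` B \<inter> space (restrict_space borel (chart_img c)) \<in> sets (restrict_space borel (chart_img c))"
    by (rule measurable_sets[OF measurable_chart_inv[OF assms(1)] assms(2)])
  then have "chart_inv c -` B \<inter> chart_img c \<in> sets (restrict_space borel (chart_img c))"
    by (simp add: space_restrict_space)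
  then have "chart_inv c -` B \<inter> chart_img c \<in> sets borel"
    using open_chart_img[OF assms(1)] by (subst (asm) sets_restrict_space_iff) auto
  then show ?thesis by (simp add: chart_map_image_subset_eq[OF assms(1,3)])
qed

lemma borel_chart_dom [measurable]: "c \<in> A \<Longrightarrow> chart_dom c \<in> sets borel"
  by (simp add: open_chart_dom borel_open)

lemma borel_chart_img [measurable]: "c \<in> A \<Longrightarrow> chart_img c \<in> sets borel"
  by (simp add: open_chart_img borel_open)

text \<open>A Borel partition subordinate to the charts.  A measure on the manifold is determined by its
  restrictions to the pieces, and measures on the pieces can be summed.\<close>

lemma countable_chart_partition:
  obtains e :: "nat \<Rightarrow> ('m, 'n) chart" and D :: "nat \<Rightarrow> 'm set"
  where "\<And>i. e i \<in> A" "\<And>i. D i \<in> sets borel" "\<And>i. D i \<subseteq> chart_dom (e i)"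
    "disjoint_family D" "(\<Union>i. D i) = UNIV"
proof -
  obtain \<D> where \<D>: "\<D> \<subseteq> chart_dom ` A" "countable \<D>" "\<Union>\<D> = \<Union>(chart_dom ` A)"
    using Lindelof[of "chart_dom ` A"] open_chart_dom by blast
  have U: "\<Union>\<D> = UNIV" using \<D>(3) atlas by (simp add: smooth_atlas_def)
  then have "\<D> \<noteq> {}" by auto
  with \<D>(2) have r: "range (from_nat_into \<D>) = \<D>" by (simp add: range_from_nat_into)
  then have "\<forall>i. \<exists>c\<in>A. from_nat_into \<D> i = chart_dom c" using \<D>(1) by blast
  then obtain e where e: "\<And>i. e i \<in> A" "\<And>i. from_nat_into \<D> i = chart_dom (e i)"
    by metis
  let ?D = "disjointed (\<lambda>i. chart_dom (e i))"
  show ?thesis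
  proof (rule that[of e ?D])
    have "range (\<lambda>i. chart_dom (e i)) \<subseteq> sets borel" using e(1) by auto
    from sets.range_disjointed_sets[OF this] show "?D i \<in> sets borel" for i by blast
    show "(\<Union>i. ?D i) = UNIV"
      using r U e(2) by (simp add: UN_disjointed_eq)
    show "e i \<in> A" "?D i \<subseteq> chart_dom (e i)" for i
      by (rule e(1), rule disjointed_subset)
    show "disjoint_family ?D" by (rule disjoint_family_disjointed)
  qed
qed

end

context finsler_manifold
begin

abbreviation "indicatrix_body c y \<equiv> {u. G c y u < 1}"

lemma open_indicatrix_body:
  assumes "c \<in> A" "y \<in> chart_img c"
  shows "open (indicatrix_body c y)"
  by (rule open_Collect_less[OF continuous_on_G[OF assms] continuous_on_const])

lemma emeasure_indicatrix_body_finite: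
  assumes "c \<in> A" "y \<in> chart_img c"
  shows "emeasure lborel (indicatrix_body c y) < \<infinity>"
proof (rule emeasure_bounded_finite)
  obtain a b where ab: "0 < a" "0 < b" "\<forall>u. a * norm u \<le> G c y u \<and> G c y u \<le> b * norm u"
    by (rule G_bounds_at[OF assms])
  have "indicatrix_body c y \<subseteq> cball 0 (1 / a)"
  proof
    fix u assume "u \<in> indicatrix_body c y"
    then have "a * norm u \<le> 1" using ab(3)[rule_format, of u] by simp
    then show "u \<in> cball 0 (1 / a)" using ab(1) by (simp add: field_simps)
  qed
  then show "bounded (indicatrix_body c y)" using bounded_cball bounded_subset by blast
qed

lemma measure_indicatrix_body_ge:
  assumes "c \<in> A" "y \<in> chart_img c" "0 < b" "\<And>u. G c y u \<le> b * norm u"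
  shows "(1 / b) ^ CARD('n) * measure lborel (ball (0 :: real ^ 'n) 1) \<le> measure lborel (indicatrix_body c y)"
proof -
  have "ball 0 (1 / b) \<subseteq> indicatrix_body c y"
  proof
    fix u :: "real ^ 'n" assume "u \<in> ball 0 (1 / b)"
    then have "b * norm u < 1" using assms(3) by (simp add: field_simps)
    then show "u \<in> indicatrix_body c y" using assms(4)[of u] by simp
  qed
  then have "measure lborel (ball (0 :: real ^ 'n) (1 / b)) \<le> measure lborel (indicatrix_body c y)"
    using emeasure_indicatrix_body_finite[OF assms(1,2)] open_indicatrix_body[OF assms(1,2)]
    by (intro measure_mono_fmeasurable) (auto simp: fmeasurable_def)
  moreover have "measure lborel (ball (0 :: real ^ 'n) (1 / b)) =
      (1 / b) ^ CARD('n) * measure lborel (ball (0 :: real ^ 'n) 1)"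
    using content_ball_conv_unit_ball[of "1 / b" "0 :: real ^ 'n"] assms(3) by simp
  ultimately show ?thesis by simp
qed

lemma measure_indicatrix_body_pos:
  assumes "c \<in> A" "y \<in> chart_img c"
  shows "0 < measure lborel (indicatrix_body c y)"
proof -
  obtain a b where ab: "0 < a" "0 < b" "\<forall>u. a * norm u \<le> G c y u \<and> G c y u \<le> b * norm u"
    by (rule G_bounds_at[OF assms])
  have "0 < (1 / b) ^ CARD('n) * measure lborel (ball (0 :: real ^ 'n) 1)"
    using ab(2) by (simp add: content_ball_pos)
  also have "\<dots> \<le> measure lborel (indicatrix_body c y)"
    by (rule measure_indicatrix_body_ge[OF assms ab(2)]) (use ab(3) in simp)
  finally show ?thesis .
qed

lemma bh_density_nonneg: "0 \<le> bh_density A c F y"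
  by (simp add: bh_density_def)

lemma bh_density_le:
  assumes "c \<in> A" "y \<in> chart_img c" "0 < b" "\<And>u. G c y u \<le> b * norm u"
  shows "bh_density A c F y \<le> b ^ CARD('n)"
  using measure_indicatrix_body_ge[OF assms] measure_indicatrix_body_pos[OF assms(1,2)] assms(3)
  by (simp add: bh_density_def field_simps power_divide)

text \<open>The volume of the unit ball at \<open>y\<close> is the volume of a section of a Borel subset of the product
  space, so Tonelli's theorem applies.\<close>

lemma bh_density_measurable [measurable]:
  assumes c: "c \<in> A"
  shows "(\<lambda>y. bh_density A c F y * indicator (chart_img c) y) \<in> borel_measurable borel"
proof -
  let ?X = "chart_img c \<times> (UNIV - {0 :: real ^ 'n})"
  let ?Q = "(?X \<inter> (\<lambda>(y, u). G c y u) -` {..<1}) \<union> chart_img c \<times> {0}"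
  have "open ?X"
    using open_chart_img[OF c] by (intro open_Times) auto
  then have "open (?X \<inter> (\<lambda>(y, u). G c y u) -` {..<1})"
    by (intro continuous_open_preimage smooth_on_continuous G_smooth c) auto
  then have "?X \<inter> (\<lambda>(y, u). G c y u) -` {..<1} \<in> sets borel" by (rule borel_open)
  moreover have "chart_img c \<times> {0 :: real ^ 'n} \<in> sets (borel \<Otimes>\<^sub>M borel)"
    using borel_chart_img[OF c] by (intro pair_measureI) auto
  ultimately have "?Q \<in> sets (borel \<Otimes>\<^sub>M borel)" unfolding borel_prod by (rule sets.Un)
  also have "sets (borel \<Otimes>\<^sub>M borel) = sets (borel \<Otimes>\<^sub>M (lborel :: (real ^ 'n) measure))"
    by (rule sets_pair_measure_cong) simp_all
  finally have Q: "?Q \<in> sets (borel \<Otimes>\<^sub>M lborel)" .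
  have [measurable]: "(\<lambda>y. emeasure lborel (Pair y -` ?Q)) \<in> borel_measurable borel"
    by (rule lborel.measurable_emeasure_Pair[OF Q])
  have "Pair y -` ?Q = indicatrix_body c y" if "y \<in> chart_img c" for y
  proof (rule set_eqI)
    fix u
    show "u \<in> Pair y -` ?Q \<longleftrightarrow> u \<in> indicatrix_body c y"
      using that G_zero[OF c that] by (cases "u = 0") simp_all
  qed
  then have "(\<lambda>y. bh_density A c F y * indicator (chart_img c) y) =
    (\<lambda>y. measure lborel (ball (0 :: real ^ 'n) 1) / enn2real (emeasure lborel (Pair y -` ?Q)) *
      indicator (chart_img c) y)"
    by (auto simp: bh_density_def measure_def indicator_def)
  moreover have "\<dots> \<in> borel_measurable borel"
    using borel_chart_img[OF c] by measurable
  ultimately show ?thesis by simp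
qed

lemma G_change:
  assumes "c \<in> A" "d \<in> A" "x \<in> chart_dom c" "x \<in> chart_dom d"
  shows "G c (chart_map c x) u = G d (chart_map d x) (transition_derivative c d (chart_map c x) u)"
  using assms coord_vector_change[OF assms] by (simp add: G_chart_map)

text \<open>The differential of the coordinate change maps one unit ball onto the other.\<close>

lemma bh_density_change:
  assumes "c \<in> A" "d \<in> A" "x \<in> chart_dom c" "x \<in> chart_dom d"
  shows "bh_density A c F (chart_map c x) =
    absdet (transition_derivative c d (chart_map c x)) * bh_density A d F (chart_map d x)"
proof -
  let ?L = "transition_derivative c d (chart_map c x)"
  let ?Bc = "indicatrix_body c (chart_map c x)" and ?Bd = "indicatrix_body d (chart_map d x)"
  have y: "chart_map c x \<in> chart_img c" "chart_map d x \<in> chart_img d" using assms by auto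
  have im: "?L ` ?Bc = ?Bd"
  proof
    show "?L ` ?Bc \<subseteq> ?Bd" using G_change[OF assms] by auto
    show "?Bd \<subseteq> ?L ` ?Bc"
    proof
      fix w assume "w \<in> ?Bd"
      then have "transition_derivative d c (chart_map d x) w \<in> ?Bc"
        using G_change[OF assms(2,1,4,3)] by simp
      then show "w \<in> ?L ` ?Bc"
        using transition_derivative_inverse[OF assms, of w] by (metis imageI)
    qed
  qed
  have "measure lborel ?Bd = absdet ?L * measure lborel ?Bc"
    unfolding im[symmetric]
    by (rule measure_linear_image_absdet)
      (use im has_derivative_linear[OF transition_has_derivative[OF assms]]
        open_indicatrix_body[OF assms(1) y(1)] open_indicatrix_body[OF assms(2) y(2)]
        emeasure_indicatrix_body_finite[OF assms(1) y(1)] in simp_all)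
  then show ?thesis
    using measure_indicatrix_body_pos[OF assms(1) y(1)] measure_indicatrix_body_pos[OF assms(2) y(2)]
    unfolding bh_density_def by (auto simp: field_simps)
qed

definition chart_measure :: "('m, 'n) chart \<Rightarrow> 'm measure" where
  "chart_measure c = distr (density (restrict_space lborel (chart_img c))
     (\<lambda>y. ennreal (bh_density A c F y))) borel (chart_inv c)"

lemma bh_density_measurable_restrict:
  assumes c: "c \<in> A"
  shows "(\<lambda>y. ennreal (bh_density A c F y)) \<in> borel_measurable (restrict_space lborel (chart_img c))"
proof -
  have "(\<lambda>y. bh_density A c F y) \<in> borel_measurable (restrict_space borel (chart_img c))"
    using bh_density_measurable[OF c] borel_chart_img[OF c]
    by (subst borel_measurable_restrict_space_iff) (auto simp: mult.commute)
  then have "(\<lambda>y. bh_density A c F y) \<in> borel_measurable (restrict_space lborel (chart_img c))"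
    by (simp cong: measurable_cong_sets sets_restrict_space_cong)
  then show ?thesis by simp
qed

lemma nn_integral_chart_measure:
  assumes c: "c \<in> A" and g[measurable]: "g \<in> borel_measurable borel"
  shows "(\<integral>\<^sup>+x. g x \<partial>chart_measure c) =
    (\<integral>\<^sup>+y. ennreal (bh_density A c F y) * g (chart_inv c y) * indicator (chart_img c) y \<partial>lborel)"
proof -
  have inv: "chart_inv c \<in> restrict_space lborel (chart_img c) \<rightarrow>\<^sub>M borel"
    using measurable_chart_inv[OF c] by (simp cong: measurable_cong_sets sets_restrict_space_cong)
  have gi: "(\<lambda>y. g (chart_inv c y)) \<in> borel_measurable (restrict_space lborel (chart_img c))"
    by (rule measurable_compose[OF inv g])
  have "(\<integral>\<^sup>+x. g x \<partial>chart_measure c) = (\<integral>\<^sup>+y. g (chart_inv c y) \<partial>density (restrict_space lborel (chart_img c))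
     (\<lambda>y. ennreal (bh_density A c F y)))"
    unfolding chart_measure_def by (rule nn_integral_distr) (use inv in auto)
  also have "\<dots> = (\<integral>\<^sup>+y. ennreal (bh_density A c F y) * g (chart_inv c y) \<partial>restrict_space lborel (chart_img c))"
    by (rule nn_integral_density[OF bh_density_measurable_restrict[OF c] gi])
  also have "\<dots> = (\<integral>\<^sup>+y. ennreal (bh_density A c F y) * g (chart_inv c y) * indicator (chart_img c) y \<partial>lborel)"
    using borel_chart_img[OF c] by (subst nn_integral_restrict_space) auto
  finally show ?thesis .
qed

lemma sets_chart_measure [simp, measurable_cong]: "sets (chart_measure c) = sets borel"
  by (simp add: chart_measure_def)

lemma emeasure_chart_measure:
  assumes c: "c \<in> A" and B: "B \<in> sets borel" "B \<subseteq> chart_dom c"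
  shows "emeasure (chart_measure c) B =
    (\<integral>\<^sup>+y. ennreal (bh_density A c F y) * indicator (chart_map c ` B) y \<partial>lborel)"
proof -
  have "emeasure (chart_measure c) B = (\<integral>\<^sup>+x. indicator B x \<partial>chart_measure c)"
    using B by simp
  also have "\<dots> = (\<integral>\<^sup>+y. ennreal (bh_density A c F y) * indicator B (chart_inv c y) * indicator (chart_img c) y \<partial>lborel)"
    using B by (intro nn_integral_chart_measure[OF c]) auto
  also have "\<dots> = (\<integral>\<^sup>+y. ennreal (bh_density A c F y) * indicator (chart_map c ` B) y \<partial>lborel)"
    unfolding chart_map_image_subset_eq[OF c B(2)]
    by (intro nn_integral_cong) (auto simp: indicator_def)
  finally show ?thesis .
qed

text \<open>The transformation rule of the density is exactly the Jacobian factor of the coordinate change.\<close>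

lemma emeasure_chart_measure_change:
  assumes c: "c \<in> A" and d: "d \<in> A" and B: "B \<in> sets borel" "B \<subseteq> chart_dom c" "B \<subseteq> chart_dom d"
  shows "emeasure (chart_measure c) B = emeasure (chart_measure d) B"
proof -
  let ?S = "chart_map c ` B" and ?g = "chart_map d \<circ> chart_inv c"
  let ?f = "\<lambda>y. bh_density A d F y * indicator (chart_img d) y"
  have im: "?g ` ?S = chart_map d ` B"
    using B(2) c by (auto simp: image_comp subset_iff image_iff)
  have S: "?S \<in> sets borel" "chart_map d ` B \<in> sets borel"
    using borel_chart_map_image c d B by auto
  have eq: "absdet (transition_derivative c d y) * ?f (?g y) * indicator ?S y =
      bh_density A c F y * indicator (chart_img c) y * indicator ?S y" for y
  proof (cases "y \<in> ?S")
    case True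
    then obtain x where x: "x \<in> B" "y = chart_map c x" by auto
    then have xd: "x \<in> chart_dom c" "x \<in> chart_dom d" using B by auto
    then show ?thesis using bh_density_change[OF c d xd] c d x by (simp add: indicator_def)
  qed simp
  have "(\<integral>\<^sup>+y. ennreal (?f y * indicator (?g ` ?S) y) \<partial>lborel) =
    (\<integral>\<^sup>+y. ennreal (absdet (transition_derivative c d y) * ?f (?g y) * indicator ?S y) \<partial>lborel)"
  proof (rule nn_integral_change_of_variables[OF S(1)])
    show "(?g has_derivative transition_derivative c d y) (at y)" if y: "y \<in> ?S" for y
    proof -
      obtain x where x: "x \<in> B" "y = chart_map c x" using y by auto
      then have xd: "x \<in> chart_dom c" "x \<in> chart_dom d" using B by auto
      show ?thesis using transition_has_derivative[OF c d xd] x by simp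
    qed
    show "inj_on ?g ?S"
    proof (rule inj_onI)
      fix y z assume "y \<in> ?S" "z \<in> ?S" and eq: "?g y = ?g z"
      then obtain p q where pq: "p \<in> B" "q \<in> B" "y = chart_map c p" "z = chart_map c q" by auto
      have "chart_map d p = chart_map d q" using eq pq B(2) c by (simp add: subset_iff)
      then have "p = q" using pq B(3) d by (metis chart_inv_map subset_iff)
      then show "y = z" using pq by simp
    qed
    show "(\<lambda>y. ?f y * indicator (?g ` ?S) y) \<in> borel_measurable borel"
      unfolding im using bh_density_measurable[OF d] S by simp
    show "(\<lambda>y. absdet (transition_derivative c d y) * ?f (?g y) * indicator ?S y) \<in> borel_measurable borel"
      unfolding eq using bh_density_measurable[OF c] S by simp
  qed (simp add: bh_density_nonneg)
  then have "(\<integral>\<^sup>+y. ennreal (?f y * indicator (chart_map d ` B) y) \<partial>lborel) =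
     (\<integral>\<^sup>+y. ennreal (bh_density A c F y * indicator (chart_img c) y * indicator ?S y) \<partial>lborel)"
    unfolding im eq .
  moreover have "(\<integral>\<^sup>+y. ennreal (bh_density A d F y * indicator (chart_img d) y * indicator (chart_map d ` B) y) \<partial>lborel)
     = (\<integral>\<^sup>+y. ennreal (bh_density A d F y) * indicator (chart_map d ` B) y \<partial>lborel)" if "B \<subseteq> chart_dom d" for d
    using that by (intro nn_integral_cong) (auto simp: indicator_def)
  ultimately show ?thesis
    using B by (simp add: emeasure_chart_measure c d)
qed

definition is_bh_measure :: "'m measure \<Rightarrow> bool" where
  "is_bh_measure m \<longleftrightarrow> sets m = sets borel \<and>
     (\<forall>c\<in>A. \<forall>B\<in>sets borel. B \<subseteq> chart_dom c \<longrightarrow>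
        emeasure m B =
          (\<integral>\<^sup>+y. ennreal (bh_density A c F y) * indicator (chart_map c ` B) y \<partial>lborel))"

lemma is_bh_measure_unique:
  assumes "is_bh_measure m" "is_bh_measure m'"
  shows "m = m'"
proof -
  obtain e D where eD: "\<And>i. e i \<in> A" "\<And>i. D i \<in> sets borel" "\<And>i. D i \<subseteq> chart_dom (e i)"
    "disjoint_family D" "(\<Union>i::nat. D i) = UNIV"
    using countable_chart_partition by metis
  have *: "emeasure m B = (\<Sum>i. \<integral>\<^sup>+y. ennreal (bh_density A (e i) F y) * indicator (chart_map (e i) ` (B \<inter> D i)) y \<partial>lborel)"
    if m: "is_bh_measure m" and B: "B \<in> sets borel" for m B
  proof -
    have "disjoint_family (\<lambda>i. B \<inter> D i)"
      using eD(4) unfolding disjoint_family_on_def by blast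
    then have "(\<Sum>i. emeasure m (B \<inter> D i)) = emeasure m (\<Union>i. B \<inter> D i)"
      using m B eD(2) by (intro suminf_emeasure) (auto simp: is_bh_measure_def)
    moreover have "(\<Union>i. B \<inter> D i) = B" using eD(5) by auto
    moreover have "emeasure m (B \<inter> D i) =
        (\<integral>\<^sup>+y. ennreal (bh_density A (e i) F y) * indicator (chart_map (e i) ` (B \<inter> D i)) y \<partial>lborel)" for i
    proof -
      have "B \<inter> D i \<in> sets borel" "B \<inter> D i \<subseteq> chart_dom (e i)" using B eD(2,3) by auto
      then show ?thesis using m eD(1) unfolding is_bh_measure_def by blast
    qed
    ultimately show ?thesis by simp
  qed
  show ?thesis
    by (rule measure_eqI) (use assms * in \<open>auto simp: is_bh_measure_def\<close>)
qed

text \<open>On each piece of the partition the measure of the chart containing it is used.  That another chart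
  prescribes the same values is the change of variables.\<close>

lemma ex_is_bh_measure: "\<exists>m. is_bh_measure m"
proof -
  obtain e D where eD: "\<And>i. e i \<in> A" "\<And>i. D i \<in> sets borel" "\<And>i. D i \<subseteq> chart_dom (e i)"
    "disjoint_family D" "(\<Union>i::nat. D i) = UNIV"
    using countable_chart_partition by metis
  let ?\<mu> = "\<lambda>B. \<Sum>i. emeasure (chart_measure (e i)) (B \<inter> D i)"
  define m where "m = measure_of UNIV (sets (borel :: 'm measure)) ?\<mu>"
  have sets: "sets m = sets borel"
    using sets.sigma_sets_eq[of "borel :: 'm measure"] by (simp add: m_def)
  have em: "emeasure m B = ?\<mu> B" if "B \<in> sets borel" for B
  proof (rule emeasure_measure_of[OF m_def])
    show "positive (sets m) ?\<mu>" by (simp add: positive_def)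
    show "countably_additive (sets m) ?\<mu>"
    proof (rule countably_additiveI)
      fix S :: "nat \<Rightarrow> 'm set"
      assume S: "range S \<subseteq> sets m" "disjoint_family S" "(\<Union>i. S i) \<in> sets m"
      have "(\<Sum>n. ?\<mu> (S n)) = (\<Sum>n. \<integral>\<^sup>+i. emeasure (chart_measure (e i)) (S n \<inter> D i) \<partial>count_space UNIV)"
        by (simp add: nn_integral_count_space_nat)
      also have "\<dots> = (\<integral>\<^sup>+i. (\<Sum>n. emeasure (chart_measure (e i)) (S n \<inter> D i)) \<partial>count_space UNIV)"
        by (rule nn_integral_suminf[symmetric]) simp
      also have "\<dots> = (\<integral>\<^sup>+i. emeasure (chart_measure (e i)) ((\<Union>n. S n) \<inter> D i) \<partial>count_space UNIV)"
      proof (rule nn_integral_cong)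
        fix i
        have "(\<Sum>n. emeasure (chart_measure (e i)) (S n \<inter> D i)) = emeasure (chart_measure (e i)) (\<Union>n. S n \<inter> D i)"
          using S eD(2) sets by (intro suminf_emeasure) (auto simp: disjoint_family_on_def)
        also have "(\<Union>n. S n \<inter> D i) = (\<Union>n. S n) \<inter> D i" by auto
        finally show "(\<Sum>n. emeasure (chart_measure (e i)) (S n \<inter> D i)) =
          emeasure (chart_measure (e i)) ((\<Union>n. S n) \<inter> D i)" .
      qed
      finally show "(\<Sum>n. ?\<mu> (S n)) = ?\<mu> (\<Union>n. S n)" by (simp add: nn_integral_count_space_nat)
    qed
  qed (use that sets in auto)
  have "is_bh_measure m"
    unfolding is_bh_measure_def
  proof (intro conjI ballI impI)
    show "sets m = sets borel" by (rule sets)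
    fix c and B :: "'m set" assume c: "c \<in> A" and B: "B \<in> sets borel" "B \<subseteq> chart_dom c"
    have "emeasure m B = (\<Sum>i. emeasure (chart_measure c) (B \<inter> D i))"
    proof -
      have "emeasure (chart_measure (e i)) (B \<inter> D i) = emeasure (chart_measure c) (B \<inter> D i)" for i
      proof (rule emeasure_chart_measure_change[OF eD(1) c])
        show "B \<inter> D i \<in> sets borel" "B \<inter> D i \<subseteq> chart_dom (e i)" "B \<inter> D i \<subseteq> chart_dom c"
          using B eD(2,3) by auto
      qed
      then show ?thesis using em[OF B(1)] by simp
    qed
    also have "\<dots> = emeasure (chart_measure c) (\<Union>i. B \<inter> D i)"
    proof (rule suminf_emeasure)
      show "disjoint_family (\<lambda>i. B \<inter> D i)"
        using eD(4) unfolding disjoint_family_on_def by blast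
    qed (use B eD(2) in auto)
    also have "(\<Union>i. B \<inter> D i) = B" using eD(5) by auto
    finally show "emeasure m B = (\<integral>\<^sup>+y. ennreal (bh_density A c F y) * indicator (chart_map c ` B) y \<partial>lborel)"
      using emeasure_chart_measure[OF c B] by simp
  qed
  then show ?thesis ..
qed

abbreviation "bh \<equiv> bh_measure A F"

lemma bh_measure_eqI: "is_bh_measure m \<Longrightarrow> bh = m"
  unfolding bh_measure_def is_bh_measure_def[symmetric]
  by (rule the_equality, assumption) (rule is_bh_measure_unique)

lemma is_bh_measure_bh: "is_bh_measure bh"
  using ex_is_bh_measure bh_measure_eqI by metis

lemma sets_bh [simp, measurable_cong]: "sets bh = sets borel"
  using is_bh_measure_bh by (simp add: is_bh_measure_def)

lemma space_bh [simp]: "space bh = UNIV"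
  using sets_eq_imp_space_eq[OF sets_bh] by simp

lemma emeasure_bh_chart:
  assumes "c \<in> A" "B \<in> sets borel" "B \<subseteq> chart_dom c"
  shows "emeasure bh B = (\<integral>\<^sup>+y. ennreal (bh_density A c F y) * indicator (chart_map c ` B) y \<partial>lborel)"
  using is_bh_measure_bh assms by (simp add: is_bh_measure_def)

text \<open>Identifying the restriction to a chart domain with an explicit image measure transports integrals
  of arbitrary functions to coordinates.\<close>

lemma density_indicator_chart_dom:
  assumes c: "c \<in> A"
  shows "density bh (indicator (chart_dom c)) = chart_measure c"
proof (rule measure_eqI)
  fix B assume "B \<in> sets (density bh (indicator (chart_dom c)))"
  then have B: "B \<in> sets borel" by simp
  have [measurable]: "chart_dom c \<in> sets borel" using c by simp
  have BD: "B \<inter> chart_dom c \<in> sets borel" "B \<inter> chart_dom c \<subseteq> chart_dom c" using B c by auto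
  have "emeasure (density bh (indicator (chart_dom c))) B = (\<integral>\<^sup>+x. indicator (chart_dom c) x * indicator B x \<partial>bh)"
    using B by (intro emeasure_density) auto
  also have "\<dots> = (\<integral>\<^sup>+x. indicator (B \<inter> chart_dom c) x \<partial>bh)"
    by (intro nn_integral_cong) (auto simp: indicator_def)
  also have "\<dots> = emeasure (chart_measure c) (B \<inter> chart_dom c)"
    using BD by (simp add: emeasure_bh_chart[OF c BD] emeasure_chart_measure[OF c BD])
  also have "\<dots> = emeasure (chart_measure c) B"
  proof -
    have "emeasure (chart_measure c) (B \<inter> chart_dom c) = (\<integral>\<^sup>+x. indicator (B \<inter> chart_dom c) x \<partial>chart_measure c)"
      using BD by simp
    also have "\<dots> = (\<integral>\<^sup>+x. indicator B x \<partial>chart_measure c)"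
      using B BD by (auto simp: nn_integral_chart_measure[OF c] indicator_def c intro!: nn_integral_cong)
    also have "\<dots> = emeasure (chart_measure c) B" using B by simp
    finally show ?thesis .
  qed
  finally show "emeasure (density bh (indicator (chart_dom c))) B = emeasure (chart_measure c) B" .
qed simp

lemma nn_integral_bh_chart:
  assumes c: "c \<in> A" and g[measurable]: "g \<in> borel_measurable borel"
  shows "(\<integral>\<^sup>+x. indicator (chart_dom c) x * g x \<partial>bh) =
    (\<integral>\<^sup>+y. ennreal (bh_density A c F y) * g (chart_inv c y) * indicator (chart_img c) y \<partial>lborel)"
proof -
  have [measurable]: "chart_dom c \<in> sets borel" using c by simp
  have "(\<integral>\<^sup>+x. indicator (chart_dom c) x * g x \<partial>bh) = (\<integral>\<^sup>+x. g x \<partial>density bh (indicator (chart_dom c)))"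
    by (subst nn_integral_density) auto
  then show ?thesis
    by (simp add: density_indicator_chart_dom[OF c] nn_integral_chart_measure[OF c g])
qed

end

section \<open>Concentration of finite measures on a Euclidean space\<close>

text \<open>Total boundedness of one compact ball gives the number \<open>N\<close>; translation and scaling carry the
  cover to all other balls.\<close>

lemma ball_doubling:
  obtains N :: nat where "0 < N"
    "\<forall>(y :: 'a::euclidean_space) r. 0 < r \<longrightarrow>
       (\<exists>X. finite X \<and> card X \<le> N \<and> ball y (2 * r) \<subseteq> (\<Union>x\<in>X. ball x (r / 2)))"
proof -
  obtain k :: "'a set" where k: "finite k" "cball 0 2 \<subseteq> (\<Union>x\<in>k. ball x (1 / 2))"
    using compact_eq_totally_bounded[of "cball (0 :: 'a) 2"] compact_cball
    by (meson half_gt_zero_iff zero_less_one)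
  have "\<exists>X. finite X \<and> card X \<le> Suc (card k) \<and> ball y (2 * r) \<subseteq> (\<Union>x\<in>X. ball x (r / 2))"
    if r: "0 < r" for y :: 'a and r :: real
  proof (intro exI conjI)
    show "finite ((\<lambda>x. y + r *\<^sub>R x) ` k)" using k by simp
    show "card ((\<lambda>x. y + r *\<^sub>R x) ` k) \<le> Suc (card k)"
      using card_image_le[OF k(1)] by (rule le_SucI)
    show "ball y (2 * r) \<subseteq> (\<Union>x\<in>(\<lambda>x. y + r *\<^sub>R x) ` k. ball x (r / 2))"
    proof
      fix z assume z: "z \<in> ball y (2 * r)"
      let ?w = "(z - y) /\<^sub>R r"
      have zw: "z = y + r *\<^sub>R ?w" using r by simp
      have "norm (z - y) < 2 * r" using z by (simp add: dist_norm norm_minus_commute)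
      then have "norm (z - y) / r \<le> 2" using r by (simp add: field_simps)
      moreover have "norm ?w = norm (z - y) / r"
        using r by (simp only: norm_scaleR) (simp add: divide_inverse)
      ultimately have "?w \<in> cball 0 2" by simp
      then obtain x where x: "x \<in> k" "?w \<in> ball x (1 / 2)" using k(2) by blast
      have "dist (y + r *\<^sub>R x) z = r * dist x ?w"
      proof -
        have "(y + r *\<^sub>R x) - z = r *\<^sub>R (x - ?w)"
          by (subst zw) (simp add: algebra_simps)
        then show ?thesis using r by (simp add: dist_norm)
      qed
      also have "\<dots> < r / 2" using x(2) r by simp
      finally show "z \<in> (\<Union>x\<in>(\<lambda>x. y + r *\<^sub>R x) ` k. ball x (r / 2))" using x(1) by auto
    qed
  qed
  then show ?thesis using that[of "Suc (card k)"] by blast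
qed

text \<open>In the sequence \<open>R, R/2, R/4, \<dots>\<close> there is a radius \<open>r\<close> such that some ball of radius \<open>r\<close>
  but none of radius \<open>r/2\<close> has mass at least \<open>m/(2N)\<close>: the ball of radius \<open>R\<close> around \<open>z\<close> has
  large mass, and balls of radius \<open>\<delta>\<close> have small mass.  The ball of radius \<open>2r\<close> is covered by
  \<open>N\<close> balls of radius \<open>r/2\<close>.\<close>

lemma concentrated_ball:
  fixes \<nu> :: "'a::euclidean_space measure"
  assumes "finite_measure \<nu>" and sets: "sets \<nu> = sets borel"
    and N: "0 < N" "\<forall>(y :: 'a) r. 0 < r \<longrightarrow>
       (\<exists>X. finite X \<and> card X \<le> N \<and> ball y (2 * r) \<subseteq> (\<Union>x\<in>X. ball x (r / 2)))"
    and R: "0 < R" and m: "0 < m" "m \<le> measure \<nu> (ball z R)"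
    and \<delta>: "0 < \<delta>" "\<forall>y. measure \<nu> (ball y \<delta>) < m / (2 * N)"
  obtains y r where "0 < r" "r \<le> R" "m / (2 * N) \<le> measure \<nu> (ball y r)"
    "measure \<nu> (ball y (2 * r)) \<le> m / 2"
proof -
  interpret finite_measure \<nu> by fact
  define P where "P j \<longleftrightarrow> (\<exists>y. m / (2 * N) \<le> measure \<nu> (ball y (R / 2 ^ j)))" for j :: nat
  have "m / (2 * N) \<le> m" using N(1) m(1) by (simp add: field_simps)
  then have P0: "P 0" using m(2) by (auto simp: P_def intro!: exI[of _ z])
  obtain j where j: "R / \<delta> < 2 ^ j" using real_arch_pow[of 2 "R / \<delta>"] by auto
  have "\<not> P j"
  proof
    assume "P j"
    then obtain y where y: "m / (2 * N) \<le> measure \<nu> (ball y (R / 2 ^ j))" by (auto simp: P_def)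
    have "R / 2 ^ j \<le> \<delta>" using j \<delta>(1) by (simp add: field_simps)
    then have "measure \<nu> (ball y (R / 2 ^ j)) \<le> measure \<nu> (ball y \<delta>)"
      by (intro finite_measure_mono) (auto simp: sets)
    then show False using y \<delta>(2)[rule_format, of y] by linarith
  qed
  with P0 obtain i where i: "P i" "\<not> P (Suc i)"
    by (metis nat_induct)
  define r where "r = R / 2 ^ i"
  have r: "0 < r" "r \<le> R" "R / 2 ^ Suc i = r / 2"
    using R by (auto simp: r_def field_simps)
  obtain y where y: "m / (2 * N) \<le> measure \<nu> (ball y r)" using i(1) by (auto simp: P_def r_def)
  obtain X where X: "finite X" "card X \<le> N" "ball y (2 * r) \<subseteq> (\<Union>x\<in>X. ball x (r / 2))"
    using N(2) r(1) by blast
  have "measure \<nu> (ball y (2 * r)) \<le> measure \<nu> (\<Union>x\<in>X. ball x (r / 2))"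
    using X by (intro finite_measure_mono) (auto simp: sets)
  also have "\<dots> \<le> (\<Sum>x\<in>X. measure \<nu> (ball x (r / 2)))"
    using X by (intro finite_measure_subadditive_finite) (auto simp: sets)
  also have "\<dots> \<le> (\<Sum>x\<in>X. m / (2 * N))"
  proof (rule sum_mono)
    fix x
    show "measure \<nu> (ball x (r / 2)) \<le> m / (2 * N)"
      using i(2) unfolding P_def r(3) by (meson linorder_not_less less_imp_le)
  qed
  also have "\<dots> = card X * (m / (2 * N))" by simp
  also have "\<dots> \<le> N * (m / (2 * N))"
    using X(2) m(1) by (intro mult_right_mono) auto
  also have "\<dots> = m / 2" using N(1) by simp
  finally show ?thesis using that[OF r(1,2) y] by simp
qed

section \<open>Normalising a function to have vanishing p-mean\<close>

text \<open>In this form continuity at the origin is visible: both exponents are positive, whereas \<open>p - 2\<close> may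
  be negative.\<close>

lemma signed_powr_eq:
  fixes x p :: real
  assumes "1 < p"
  shows "\<bar>x\<bar> powr (p - 2) * x = max x 0 powr (p - 1) - max (- x) 0 powr (p - 1)"
proof -
  have *: "y powr (p - 2) * y = y powr (p - 1)" if "y > 0" for y :: real
    using that powr_add[of y "p - 2" 1] by (simp add: algebra_simps)
  consider "x > 0" | "x = 0" | "x < 0" by linarith
  then show ?thesis
    by cases (use *[of x] *[of "- x"] assms in \<open>auto simp: max_def\<close>)
qed

lemma continuous_on_signed_powr:
  assumes "1 < (p :: real)"
  shows "continuous_on UNIV (\<lambda>x :: real. \<bar>x\<bar> powr (p - 2) * x)"
  unfolding signed_powr_eq[OF assms]
  by (intro continuous_on_diff continuous_on_powr' continuous_on_max continuous_intros)
    (use assms in auto)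

text \<open>The mean is nonnegative for \<open>t = 0\<close>, nonpositive for \<open>t = 1\<close> and, by dominated convergence,
  continuous in \<open>t\<close>.\<close>

lemma (in finite_measure) ex_shift_p_mean_zero:
  fixes f :: "'a \<Rightarrow> real"
  assumes p: "1 < p" and f[measurable]: "f \<in> borel_measurable M" and f01: "\<And>x. 0 \<le> f x" "\<And>x. f x \<le> 1"
  obtains t where "0 \<le> t" "t \<le> 1" "(\<integral>x. \<bar>f x - t\<bar> powr (p - 2) * (f x - t) \<partial>M) = 0"
proof -
  define \<psi> where "\<psi> x = \<bar>x\<bar> powr (p - 2) * x" for x :: real
  have \<psi>c: "continuous_on UNIV \<psi>"
    unfolding \<psi>_def by (rule continuous_on_signed_powr[OF p])
  have [measurable]: "\<psi> \<in> borel_measurable borel"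
    by (rule borel_measurable_continuous_onI[OF \<psi>c])
  have bd: "\<bar>\<psi> x\<bar> \<le> 1" if "\<bar>x\<bar> \<le> 1" for x
  proof (cases "x = 0")
    case False
    have "\<bar>\<psi> x\<bar> = \<bar>x\<bar> powr (p - 1)"
      using False powr_add[of "\<bar>x\<bar>" "p - 2" 1] by (simp add: \<psi>_def abs_mult)
    also have "\<dots> \<le> 1 powr (p - 1)"
      using that p by (intro powr_mono2) auto
    finally show ?thesis by simp
  qed (simp add: \<psi>_def)
  have bd': "\<bar>\<psi> (f x - t)\<bar> \<le> 1" if "0 \<le> t" "t \<le> 1" for t x
    by (rule bd) (use that f01[of x] in auto)
  have int: "integrable M (\<lambda>x. \<psi> (f x - t))" if "0 \<le> t" "t \<le> 1" for t
    by (rule integrable_const_bound[where B = 1]) (use bd'[OF that] in auto)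
  let ?G = "\<lambda>t. \<integral>x. \<psi> (f x - t) \<partial>M"
  have "continuous_on {0..1} ?G"
    unfolding continuous_on_sequentially
  proof (intro allI impI ballI)
    fix s :: "nat \<Rightarrow> real" and t assume t: "t \<in> {0..1}" and s: "(\<forall>n. s n \<in> {0..1}) \<and> s \<longlonglongrightarrow> t"
    have "(\<lambda>n. ?G (s n)) \<longlonglongrightarrow> ?G t"
    proof (rule integral_dominated_convergence[where w = "\<lambda>_. 1"])
      show "AE x in M. (\<lambda>n. \<psi> (f x - s n)) \<longlonglongrightarrow> \<psi> (f x - t)"
      proof (rule AE_I2)
        fix x
        have "isCont \<psi> (f x - t)" using \<psi>c by (simp add: continuous_on_eq_continuous_at)
        moreover have "(\<lambda>n. f x - s n) \<longlonglongrightarrow> f x - t" using s by (intro tendsto_intros) auto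
        ultimately show "(\<lambda>n. \<psi> (f x - s n)) \<longlonglongrightarrow> \<psi> (f x - t)" by (rule isCont_tendsto_compose)
      qed
      show "AE x in M. norm (\<psi> (f x - s n)) \<le> 1" for n
        using bd'[of "s n"] s by auto
    qed auto
    then show "(?G \<circ> s) \<longlonglongrightarrow> ?G t" by (simp add: o_def)
  qed
  moreover have "0 \<le> ?G 0"
    using f01 by (intro integral_nonneg_AE) (auto simp: \<psi>_def)
  moreover have "?G 1 \<le> 0"
  proof -
    have "0 \<le> (\<integral>x. - \<psi> (f x - 1) \<partial>M)"
      using f01 by (intro integral_nonneg_AE) (auto simp: \<psi>_def mult_nonneg_nonpos)
    then show ?thesis by simp
  qed
  ultimately obtain t where "0 \<le> t" "t \<le> 1" "?G t = 0"
    using IVT2'[of ?G 1 0 0] by auto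
  then show ?thesis using that by (simp add: \<psi>_def)
qed

text \<open>As \<open>f\<close> is at least \<open>a\<close> on \<open>S\<close> and zero on \<open>T\<close>, the constant \<open>t\<close> has distance at least
  \<open>a/2\<close> from all values of \<open>f\<close> on one of the two sets.\<close>

lemma p_norm_lower_bound:
  fixes f :: "'a \<Rightarrow> real"
  assumes S: "S \<in> sets M" "T \<in> sets M" "ennreal \<mu> \<le> emeasure M S" "ennreal \<mu> \<le> emeasure M T"
    and f: "\<And>x. x \<in> S \<Longrightarrow> a \<le> f x" "\<And>x. x \<in> T \<Longrightarrow> f x = 0" and a: "0 < a" and p: "0 \<le> p"
  shows "ennreal ((a / 2) powr p) * ennreal \<mu> \<le> (\<integral>\<^sup>+x. ennreal (\<bar>f x - t\<bar> powr p) \<partial>M)"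
proof -
  have *: "ennreal ((a / 2) powr p) * ennreal \<mu> \<le> (\<integral>\<^sup>+x. ennreal (\<bar>f x - t\<bar> powr p) \<partial>M)"
    if X: "X \<in> sets M" "ennreal \<mu> \<le> emeasure M X" "\<And>x. x \<in> X \<Longrightarrow> a / 2 \<le> \<bar>f x - t\<bar>" for X
  proof -
    have "ennreal ((a / 2) powr p) * ennreal \<mu> \<le> ennreal ((a / 2) powr p) * emeasure M X"
      using X(2) by (intro mult_left_mono) auto
    also have "\<dots> = (\<integral>\<^sup>+x. ennreal ((a / 2) powr p) * indicator X x \<partial>M)"
      using X(1) by (simp add: nn_integral_cmult_indicator)
    also have "\<dots> \<le> (\<integral>\<^sup>+x. ennreal (\<bar>f x - t\<bar> powr p) \<partial>M)"
      using X(3) a p by (intro nn_integral_mono) (auto simp: indicator_def intro!: powr_mono2 ennreal_leI)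
    finally show ?thesis .
  qed
  show ?thesis
  proof (cases "a / 2 \<le> t")
    case True
    show ?thesis by (rule *[OF S(2,4)]) (use f(2) True in auto)
  next
    case False
    have "a / 2 \<le> \<bar>f x - t\<bar>" if "x \<in> S" for x
      using f(1)[OF that] False by linarith
    then show ?thesis by (rule *[OF S(1,3)])
  qed
qed

section \<open>Bump functions supported in a coordinate ball\<close>

text \<open>The constant \<open>4\<close> makes the argument positive exactly on the ball of radius \<open>2r\<close>, and at least
  \<open>3\<close> on the ball of radius \<open>r\<close>.\<close>

definition ball_bump :: "'a::euclidean_space \<Rightarrow> real \<Rightarrow> 'a \<Rightarrow> real" where
  "ball_bump y r z = flat_exp 1 (4 - (z - y) \<bullet> (z - y) / r\<^sup>2)"

lemma flat_exp_1_bounds: "0 \<le> flat_exp 1 x" "flat_exp 1 x \<le> 1"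
  by (auto simp: flat_exp_def)

text \<open>With \<open>s = 1/x\<close> the derivative is \<open>s\<^sup>2 e\<^sup>-\<^sup>s\<close>, and \<open>s\<^sup>2/2 \<le> e\<^sup>s\<close>.\<close>

lemma flat_exp_1_derivative_bound: "\<bar>flat_exp ([:0, 0, 1:] * (1 - pderiv 1)) x\<bar> \<le> 2"
proof (cases "0 < x")
  case True
  define s where "s = 1 / x"
  have s: "0 \<le> s" using True by (simp add: s_def)
  have "s\<^sup>2 / 2 \<le> exp s"
    using exp_lower_Taylor_quadratic[OF s] s by linarith
  then have "s\<^sup>2 * exp (- s) \<le> 2" by (simp add: exp_minus field_simps)
  then show ?thesis using True by (simp add: flat_exp_def s_def[symmetric] power2_eq_square abs_mult)
qed (simp add: flat_exp_def)

lemma Ck_on_ball_bump: "Ck_on k UNIV (ball_bump y r)"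
proof -
  have "Ck_on k UNIV (\<lambda>z :: 'a. (z - y) \<bullet> b)" for b
    using Ck_on_bounded_linear[OF open_UNIV bounded_linear_inner_left[of b],
        OF Ck_on_add[OF open_UNIV Ck_on_ident[OF open_UNIV] Ck_on_const[of _ _ "- y"]]] by simp
  then have "Ck_on k UNIV (\<lambda>z :: 'a. 4 + (\<Sum>b\<in>Basis. ((z - y) \<bullet> b) * ((z - y) \<bullet> b)) * (- 1 / r\<^sup>2))"
    by (intro Ck_on_add Ck_on_mult Ck_on_sum Ck_on_const open_UNIV)
  moreover have "(\<lambda>z. 4 + (\<Sum>b\<in>Basis. ((z - y) \<bullet> b) * ((z - y) \<bullet> b)) * (- 1 / r\<^sup>2)) =
      (\<lambda>z. 4 - (z - y) \<bullet> (z - y) / r\<^sup>2)"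
    by (auto simp: euclidean_inner[of "z - y" "z - y" for z])
  ultimately have "Ck_on k UNIV (\<lambda>z :: 'a. 4 - (z - y) \<bullet> (z - y) / r\<^sup>2)" by simp
  then show ?thesis
    unfolding ball_bump_def[abs_def] by (rule Ck_on_compose[OF open_UNIV subset_UNIV _ Ck_on_flat_exp])
qed

lemma ball_bump_derivative_bound:
  assumes r: "0 < r" and z: "norm (z - y) \<le> 2 * r"
  shows "frechet_derivative (ball_bump y r) (at z) w \<le> 8 / r * norm w"
proof -
  let ?h' = "flat_exp ([:0, 0, 1:] * (1 - pderiv 1))" and ?q = "\<lambda>z. 4 - (z - y) \<bullet> (z - y) / r\<^sup>2"
  have q: "(?q has_derivative (\<lambda>w. - (2 * ((z - y) \<bullet> w) / r\<^sup>2))) (at z)"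
  proof -
    have "((\<lambda>z. z - y) has_derivative (\<lambda>w. w)) (at z)"
      using has_derivative_diff[OF has_derivative_ident has_derivative_const[of y]] by simp
    from has_derivative_inner[OF this this]
    have "((\<lambda>z. (z - y) \<bullet> (z - y)) has_derivative (\<lambda>w. 2 * ((z - y) \<bullet> w))) (at z)"
      by (simp add: inner_commute)
    then have "((\<lambda>z. (z - y) \<bullet> (z - y) / r\<^sup>2) has_derivative (\<lambda>w. 2 * ((z - y) \<bullet> w) / r\<^sup>2)) (at z)"
      by (rule bounded_linear.has_derivative[OF bounded_linear_divide])
    from has_derivative_diff[OF has_derivative_const this] show ?thesis by simp
  qed
  have "(ball_bump y r has_derivative (\<lambda>w. ?h' (?q z) * - (2 * ((z - y) \<bullet> w) / r\<^sup>2))) (at z)"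
    unfolding ball_bump_def[abs_def]
    by (rule has_derivative_compose[OF q flat_exp_has_derivative[unfolded has_field_derivative_def]])
  then have "frechet_derivative (ball_bump y r) (at z) w = ?h' (?q z) * - (2 * ((z - y) \<bullet> w) / r\<^sup>2)"
    by (rule fun_cong[OF frechet_derivative_at, symmetric])
  also have "\<dots> \<le> \<bar>?h' (?q z)\<bar> * \<bar>2 * ((z - y) \<bullet> w) / r\<^sup>2\<bar>"
    unfolding abs_mult[symmetric] minus_mult_right[symmetric] by (rule abs_ge_minus_self)
  also have "\<dots> \<le> 2 * (4 * r * norm w / r\<^sup>2)"
  proof (rule mult_mono[OF flat_exp_1_derivative_bound])
    have "\<bar>(z - y) \<bullet> w\<bar> \<le> norm (z - y) * norm w" by (rule Cauchy_Schwarz_ineq2)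
    also have "\<dots> \<le> 2 * r * norm w" using z by (intro mult_right_mono) auto
    finally have "2 * \<bar>(z - y) \<bullet> w\<bar> \<le> 4 * r * norm w" by simp
    then show "\<bar>2 * ((z - y) \<bullet> w) / r\<^sup>2\<bar> \<le> 4 * r * norm w / r\<^sup>2"
      by (simp add: abs_mult divide_right_mono)
  qed auto
  also have "\<dots> = 8 / r * norm w" using r by (simp add: power2_eq_square)
  finally show ?thesis .
qed

lemma ball_bump_bounds: "0 \<le> ball_bump y r z" "ball_bump y r z \<le> 1"
  by (simp_all add: ball_bump_def flat_exp_1_bounds)

lemma ball_bump_inside:
  assumes r: "0 < r" and z: "norm (z - y) < r"
  shows "exp (- (1 / 3)) \<le> ball_bump y r z"
proof -
  have "(norm (z - y))\<^sup>2 < r\<^sup>2" using z by (intro power_strict_mono) auto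
  then have "(z - y) \<bullet> (z - y) < r\<^sup>2" by (simp only: power2_norm_eq_inner)
  then have "(z - y) \<bullet> (z - y) / r\<^sup>2 \<le> 1" using r by simp
  then have q: "3 \<le> 4 - (z - y) \<bullet> (z - y) / r\<^sup>2" by linarith
  have "exp (- (1 / 3)) \<le> flat_exp 1 Q" if "3 \<le> Q" for Q
  proof -
    have "1 / Q \<le> 1 / 3" using that by (simp add: field_simps)
    then show ?thesis using that by (simp add: flat_exp_def)
  qed
  from this[OF q] show ?thesis unfolding ball_bump_def .
qed

lemma ball_bump_outside:
  assumes r: "0 < r" and z: "2 * r \<le> norm (z - y)"
  shows "ball_bump y r z = 0"
proof -
  have "(2 * r)\<^sup>2 \<le> (norm (z - y))\<^sup>2" using z r by (intro power_mono) auto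
  then have "4 * r\<^sup>2 \<le> (z - y) \<bullet> (z - y)"
    by (simp only: power2_norm_eq_inner power_mult_distrib) simp
  then have "4 - (z - y) \<bullet> (z - y) / r\<^sup>2 \<le> 0" using r by (simp add: field_simps)
  then show ?thesis by (simp add: ball_bump_def flat_exp_def)
qed

context smooth_manifold
begin

definition chart_bump :: "('m, 'n) chart \<Rightarrow> real ^ 'n \<Rightarrow> real \<Rightarrow> 'm \<Rightarrow> real" where
  "chart_bump c y r x = (if x \<in> chart_dom c then ball_bump y r (chart_map c x) else 0)"

definition chart_ball :: "('m, 'n) chart \<Rightarrow> real ^ 'n \<Rightarrow> real \<Rightarrow> 'm set" where
  "chart_ball c y r = {x \<in> chart_dom c. chart_map c x \<in> ball y r}"

lemma open_chart_ball:
  assumes "c \<in> A"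
  shows "open (chart_ball c y r)"
proof -
  have "chart_ball c y r = chart_dom c \<inter> chart_map c -` ball y r" by (auto simp: chart_ball_def)
  then show ?thesis
    using continuous_open_preimage[OF continuous_on_chart_map open_chart_dom] assms by simp
qed

lemma chart_bump_bounds: "0 \<le> chart_bump c y r x" "chart_bump c y r x \<le> 1"
  by (simp_all add: chart_bump_def ball_bump_bounds)

lemma chart_bump_outside:
  assumes "0 < r" "x \<notin> chart_ball c y (2 * r)"
  shows "chart_bump c y r x = 0"
  using assms ball_bump_outside[OF assms(1), of "chart_map c x" y]
  by (auto simp: chart_bump_def chart_ball_def dist_norm norm_minus_commute not_less)

lemma chart_bump_inside:
  assumes "0 < r" "x \<in> chart_ball c y r"
  shows "exp (- (1 / 3)) \<le> chart_bump c y r x"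
  using assms ball_bump_inside[OF assms(1), of "chart_map c x" y]
  by (auto simp: chart_bump_def chart_ball_def dist_norm norm_minus_commute)

text \<open>In another chart, the function is a smooth function composed with a coordinate change on the overlap,
  and zero off the compact, hence closed, coordinate ball.  These two open sets cover the chart.\<close>

lemma chart_bump_smooth:
  assumes c: "c \<in> A" and r: "0 < r" and sub: "cball y (2 * r) \<subseteq> chart_img c"
  shows "chart_bump c y r \<in> smooth_functions A"
  unfolding smooth_functions_def smooth_on_def
proof (intro CollectI ballI allI)
  fix d k assume d: "d \<in> A"
  let ?K = "chart_inv c ` cball y (2 * r)"
  have "compact ?K"
    using compact_continuous_image[OF continuous_on_subset[OF continuous_on_chart_inv[OF c] sub] compact_cball] .
  then have K: "open (- ?K)" by (simp add: compact_imp_closed open_Compl)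
  let ?U = "chart_map d ` (chart_dom d \<inter> chart_dom c)" and ?V = "chart_map d ` (chart_dom d \<inter> - ?K)"
  have U: "open ?U" "open ?V"
    by (rule open_chart_map_image[OF d open_chart_dom[OF c]], rule open_chart_map_image[OF d K])
  have "Ck_on k ?U (\<lambda>z. ball_bump y r ((chart_map c \<circ> chart_inv d) z))"
    by (rule Ck_on_compose[OF U(1) subset_UNIV _ Ck_on_ball_bump])
      (use transition_smooth[OF d c] in \<open>simp add: smooth_on_def del: o_apply comp_apply\<close>)
  then have 1: "Ck_on k ?U (chart_bump c y r \<circ> chart_inv d)"
    by (rule Ck_on_cong[OF U(1), rotated]) (use d in \<open>auto simp: chart_bump_def\<close>)
  have zero: "chart_bump c y r x = 0" if "x \<notin> ?K" for x
  proof (rule chart_bump_outside[OF r])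
    show "x \<notin> chart_ball c y (2 * r)"
    proof
      assume x: "x \<in> chart_ball c y (2 * r)"
      then have "x = chart_inv c (chart_map c x)" "chart_map c x \<in> cball y (2 * r)"
        using c by (auto simp: chart_ball_def)
      then show False using that by blast
    qed
  qed
  have 2: "Ck_on k ?V (chart_bump c y r \<circ> chart_inv d)"
    by (rule Ck_on_cong[OF U(2) _ Ck_on_const[of k ?V 0]]) (use d zero in auto)
  show "Ck_on k (chart_img d) (chart_bump c y r \<circ> chart_inv d)"
  proof (rule Ck_on_local)
    fix z assume "z \<in> chart_img d"
    then obtain x where x: "x \<in> chart_dom d" "z = chart_map d x" by auto
    show "\<exists>T. open T \<and> z \<in> T \<and> Ck_on k T (chart_bump c y r \<circ> chart_inv d)"
    proof (cases "x \<in> ?K")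
      case True
      then have "x \<in> chart_dom c" using sub c by (auto simp: subset_iff)
      then have "z \<in> ?U" using x by blast
      then show ?thesis using 1 U by blast
    next
      case False
      then have "z \<in> ?V" using x by blast
      then show ?thesis using 2 U by blast
    qed
  qed
qed

lemma chart_bump_differential_bound:
  assumes c: "c \<in> A" and r: "0 < r" and sub: "cball y (2 * r) \<subseteq> chart_img c"
    and x: "x \<in> chart_ball c y (2 * r)"
  shows "coord_vector A c x w (\<lambda>x. chart_bump c y r x - t) \<le> 8 / r * norm w"
proof -
  let ?f = "\<lambda>x. chart_bump c y r x - t"
  have xc: "x \<in> chart_dom c" "norm (chart_map c x - y) < 2 * r"
    using x by (auto simp: chart_ball_def dist_norm norm_minus_commute)
  have y: "chart_map c x \<in> chart_img c" using xc by simp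
  have sm: "?f \<in> smooth_functions A"
    by (rule smooth_functions_diff_const[OF chart_bump_smooth[OF c r sub]])
  have "(ball_bump y r has_derivative frechet_derivative (ball_bump y r) (at (chart_map c x))) (at (chart_map c x))"
    using Ck_on_has_derivative[OF Ck_on_ball_bump] by blast
  then have "((\<lambda>z. ball_bump y r z - t) has_derivative frechet_derivative (ball_bump y r) (at (chart_map c x))) (at (chart_map c x))"
    by (auto intro!: derivative_eq_intros)
  then have "(?f \<circ> chart_inv c has_derivative frechet_derivative (ball_bump y r) (at (chart_map c x))) (at (chart_map c x))"
    by (rule has_derivative_transform_within_open[OF _ open_chart_img[OF c] y])
      (use c in \<open>auto simp: chart_bump_def\<close>)
  then have "frechet_derivative (?f \<circ> chart_inv c) (at (chart_map c x)) = frechet_derivative (ball_bump y r) (at (chart_map c x))"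
    by (rule frechet_derivative_at[symmetric])
  then have "coord_vector A c x w ?f = frechet_derivative (ball_bump y r) (at (chart_map c x)) w"
    using sm by (simp add: coord_vector_def)
  then show ?thesis
    using ball_bump_derivative_bound[OF r, of "chart_map c x" y w] xc by simp
qed

text \<open>Outside the ball the function attains its minimum \<open>-t\<close>, so its differential vanishes there.\<close>

lemma chart_bump_differential_zero:
  assumes c: "c \<in> A" and r: "0 < r" and sub: "cball y (2 * r) \<subseteq> chart_img c"
    and x: "x \<notin> chart_ball c y (2 * r)" and d: "d \<in> A" "x \<in> chart_dom d"
  shows "coord_vector A d x w (\<lambda>x. chart_bump c y r x - t) = 0"
proof -
  let ?f = "\<lambda>x. chart_bump c y r x - t"
  have sm: "?f \<in> smooth_functions A"
    by (rule smooth_functions_diff_const[OF chart_bump_smooth[OF c r sub]])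
  have z: "chart_map d x \<in> chart_img d" using d by simp
  have "frechet_derivative (?f \<circ> chart_inv d) (at (chart_map d x)) = (\<lambda>v. 0)"
  proof (rule differential_zero_maxmin[OF z open_chart_img[OF d(1)] smooth_function_has_derivative[OF sm d]])
    show "(\<forall>z\<in>chart_img d. (?f \<circ> chart_inv d) z \<le> (?f \<circ> chart_inv d) (chart_map d x)) \<or>
      (\<forall>z\<in>chart_img d. (?f \<circ> chart_inv d) (chart_map d x) \<le> (?f \<circ> chart_inv d) z)"
      using chart_bump_outside[OF r x] chart_bump_bounds(1) d by simp
  qed
  then show ?thesis by (simp add: coord_vector_def)
qed

end

section \<open>Conformal change\<close>

context finsler_manifold
begin

abbreviation scaled :: "('m \<Rightarrow> real) \<Rightarrow> 'm finsler" where
  "scaled \<phi> \<equiv> (\<lambda>x v. \<phi> x * F x v)"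

lemma coord_finsler_scaled:
  "coord_finsler A c (scaled \<phi>) y u = \<phi> (chart_inv c y) * G c y u"
  by (simp add: coord_finsler_def)

text \<open>Multiplying \<open>F\<close> by \<open>\<phi>\<close> shrinks its unit balls by the factor \<open>\<phi>\<close>.\<close>

lemma bh_density_scaled:
  assumes c: "c \<in> A" and y: "y \<in> chart_img c" and pos: "0 < \<phi> (chart_inv c y)"
  shows "bh_density A c (scaled \<phi>) y = \<phi> (chart_inv c y) ^ CARD('n) * bh_density A c F y"
proof -
  let ?s = "\<phi> (chart_inv c y)"
  have "{u. ?s * G c y u < 1} = (\<lambda>u. (1 / ?s) *\<^sub>R u + 0) ` indicatrix_body c y"
  proof (intro set_eqI iffI)
    fix u assume "u \<in> {u. ?s * G c y u < 1}"
    then have "?s *\<^sub>R u \<in> indicatrix_body c y" using G_scale[OF c y, of ?s u] pos by simp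
    moreover have "u = (1 / ?s) *\<^sub>R (?s *\<^sub>R u) + 0" using pos by simp
    ultimately show "u \<in> (\<lambda>u. (1 / ?s) *\<^sub>R u + 0) ` indicatrix_body c y" by blast
  next
    fix u assume "u \<in> (\<lambda>u. (1 / ?s) *\<^sub>R u + 0) ` indicatrix_body c y"
    then obtain w where w: "G c y w < 1" "u = (1 / ?s) *\<^sub>R w" by auto
    have "?s * G c y u = G c y w"
      using G_scale[OF c y, of "1 / ?s" w] pos w(2) by simp
    then show "u \<in> {u. ?s * G c y u < 1}" using w by simp
  qed
  moreover have "measure lborel ((\<lambda>u. (1 / ?s) *\<^sub>R u + 0) ` indicatrix_body c y) =
      \<bar>1 / ?s\<bar> ^ CARD('n) * measure lborel (indicatrix_body c y)"
  proof -
    have "open {u. ?s * G c y u < 1}"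
      by (intro open_Collect_less continuous_intros continuous_on_G[OF c y])
    then have "(\<lambda>u. (1 / ?s) *\<^sub>R u + 0) ` indicatrix_body c y \<in> sets borel"
      unfolding calculation by (rule borel_open)
    then show ?thesis
      using measure_lebesgue_affine[of "1 / ?s" 0 "indicatrix_body c y"] open_indicatrix_body[OF c y]
      by (simp add: measure_def)
  qed
  ultimately have "measure lborel {u. ?s * G c y u < 1} =
      (1 / ?s) ^ CARD('n) * measure lborel (indicatrix_body c y)"
    using pos by simp
  then show ?thesis
    using pos unfolding bh_density_def coord_finsler_scaled by (simp add: power_one_over)
qed

lemma bh_measure_scaled:
  assumes \<phi>: "\<phi> \<in> smooth_functions A" "\<And>x. 0 < \<phi> x" and fin: "finsler_metric A (scaled \<phi>)"
  shows "bh_measure A (scaled \<phi>) = density bh (\<lambda>x. ennreal (\<phi> x ^ CARD('n)))"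
proof -
  interpret S: finsler_manifold A "scaled \<phi>" by standard (rule fin)
  have m[measurable]: "\<phi> \<in> borel_measurable borel"
    by (rule borel_measurable_continuous_onI[OF smooth_function_continuous[OF \<phi>(1)]])
  have "S.is_bh_measure (density bh (\<lambda>x. ennreal (\<phi> x ^ CARD('n))))"
    unfolding S.is_bh_measure_def
  proof (intro conjI ballI impI)
    fix c and B :: "'m set" assume c: "c \<in> A" and B[measurable]: "B \<in> sets borel" and Bc: "B \<subseteq> chart_dom c"
    have "emeasure (density bh (\<lambda>x. ennreal (\<phi> x ^ CARD('n)))) B =
        (\<integral>\<^sup>+x. ennreal (\<phi> x ^ CARD('n)) * indicator B x \<partial>bh)"
      by (rule emeasure_density) auto
    also have "\<dots> = (\<integral>\<^sup>+x. indicator (chart_dom c) x * (ennreal (\<phi> x ^ CARD('n)) * indicator B x) \<partial>bh)"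
      using Bc by (intro nn_integral_cong) (auto simp: indicator_def)
    also have "\<dots> = (\<integral>\<^sup>+y. ennreal (bh_density A c F y) *
        (ennreal (\<phi> (chart_inv c y) ^ CARD('n)) * indicator B (chart_inv c y)) * indicator (chart_img c) y \<partial>lborel)"
      by (rule nn_integral_bh_chart[OF c]) measurable
    also have "\<dots> = (\<integral>\<^sup>+y. ennreal (bh_density A c (scaled \<phi>) y) * indicator (chart_map c ` B) y \<partial>lborel)"
      unfolding chart_map_image_subset_eq[OF c Bc]
    proof (intro nn_integral_cong)
      fix y
      show "ennreal (bh_density A c F y) * (ennreal (\<phi> (chart_inv c y) ^ CARD('n)) * indicator B (chart_inv c y)) *
          indicator (chart_img c) y =
        ennreal (bh_density A c (scaled \<phi>) y) * indicator (chart_inv c -` B \<inter> chart_img c) y"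
      proof (cases "y \<in> chart_inv c -` B \<inter> chart_img c")
        case True
        then have "bh_density A c (scaled \<phi>) y = \<phi> (chart_inv c y) ^ CARD('n) * bh_density A c F y"
          using bh_density_scaled[where \<phi> = \<phi>, OF c _ \<phi>(2)] by blast
        moreover have "0 \<le> \<phi> (chart_inv c y) ^ CARD('n)" using \<phi>(2) less_imp_le by (intro zero_le_power) blast
        ultimately show ?thesis
          using True bh_density_nonneg by (simp add: ennreal_mult mult.commute)
      next
        case False
        then show ?thesis by (cases "y \<in> chart_img c") (simp_all add: indicator_def)
      qed
    qed
    finally show "emeasure (density bh (\<lambda>x. ennreal (\<phi> x ^ CARD('n)))) B =
      (\<integral>\<^sup>+y. ennreal (bh_density A c (scaled \<phi>) y) * indicator (chart_map c ` B) y \<partial>lborel)" .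
  qed simp
  then show ?thesis by (rule S.bh_measure_eqI)
qed

section \<open>The gradient and the Sobolev space\<close>

text \<open>At the maximizer \<open>v\<close> of the Legendre transform \<open>F(v)\<^sup>2 = \<alpha>(v)\<close>, and \<open>\<alpha>(v)\<close> is at most
  \<open>L/a\<close> times \<open>F(v)\<close>.\<close>

lemma gradient_norm_le:
  assumes c: "c \<in> A" and x: "x \<in> chart_dom c" and lin: "linear (\<lambda>u. \<alpha> (coord_vector A c x u))"
    and a: "0 < a" "\<And>u. a * norm u \<le> G c (chart_map c x) u" and L: "0 \<le> L" "\<And>u. \<alpha> (coord_vector A c x u) \<le> L * norm u"
  shows "F x (legendre A F x \<alpha>) \<le> L / a"
proof -
  obtain u where u: "legendre A F x \<alpha> = coord_vector A c x u"
    "(F x (legendre A F x \<alpha>))\<^sup>2 = \<alpha> (coord_vector A c x u)"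
    by (rule legendre_coord[OF c x lin])
  let ?N = "F x (legendre A F x \<alpha>)"
  have N: "?N = G c (chart_map c x) u" using u(1) G_chart_map[OF c x] by simp
  then have N0: "0 \<le> ?N" using G_nonneg[OF c] x by simp
  have "?N\<^sup>2 \<le> L * norm u" using u(2) L(2) by simp
  also have "\<dots> \<le> L * (?N / a)"
    using L(1) a by (intro mult_left_mono) (simp_all add: N field_simps)
  finally have "?N * ?N \<le> (L / a) * ?N" by (simp add: power2_eq_square)
  then have "?N = 0 \<or> ?N \<le> L / a"
    using N0 by (metis less_eq_real_def mult_le_cancel_right not_less)
  then show ?thesis using L(1) a(1) by auto
qed

lemma gradient_norm_nonneg:
  assumes c: "c \<in> A" and x: "x \<in> chart_dom c" and lin: "linear (\<lambda>u. \<alpha> (coord_vector A c x u))"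
  shows "0 \<le> F x (legendre A F x \<alpha>)"
proof -
  obtain u where u: "legendre A F x \<alpha> = coord_vector A c x u"
    "(F x (legendre A F x \<alpha>))\<^sup>2 = \<alpha> (coord_vector A c x u)"
    by (rule legendre_coord[OF c x lin])
  have "0 \<le> G c (chart_map c x) u" using G_nonneg[OF c] x by simp
  then show ?thesis using u(1) G_chart_map[OF c x] by simp
qed

text \<open>The constant sequence converges to \<open>f\<close>, with the dual metric of the zero covector equal to \<open>0\<close>.\<close>

lemma smooth_in_sobolev:
  assumes f: "f \<in> smooth_functions A" and p: "0 < p"
  shows "(f, differential f) \<in> sobolev A F p"
proof -
  have "f \<in> borel_measurable borel"
    by (rule borel_measurable_continuous_onI[OF smooth_function_continuous[OF f]])
  moreover have "measurable_covector_field A (differential f)"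
    unfolding measurable_covector_field_def
  proof (intro ballI conjI allI)
    fix c x assume "c \<in> A" "x \<in> chart_dom c"
    then show "linear (\<lambda>u. differential f x (coord_vector A c x u))"
      unfolding differential_def by (rule linear_coord_vector)
  next
    fix c u assume c: "c \<in> A"
    have "continuous_on (chart_dom c) (\<lambda>x. frechet_derivative (f \<circ> chart_inv c) (at (chart_map c x)) u)"
    proof (rule continuous_on_compose2[OF _ continuous_on_chart_map[OF c] order_refl])
      show "continuous_on (chart_img c) (\<lambda>y. frechet_derivative (f \<circ> chart_inv c) (at y) u)"
        by (rule smooth_on_continuous[OF smooth_on_derivative]) (use f c in \<open>simp add: smooth_functions_def\<close>)
    qed
    then show "(\<lambda>x. differential f x (coord_vector A c x u)) \<in> borel_measurable (restrict_space borel (chart_dom c))"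
      using f by (intro borel_measurable_continuous_on_restrict) (simp add: differential_def coord_vector_def)
  qed
  moreover have "dual_metric A F x (\<lambda>v. 0) = 0" for x
  proof -
    obtain c where c: "c \<in> A" "x \<in> chart_dom c" by (rule chart_at)
    have "F x (coord_vector A c x 0) = 0"
      using G_chart_map[OF c, of 0] G_zero[OF c(1), of "chart_map c x"] c(2) by simp
    then have "coord_vector A c x 0 \<in> {v \<in> tangent_space A x. F x v \<le> 1}"
      using tangent_space_eq[OF c] by simp
    then have "{v \<in> tangent_space A x. F x v \<le> 1} \<noteq> {}" by blast
    then show ?thesis unfolding dual_metric_def by (rule cSUP_const)
  qed
  ultimately show ?thesis
    using f p unfolding sobolev_def by (auto intro!: exI[of _ "\<lambda>_. f"])
qed

lemma first_eigenvalue_le: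
  assumes f: "f \<in> smooth_functions A" and p: "0 < p"
    and mean: "(\<integral>x. \<bar>f x\<bar> powr (p - 2) * f x \<partial>bh) = 0"
    and den: "0 < d" "ennreal d \<le> (\<integral>\<^sup>+x. ennreal (\<bar>f x\<bar> powr p) \<partial>bh)"
    and num: "(\<integral>\<^sup>+x. ennreal (F x (legendre A F x (differential f x)) powr p) \<partial>bh) \<le> ennreal e"
    and e: "0 \<le> e"
  shows "first_eigenvalue A F p \<le> ennreal (e / d)"
proof -
  have "\<not> (AE x in bh. f x = 0)"
  proof
    assume "AE x in bh. f x = 0"
    then have "(\<integral>\<^sup>+x. ennreal (\<bar>f x\<bar> powr p) \<partial>bh) = (\<integral>\<^sup>+x. 0 \<partial>bh)"
      by (intro nn_integral_cong_AE) auto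
    then show False using den by simp
  qed
  then have mem: "(f, differential f) \<in> sobolev_mean_zero A F p"
    using smooth_in_sobolev[OF f p] mean by (simp add: sobolev_mean_zero_def)
  have "first_eigenvalue A F p \<le>
     (\<integral>\<^sup>+x. ennreal (F x (legendre A F x (differential f x)) powr p) \<partial>bh) /
     (\<integral>\<^sup>+x. ennreal (\<bar>f x\<bar> powr p) \<partial>bh)"
    unfolding first_eigenvalue_def by (rule INF_lower2[OF mem]) simp
  also have "\<dots> \<le> ennreal (e / d)"
  proof (rule divide_le_posI_ennreal)
    show "0 < (\<integral>\<^sup>+x. ennreal (\<bar>f x\<bar> powr p) \<partial>bh)"
      using den by (meson ennreal_less_zero_iff order_less_le_trans)
    have "ennreal e = ennreal d * ennreal (e / d)"
      using den(1) e by (simp flip: ennreal_mult)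
    also have "\<dots> \<le> (\<integral>\<^sup>+x. ennreal (\<bar>f x\<bar> powr p) \<partial>bh) * ennreal (e / d)"
      using den(2) by (rule mult_right_mono) simp
    finally show "(\<integral>\<^sup>+x. ennreal (F x (legendre A F x (differential f x)) powr p) \<partial>bh) \<le>
      (\<integral>\<^sup>+x. ennreal (\<bar>f x\<bar> powr p) \<partial>bh) * ennreal (e / d)"
      using num by (rule order_trans[rotated])
  qed
  finally show ?thesis .
qed

end

section \<open>Concentration and energy estimates\<close>

lemma powr_le_one_plus_power:
  fixes s p :: real
  assumes "0 \<le> s" "0 \<le> p" "p \<le> real n"
  shows "s powr p \<le> 1 + s ^ n"
proof (cases "s \<le> 1")
  case True
  then have "s powr p \<le> 1 powr p" using assms by (intro powr_mono2) auto
  moreover have "0 \<le> s ^ n" using assms by simp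
  ultimately show ?thesis by simp
next
  case False
  then have "s powr p \<le> s powr real n" using assms by (intro powr_mono) auto
  also have "\<dots> = s ^ n" using False by (intro powr_realpow) simp
  finally show ?thesis by simp
qed

lemma (in smooth_manifold) borel_chart_ball [measurable]: "c \<in> A \<Longrightarrow> chart_ball c y r \<in> sets borel"
  by (simp add: open_chart_ball)

context finsler_manifold
begin

lemma emeasure_bh_le:
  assumes c: "c \<in> A" and B: "B \<in> sets borel" "B \<subseteq> chart_dom c" "chart_map c ` B \<subseteq> ball y r"
    and r: "0 \<le> r" and b: "0 < b" "\<And>x u. x \<in> B \<Longrightarrow> G c (chart_map c x) u \<le> b * norm u"
  shows "emeasure bh B \<le> ennreal (b ^ CARD('n) * (r ^ CARD('n) * measure lborel (ball (0 :: real ^ 'n) 1)))"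
proof -
  have "emeasure bh B = (\<integral>\<^sup>+y. ennreal (bh_density A c F y) * indicator (chart_map c ` B) y \<partial>lborel)"
    by (rule emeasure_bh_chart[OF c B(1,2)])
  also have "\<dots> \<le> (\<integral>\<^sup>+z. ennreal (b ^ CARD('n)) * indicator (ball y r) z \<partial>lborel)"
  proof (rule nn_integral_mono)
    fix z
    show "ennreal (bh_density A c F z) * indicator (chart_map c ` B) z \<le> ennreal (b ^ CARD('n)) * indicator (ball y r) z"
    proof (cases "z \<in> chart_map c ` B")
      case True
      then obtain x where x: "x \<in> B" "z = chart_map c x" by blast
      have "bh_density A c F z \<le> b ^ CARD('n)"
        by (rule bh_density_le[OF c _ b(1)]) (use x B(2) b(2) in auto)
      then show ?thesis using True B(3) by (auto simp: indicator_def intro: ennreal_leI)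
    qed simp
  qed
  also have "\<dots> = ennreal (b ^ CARD('n)) * emeasure lborel (ball y r)"
    by (simp add: nn_integral_cmult_indicator)
  also have "emeasure lborel (ball y r) = ennreal (measure lborel (ball y r))"
    using emeasure_lborel_ball_finite[of y r] by (intro emeasure_eq_ennreal_measure) auto
  also have "measure lborel (ball y r) = r ^ CARD('n) * measure lborel (ball (0 :: real ^ 'n) 1)"
    using content_ball_conv_unit_ball[OF r, of y] by simp
  finally show ?thesis using b(1) r by (simp add: ennreal_mult)
qed

text \<open>The measure has bounded density in the coordinates of a compact ball.\<close>

lemma small_chart_balls:
  assumes c: "c \<in> A" and R: "cball z R \<subseteq> chart_img c" and \<epsilon>: "0 < \<epsilon>"
  obtains \<delta> where "0 < \<delta>" "\<forall>y. measure bh (chart_ball c z R \<inter> chart_ball c y \<delta>) < \<epsilon>"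
proof -
  let ?\<omega> = "measure lborel (ball (0 :: real ^ 'n) 1)"
  obtain a b where ab: "0 < a" "0 < b" "\<forall>y\<in>cball z R. \<forall>u. a * norm u \<le> G c y u \<and> G c y u \<le> b * norm u"
    by (rule G_bounds[OF c compact_cball R])
  define Q where "Q = b ^ CARD('n) * ?\<omega> + 1"
  have Q: "0 < Q" using ab(2) by (simp add: Q_def add_nonneg_pos)
  \<comment> \<open>For \<open>\<delta> \<le> 1\<close> the volume \<open>\<delta>\<^sup>n\<close> is at most \<open>\<delta>\<close>, so a linear choice suffices.\<close>
  define \<delta> where "\<delta> = min 1 (\<epsilon> / (2 * Q))"
  have \<delta>: "0 < \<delta>" "\<delta> \<le> 1" "\<delta> \<le> \<epsilon> / (2 * Q)" using Q \<epsilon> by (auto simp: \<delta>_def)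
  have "measure bh (chart_ball c z R \<inter> chart_ball c y \<delta>) < \<epsilon>" for y
  proof -
    let ?B = "chart_ball c z R \<inter> chart_ball c y \<delta>"
    have "emeasure bh ?B \<le> ennreal (b ^ CARD('n) * (\<delta> ^ CARD('n) * ?\<omega>))"
    proof (rule emeasure_bh_le[OF c])
      show "?B \<in> sets borel" using c by simp
      show "?B \<subseteq> chart_dom c" "chart_map c ` ?B \<subseteq> ball y \<delta>" by (auto simp: chart_ball_def)
      show "G c (chart_map c x) u \<le> b * norm u" if "x \<in> ?B" for x u
        using that ab(3) by (auto simp: chart_ball_def)
    qed (use \<delta> ab in auto)
    then have "measure bh ?B \<le> b ^ CARD('n) * (\<delta> ^ CARD('n) * ?\<omega>)"
      using ab(2) \<delta>(1) unfolding measure_def by (intro enn2real_leI) auto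
    also have "\<dots> \<le> b ^ CARD('n) * (\<delta> * ?\<omega>)"
    proof -
      have "\<delta> ^ CARD('n) \<le> \<delta> ^ 1" using \<delta> by (intro power_decreasing) (auto simp: Suc_leI)
      then show ?thesis using ab(2) by (intro mult_left_mono mult_right_mono) auto
    qed
    also have "\<dots> \<le> Q * \<delta>" using \<delta>(1) by (simp add: Q_def algebra_simps)
    also have "\<dots> \<le> \<epsilon> / 2" using \<delta>(3) Q by (simp add: field_simps)
    also have "\<dots> < \<epsilon>" using \<epsilon> by simp
    finally show ?thesis .
  qed
  then show ?thesis using that \<delta>(1) by blast
qed

text \<open>The Euclidean statement is applied to the part of the measure in the coordinate ball around \<open>z\<close>,
  pushed forward to coordinates.  The concentrated ball then meets the ball around \<open>z\<close> and has
  radius at most \<open>R\<close>, so its double stays inside the ball of radius \<open>5R\<close>.\<close>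

lemma concentrated_chart_ball:
  assumes c: "c \<in> A" and R: "0 < R" "cball z (5 * R) \<subseteq> chart_img c"
    and fin: "emeasure bh UNIV < \<infinity>" and m: "0 < m" "m \<le> measure bh (chart_ball c z R)"
    and N: "0 < N" "\<forall>(y :: real ^ 'n) r. 0 < r \<longrightarrow>
       (\<exists>X. finite X \<and> card X \<le> N \<and> ball y (2 * r) \<subseteq> (\<Union>x\<in>X. ball x (r / 2)))"
  obtains y r where "0 < r" "cball y (2 * r) \<subseteq> cball z (5 * R)"
    "m / (2 * N) \<le> measure bh (chart_ball c y r)"
    "m / (2 * N) \<le> measure bh (- chart_ball c y (2 * r))"
proof -
  interpret B: finite_measure bh
    by (rule finite_measureI) (use fin in auto)
  let ?S = "chart_ball c z R"
  have S[measurable]: "?S \<in> sets borel" using c by simp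
  define \<nu> where "\<nu> = distr (restrict_space bh ?S) borel (chart_map c)"
  have sets: "sets \<nu> = sets borel" by (simp add: \<nu>_def)
  have "continuous_on ?S (chart_map c)"
    by (rule continuous_on_subset[OF continuous_on_chart_map[OF c]]) (auto simp: chart_ball_def)
  then have "chart_map c \<in> borel_measurable (restrict_space borel ?S)"
    by (rule borel_measurable_continuous_on_restrict)
  then have map: "chart_map c \<in> restrict_space bh ?S \<rightarrow>\<^sub>M borel"
    by (simp cong: measurable_cong_sets sets_restrict_space_cong)
  have \<nu>: "emeasure \<nu> (ball y r) = emeasure bh (?S \<inter> chart_ball c y r)" for y r
  proof -
    have "emeasure \<nu> (ball y r) = emeasure (restrict_space bh ?S) (chart_map c -` ball y r \<inter> space (restrict_space bh ?S))"
      unfolding \<nu>_def by (rule emeasure_distr[OF map]) simp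
    also have "chart_map c -` ball y r \<inter> space (restrict_space bh ?S) = ?S \<inter> chart_ball c y r"
      by (auto simp: space_restrict_space chart_ball_def)
    also have "emeasure (restrict_space bh ?S) \<dots> = emeasure bh \<dots>"
      by (rule emeasure_restrict_space) auto
    finally show ?thesis .
  qed
  then have \<nu>m: "measure \<nu> (ball y r) = measure bh (?S \<inter> chart_ball c y r)" for y r
    by (simp add: measure_def)
  have fin\<nu>: "finite_measure \<nu>"
  proof (rule finite_measureI)
    have "emeasure \<nu> (space \<nu>) = emeasure (restrict_space bh ?S) (space (restrict_space bh ?S))"
      unfolding \<nu>_def using map by (subst emeasure_distr) (auto simp: measurable_space intro!: arg_cong[where f = "emeasure _"])
    also have "\<dots> = emeasure bh ?S"
      by (simp add: space_restrict_space emeasure_restrict_space)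
    finally show "emeasure \<nu> (space \<nu>) \<noteq> \<infinity>" by simp
  qed
  have "cball z R \<subseteq> chart_img c" using R by (intro order_trans[OF subset_cball R(2)]) auto
  then obtain \<delta> where \<delta>: "0 < \<delta>" "\<forall>y. measure bh (?S \<inter> chart_ball c y \<delta>) < m / (2 * N)"
    using small_chart_balls[OF c, of z R "m / (2 * N)"] m(1) N(1) by auto
  have m\<nu>: "m \<le> measure \<nu> (ball z R)" using m(2) by (simp add: \<nu>m)
  have \<delta>\<nu>: "\<forall>y. measure \<nu> (ball y \<delta>) < m / (2 * N)" using \<delta>(2) by (simp add: \<nu>m)
  obtain y r where yr: "0 < r" "r \<le> R" "m / (2 * N) \<le> measure \<nu> (ball y r)"
    "measure \<nu> (ball y (2 * r)) \<le> m / 2"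
    by (rule concentrated_ball[OF fin\<nu> sets N R(1) m(1) m\<nu> \<delta>(1) \<delta>\<nu>])
  have Nm: "m / (2 * N) \<le> m / 2" "0 < m / (2 * N)" using N(1) m(1) by (auto simp: field_simps)
  have "?S \<inter> chart_ball c y r \<noteq> {}"
  proof
    assume "?S \<inter> chart_ball c y r = {}"
    then show False using yr(3) Nm(2) by (simp add: \<nu>m)
  qed
  then obtain x where "dist z (chart_map c x) < R" "dist y (chart_map c x) < r"
    by (auto simp: chart_ball_def)
  then have "dist z y < 2 * R" using yr(2) by (smt (verit) dist_commute dist_triangle)
  then have sub: "cball y (2 * r) \<subseteq> cball z (5 * R)"
    using yr(2) R(1) by (auto simp: subset_iff) (smt (verit) dist_triangle)
  have in1: "m / (2 * N) \<le> measure bh (chart_ball c y r)"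
  proof -
    have "measure bh (?S \<inter> chart_ball c y r) \<le> measure bh (chart_ball c y r)"
      using c by (intro B.finite_measure_mono) auto
    then show ?thesis using yr(3) by (simp add: \<nu>m)
  qed
  have "measure bh ?S \<le> measure bh (?S \<inter> chart_ball c y (2 * r)) + measure bh (- chart_ball c y (2 * r))"
  proof -
    have [measurable]: "chart_ball c y (2 * r) \<in> sets borel" using c by simp
    have "measure bh ?S \<le> measure bh ((?S \<inter> chart_ball c y (2 * r)) \<union> (- chart_ball c y (2 * r)))"
      by (intro B.finite_measure_mono) auto
    also have "\<dots> \<le> measure bh (?S \<inter> chart_ball c y (2 * r)) + measure bh (- chart_ball c y (2 * r))"
      by (intro measure_Un_le) auto
    finally show ?thesis .
  qed
  then have in2: "m / (2 * N) \<le> measure bh (- chart_ball c y (2 * r))"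
    using yr(4) m(2) Nm(1) by (simp add: \<nu>m)
  show ?thesis by (rule that[OF yr(1) sub in1 in2])
qed

text \<open>The gradient of the bump function has norm at most \<open>8/(r a \<phi>)\<close> on the ball of radius \<open>2r\<close> and
  vanishes elsewhere.  The \<open>n\<close>-th power of \<open>1/\<phi>\<close> cancels the factor \<open>\<phi>\<^sup>n\<close> of the measure.\<close>

lemma energy_le:
  assumes c: "c \<in> A" and r: "0 < r" and sub: "cball y (2 * r) \<subseteq> chart_img c"
    and ab: "0 < a" "0 < b" "\<And>z u. z \<in> cball y (2 * r) \<Longrightarrow> a * norm u \<le> G c z u \<and> G c z u \<le> b * norm u"
    and \<phi>: "\<phi> \<in> smooth_functions A" "\<And>x. 0 < \<phi> x" and fin: "finsler_metric A (scaled \<phi>)"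
    and p: "0 \<le> p" "p \<le> real CARD('n)"
    and V: "0 < V" "emeasure (bh_measure A (scaled \<phi>)) UNIV = ennreal V"
  shows "(\<integral>\<^sup>+x. ennreal ((scaled \<phi>) x (legendre A (scaled \<phi>) x
      (differential (\<lambda>x. chart_bump c y r x - t) x)) powr p) \<partial>bh_measure A (scaled \<phi>))
    \<le> ennreal (V powr (1 - p / CARD('n)) *
        (1 + (16 * b / a) ^ CARD('n) * measure lborel (ball (0 :: real ^ 'n) 1)))"
proof -
  interpret S: finsler_manifold A "scaled \<phi>" by standard (rule fin)
  let ?f = "\<lambda>x. chart_bump c y r x - t" and ?S = "chart_ball c y (2 * r)"
  let ?n = "CARD('n)" and ?\<omega> = "measure lborel (ball (0 :: real ^ 'n) 1)"
  define N where "N x = \<phi> x * F x (legendre A (scaled \<phi>) x (differential ?f x))" for x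
  have lin: "linear (\<lambda>u. differential ?f x (coord_vector A d x u))" if "d \<in> A" "x \<in> chart_dom d" for d x
    unfolding differential_def using that by (rule linear_coord_vector)
  have N0: "0 \<le> N x" for x
  proof -
    obtain d where d: "d \<in> A" "x \<in> chart_dom d" by (rule chart_at)
    show ?thesis unfolding N_def using S.gradient_norm_nonneg[OF d lin[OF d]] .
  qed
  have N_in: "N x \<le> 8 / (r * a) / \<phi> x" if x: "x \<in> ?S" for x
  proof -
    have xc: "x \<in> chart_dom c" "chart_map c x \<in> cball y (2 * r)" using x by (auto simp: chart_ball_def)
    have "N x \<le> (8 / r) / (\<phi> x * a)"
      unfolding N_def
    proof (rule S.gradient_norm_le[OF c xc(1) lin[OF c xc(1)]])
      show "0 < \<phi> x * a" using \<phi>(2) ab(1) by simp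
      show "\<phi> x * a * norm u \<le> coord_finsler A c (scaled \<phi>) (chart_map c x) u" for u
        using ab(3)[OF xc(2), of u] \<phi>(2)[of x] xc(1) c by (simp add: coord_finsler_scaled mult.assoc)
      show "0 \<le> 8 / r" using r by simp
      show "differential ?f x (coord_vector A c x u) \<le> 8 / r * norm u" for u
        unfolding differential_def by (rule chart_bump_differential_bound[OF c r sub x])
    qed
    then show ?thesis by (simp add: mult_ac)
  qed
  have N_out: "N x = 0" if x: "x \<notin> ?S" for x
  proof -
    obtain d where d: "d \<in> A" "x \<in> chart_dom d" by (rule chart_at)
    then have dx: "chart_map d x \<in> chart_img d" by simp
    obtain a' b' where ab': "0 < a'" "0 < b'"
      "\<forall>u. a' * norm u \<le> S.G d (chart_map d x) u \<and> S.G d (chart_map d x) u \<le> b' * norm u"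
      by (rule S.G_bounds_at[OF d(1) dx])
    have "N x \<le> 0 / a'"
      unfolding N_def
    proof (rule S.gradient_norm_le[OF d lin[OF d] ab'(1)])
      show "a' * norm u \<le> S.G d (chart_map d x) u" for u using ab'(3) by blast
      show "differential ?f x (coord_vector A d x u) \<le> 0 * norm u" for u
        using chart_bump_differential_zero[OF c r sub x d] by (simp add: differential_def)
    qed simp
    then show ?thesis using N0[of x] by simp
  qed
  \<comment> \<open>\<open>K\<close> is the size of the gradient for which the two terms of \<open>s\<^sup>p \<le> 1 + s\<^sup>n\<close>, with \<open>s\<close> the
    quotient of the gradient norm by \<open>K\<close>, integrate to the same power of \<open>V\<close>.\<close>
  define K where "K = V powr (- 1 / ?n)"
  have K: "0 < K" using V by (simp add: K_def)
  define E where "E = (8 / (r * a * K)) ^ ?n"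
  have E: "0 \<le> E" using r ab K by (simp add: E_def)
  have pt: "ennreal (N x powr p) \<le> ennreal (K powr p) +
      ennreal (K powr p * E) * (ennreal (1 / \<phi> x ^ ?n) * indicator ?S x)" for x
  proof (cases "x \<in> ?S")
    case True
    let ?q = "8 / (r * a) / \<phi> x"
    have q: "0 < ?q" using r ab \<phi>(2) by simp
    have "N x powr p \<le> ?q powr p" using N_in[OF True] N0 p by (intro powr_mono2) auto
    also have "?q powr p = K powr p * (?q / K) powr p"
      using q K powr_mult[of K "?q / K" p] by simp
    also have "\<dots> \<le> K powr p * (1 + (?q / K) ^ ?n)"
      using q K p by (intro mult_left_mono powr_le_one_plus_power) auto
    also have "(?q / K) ^ ?n = E * (1 / \<phi> x ^ ?n)"
      by (simp add: E_def power_divide power_mult_distrib mult_ac)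
    finally have "N x powr p \<le> K powr p + K powr p * E * (1 / \<phi> x ^ ?n)" by (simp add: algebra_simps)
    then have "ennreal (N x powr p) \<le> ennreal (K powr p + K powr p * E * (1 / \<phi> x ^ ?n))"
      by (rule ennreal_leI)
    also have "\<dots> = ennreal (K powr p) + ennreal (K powr p * E) * ennreal (1 / \<phi> x ^ ?n)"
      using E \<phi>(2)[of x] by (subst ennreal_plus) (auto simp flip: ennreal_mult)
    finally show ?thesis using True by simp
  next
    case False
    then show ?thesis using N_out by simp
  qed
  have [measurable]: "\<phi> \<in> borel_measurable borel"
    by (rule borel_measurable_continuous_onI[OF smooth_function_continuous[OF \<phi>(1)]])
  have [measurable]: "?S \<in> sets borel" using c by simp
  have "(\<integral>\<^sup>+x. ennreal (1 / \<phi> x ^ ?n) * indicator ?S x \<partial>bh_measure A (scaled \<phi>)) =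
      (\<integral>\<^sup>+x. ennreal (\<phi> x ^ ?n) * (ennreal (1 / \<phi> x ^ ?n) * indicator ?S x) \<partial>bh)"
    unfolding bh_measure_scaled[OF \<phi> fin] by (rule nn_integral_density) auto
  also have "\<dots> = (\<integral>\<^sup>+x. indicator ?S x \<partial>bh)"
  proof (rule nn_integral_cong)
    fix x
    have "ennreal (\<phi> x ^ ?n) * ennreal (1 / \<phi> x ^ ?n) = 1"
      using \<phi>(2)[of x] by (subst ennreal_mult[symmetric]) auto
    then show "ennreal (\<phi> x ^ ?n) * (ennreal (1 / \<phi> x ^ ?n) * indicator ?S x) = indicator ?S x"
      by (simp flip: mult.assoc)
  qed
  also have "\<dots> = emeasure bh ?S" by simp
  also have "\<dots> \<le> ennreal (b ^ ?n * ((2 * r) ^ ?n * ?\<omega>))"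
  proof (rule emeasure_bh_le[OF c])
    show "?S \<subseteq> chart_dom c" "chart_map c ` ?S \<subseteq> ball y (2 * r)" by (auto simp: chart_ball_def)
    show "G c (chart_map c x) u \<le> b * norm u" if "x \<in> ?S" for x u
      using that ab(3)[of "chart_map c x" u] by (auto simp: chart_ball_def)
  qed (use r ab in auto)
  finally have int: "(\<integral>\<^sup>+x. ennreal (1 / \<phi> x ^ ?n) * indicator ?S x \<partial>bh_measure A (scaled \<phi>)) \<le>
    ennreal (b ^ ?n * ((2 * r) ^ ?n * ?\<omega>))" .
  have "(\<integral>\<^sup>+x. ennreal (N x powr p) \<partial>bh_measure A (scaled \<phi>)) \<le>
      (\<integral>\<^sup>+x. ennreal (K powr p) + ennreal (K powr p * E) * (ennreal (1 / \<phi> x ^ ?n) * indicator ?S x)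
        \<partial>bh_measure A (scaled \<phi>))"
    by (rule nn_integral_mono) (rule pt)
  also have "\<dots> = ennreal (K powr p) * ennreal V + ennreal (K powr p * E) *
      (\<integral>\<^sup>+x. ennreal (1 / \<phi> x ^ ?n) * indicator ?S x \<partial>bh_measure A (scaled \<phi>))"
    using V(2) by (simp add: nn_integral_add nn_integral_cmult)
  also have "\<dots> \<le> ennreal (K powr p) * ennreal V + ennreal (K powr p * E) * ennreal (b ^ ?n * ((2 * r) ^ ?n * ?\<omega>))"
    by (intro add_left_mono mult_left_mono int) simp
  also have "\<dots> = ennreal (K powr p * V + K powr p * E * (b ^ ?n * ((2 * r) ^ ?n * ?\<omega>)))"
    using E V ab r by (simp add: ennreal_plus ennreal_mult)
  also have "K powr p * V + K powr p * E * (b ^ ?n * ((2 * r) ^ ?n * ?\<omega>)) =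
      V powr (1 - p / ?n) * (1 + (16 * b / a) ^ ?n * ?\<omega>)"
  proof -
    have "K ^ ?n = V powr (- 1 / ?n * ?n)"
      using K powr_realpow[OF K, of ?n] by (simp add: K_def powr_powr)
    then have Kn: "K ^ ?n = 1 / V" using V(1) by (simp add: powr_minus_divide)
    have "K powr p = V powr (- p / ?n)" by (simp add: K_def powr_powr)
    then have Kp: "K powr p * V = V powr (1 - p / ?n)"
      using V(1) powr_add[of V "- p / ?n" 1] by simp
    have "E * (b ^ ?n * ((2 * r) ^ ?n * ?\<omega>)) = (8 / (r * a * K) * b * (2 * r)) ^ ?n * ?\<omega>"
      by (simp only: E_def power_mult_distrib mult_ac)
    also have "8 / (r * a * K) * b * (2 * r) = (16 * b / a) / K" using r by simp
    also have "((16 * b / a) / K) ^ ?n * ?\<omega> = V * ((16 * b / a) ^ ?n * ?\<omega>)"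
      unfolding power_divide[of "16 * b / a" K] Kn by simp
    finally have "K powr p * E * (b ^ ?n * ((2 * r) ^ ?n * ?\<omega>)) = K powr p * V * ((16 * b / a) ^ ?n * ?\<omega>)"
      by (simp add: mult.assoc)
    then show ?thesis by (simp add: Kp distrib_left)
  qed
  finally show ?thesis by (simp add: N_def)
qed

text \<open>The constant comes from the comparison of \<open>F\<close> with the Euclidean norm on one compact coordinate ball,
  so it serves all conformal factors.  The powers of \<open>V\<close> cancel: \<open>V\<^bsup>1-p/n\<^esup>\<close> from the energy and
  \<open>V\<^bsup>p/n\<^esup>\<close> against the factor \<open>V\<close> in the \<open>p\<close>-norm.\<close>

lemma local_eigenvalue_bound:
  assumes c: "c \<in> A" and R: "0 < R" "cball z (5 * R) \<subseteq> chart_img c" and k: "0 < k"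
    and p: "1 < p" "p \<le> real CARD('n)"
  shows "\<exists>C. \<forall>\<phi> V. \<phi> \<in> smooth_functions A \<and> (\<forall>x. 0 < \<phi> x) \<and> finsler_metric A (scaled \<phi>) \<and> 0 < V \<and>
      emeasure (bh_measure A (scaled \<phi>)) UNIV = ennreal V \<and>
      V / k \<le> measure (bh_measure A (scaled \<phi>)) (chart_ball c z R) \<longrightarrow>
      first_eigenvalue A (scaled \<phi>) p * ennreal (V powr (p / CARD('n))) \<le> ennreal C"
proof -
  obtain a b where ab: "0 < a" "0 < b" "\<forall>y\<in>cball z (5 * R). \<forall>u. a * norm u \<le> G c y u \<and> G c y u \<le> b * norm u"
    by (rule G_bounds[OF c compact_cball R(2)])
  obtain N where N: "0 < N" "\<forall>(y :: real ^ 'n) r. 0 < r \<longrightarrow>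
       (\<exists>X. finite X \<and> card X \<le> N \<and> ball y (2 * r) \<subseteq> (\<Union>x\<in>X. ball x (r / 2)))"
    by (rule ball_doubling)
  let ?n = "CARD('n)" and ?\<alpha> = "exp (- (1 / 3)) :: real"
  define Q where "Q = 1 + (16 * b / a) ^ ?n * measure lborel (ball (0 :: real ^ 'n) 1)"
  have Q: "0 \<le> Q" using ab by (simp add: Q_def)
  define \<gamma> where "\<gamma> = (?\<alpha> / 2) powr p / (k * (2 * N))"
  have \<gamma>: "0 < \<gamma>" using k N(1) by (simp add: \<gamma>_def)
  show ?thesis
  proof (intro exI[of _ "Q / \<gamma>"] allI impI, elim conjE)
    fix \<phi> V
    assume \<phi>: "\<phi> \<in> smooth_functions A" "\<forall>x. 0 < \<phi> x" and fin: "finsler_metric A (scaled \<phi>)"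
      and V: "0 < V" "emeasure (bh_measure A (scaled \<phi>)) UNIV = ennreal V"
      and conc: "V / k \<le> measure (bh_measure A (scaled \<phi>)) (chart_ball c z R)"
    interpret S: finsler_manifold A "scaled \<phi>" by standard (rule fin)
    interpret B: finite_measure "bh_measure A (scaled \<phi>)"
      by (rule finite_measureI) (use V in auto)
    have finV: "emeasure (bh_measure A (scaled \<phi>)) UNIV < \<infinity>" using V by simp
    have Vk: "0 < V / k" using V k by simp
    obtain y r where yr: "0 < r" "cball y (2 * r) \<subseteq> cball z (5 * R)"
      "V / k / (2 * N) \<le> measure (bh_measure A (scaled \<phi>)) (chart_ball c y r)"
      "V / k / (2 * N) \<le> measure (bh_measure A (scaled \<phi>)) (- chart_ball c y (2 * r))"
      by (rule S.concentrated_chart_ball[OF c R finV Vk conc N])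
    have sub: "cball y (2 * r) \<subseteq> chart_img c" using yr(2) R(2) by (rule order_trans)
    let ?u = "chart_bump c y r"
    have sm: "?u \<in> smooth_functions A" by (rule chart_bump_smooth[OF c yr(1) sub])
    then have "?u \<in> borel_measurable (bh_measure A (scaled \<phi>))"
      using borel_measurable_continuous_onI[OF smooth_function_continuous[OF sm]] by simp
    then obtain t where t: "0 \<le> t" "t \<le> 1"
      "(\<integral>x. \<bar>?u x - t\<bar> powr (p - 2) * (?u x - t) \<partial>bh_measure A (scaled \<phi>)) = 0"
      using B.ex_shift_p_mean_zero[OF p(1), of ?u] chart_bump_bounds by blast
    have den: "ennreal ((?\<alpha> / 2) powr p) * ennreal (V / k / (2 * N)) \<le>
        (\<integral>\<^sup>+x. ennreal (\<bar>?u x - t\<bar> powr p) \<partial>bh_measure A (scaled \<phi>))"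
    proof (rule p_norm_lower_bound)
      show "chart_ball c y r \<in> sets (bh_measure A (scaled \<phi>))"
        "- chart_ball c y (2 * r) \<in> sets (bh_measure A (scaled \<phi>))"
        using borel_chart_ball[OF c] by auto
      show "ennreal (V / k / (2 * N)) \<le> emeasure (bh_measure A (scaled \<phi>)) (chart_ball c y r)"
        "ennreal (V / k / (2 * N)) \<le> emeasure (bh_measure A (scaled \<phi>)) (- chart_ball c y (2 * r))"
        unfolding B.emeasure_eq_measure by (intro ennreal_leI yr)+
      show "?\<alpha> \<le> ?u x" if "x \<in> chart_ball c y r" for x by (rule chart_bump_inside[OF yr(1) that])
      show "?u x = 0" if "x \<in> - chart_ball c y (2 * r)" for x
        using chart_bump_outside[OF yr(1)] that by simp
    qed (use p in auto)
    have "ennreal ((?\<alpha> / 2) powr p) * ennreal (V / k / (2 * N)) = ennreal (\<gamma> * V)"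
      using V k by (simp add: \<gamma>_def ennreal_mult[symmetric] mult_ac)
    with den have den': "ennreal (\<gamma> * V) \<le> (\<integral>\<^sup>+x. ennreal (\<bar>?u x - t\<bar> powr p) \<partial>bh_measure A (scaled \<phi>))"
      by simp
    have num: "(\<integral>\<^sup>+x. ennreal ((scaled \<phi>) x (legendre A (scaled \<phi>) x
        (differential (\<lambda>x. ?u x - t) x)) powr p) \<partial>bh_measure A (scaled \<phi>))
      \<le> ennreal (V powr (1 - p / ?n) * Q)"
      unfolding Q_def
    proof (rule energy_le[OF c yr(1) sub ab(1,2) _ \<phi>(1) _ fin _ p(2) V])
      show "a * norm u \<le> G c z' u \<and> G c z' u \<le> b * norm u" if "z' \<in> cball y (2 * r)" for z' u
        using ab(3) yr(2) that by blast
      show "0 < \<phi> x" for x using \<phi>(2) by blast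
    qed (use p in simp)
    have le: "first_eigenvalue A (scaled \<phi>) p \<le> ennreal (V powr (1 - p / ?n) * Q / (\<gamma> * V))"
      by (rule S.first_eigenvalue_le[OF smooth_functions_diff_const[OF sm] _ t(3) _ den' num])
        (use p \<gamma> V Q in auto)
    have "first_eigenvalue A (scaled \<phi>) p * ennreal (V powr (p / ?n)) \<le>
        ennreal (V powr (1 - p / ?n) * Q / (\<gamma> * V)) * ennreal (V powr (p / ?n))"
      using le by (rule mult_right_mono) simp
    also have "\<dots> = ennreal (V powr (1 - p / ?n) * Q / (\<gamma> * V) * V powr (p / ?n))"
      using Q \<gamma> V by (intro ennreal_mult[symmetric]) auto
    also have "V powr (1 - p / ?n) * Q / (\<gamma> * V) * V powr (p / ?n) = Q / \<gamma>"
    proof -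
      have "V powr (1 - p / ?n) * V powr (p / ?n) = V"
        using V(1) by (simp flip: powr_add)
      then have "V powr (1 - p / ?n) * Q / (\<gamma> * V) * V powr (p / ?n) = V * Q / (\<gamma> * V)"
        by (metis (no_types, opaque_lifting) mult.commute mult.left_commute times_divide_eq_left)
      then show ?thesis using V(1) by simp
    qed
    finally show "first_eigenvalue A (scaled \<phi>) p * ennreal (V powr (p / ?n)) \<le> ennreal (Q / \<gamma>)" .
  qed
qed

section \<open>Compact manifolds\<close>

text \<open>Finitely many coordinate balls cover the manifold, so one of the \<open>k\<close> balls has mass at least
  \<open>V/k\<close>.  Which one depends on the conformal factor, hence the maximum of the local constants.\<close>

lemma conformal_eigenvalue_bound:
  assumes comp: "compact (UNIV :: 'm set)" and p: "1 < p" "p \<le> real CARD('n)"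
  shows "\<exists>C. \<forall>\<phi>. \<phi> \<in> smooth_functions A \<and> (\<forall>x. 0 < \<phi> x) \<and> finsler_metric A (scaled \<phi>) \<longrightarrow>
      first_eigenvalue A (scaled \<phi>) p * ennreal (finsler_volume A (scaled \<phi>) powr (p / CARD('n))) \<le> ennreal C"
proof -
  have "\<exists>c R. c \<in> A \<and> x \<in> chart_dom c \<and> 0 < R \<and> cball (chart_map c x) (5 * R) \<subseteq> chart_img c" for x
  proof -
    obtain c where c: "c \<in> A" "x \<in> chart_dom c" by (rule chart_at)
    then obtain e where "0 < e" "cball (chart_map c x) e \<subseteq> chart_img c"
      using open_contains_cball[of "chart_img c"] open_chart_img[OF c(1)] by blast
    then show ?thesis using c by (intro exI[of _ c] exI[of _ "e / 5"]) auto
  qed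
  then have "\<exists>ch R. \<forall>x. ch x \<in> A \<and> x \<in> chart_dom (ch x) \<and> 0 < R x \<and>
      cball (chart_map (ch x) x) (5 * R x) \<subseteq> chart_img (ch x)"
    by (subst choice_iff[symmetric], subst choice_iff[symmetric]) blast
  then obtain ch R where ch: "\<And>x. ch x \<in> A" "\<And>x. x \<in> chart_dom (ch x)" "\<And>x. 0 < R x"
    "\<And>x. cball (chart_map (ch x) x) (5 * R x) \<subseteq> chart_img (ch x)"
    by blast
  let ?S = "\<lambda>x. chart_ball (ch x) (chart_map (ch x) x) (R x)"
  have "\<And>x. open (?S x)" "UNIV \<subseteq> (\<Union>x\<in>UNIV. ?S x)"
    using open_chart_ball[OF ch(1)] ch(2,3) by (auto simp: chart_ball_def)
  then obtain X where X: "finite X" "UNIV \<subseteq> (\<Union>x\<in>X. ?S x)"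
    by (rule compactE_image[OF comp])
  then have Xne: "X \<noteq> {}" by auto
  define k where "k = real (card X)"
  have k: "0 < k" using X(1) Xne by (simp add: k_def card_gt_0_iff)
  have "\<exists>C. \<forall>x. \<forall>\<phi> V. \<phi> \<in> smooth_functions A \<and> (\<forall>x. 0 < \<phi> x) \<and> finsler_metric A (scaled \<phi>) \<and> 0 < V \<and>
      emeasure (bh_measure A (scaled \<phi>)) UNIV = ennreal V \<and>
      V / k \<le> measure (bh_measure A (scaled \<phi>)) (?S x) \<longrightarrow>
      first_eigenvalue A (scaled \<phi>) p * ennreal (V powr (p / CARD('n))) \<le> ennreal (C x)"
    by (rule choice, rule allI, rule local_eigenvalue_bound[OF ch(1,3,4) k p])
  then obtain C where C: "\<And>x \<phi> V. \<phi> \<in> smooth_functions A \<Longrightarrow> (\<forall>x. 0 < \<phi> x) \<Longrightarrow> finsler_metric A (scaled \<phi>) \<Longrightarrow> 0 < V \<Longrightarrow>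
      emeasure (bh_measure A (scaled \<phi>)) UNIV = ennreal V \<Longrightarrow>
      V / k \<le> measure (bh_measure A (scaled \<phi>)) (?S x) \<Longrightarrow>
      first_eigenvalue A (scaled \<phi>) p * ennreal (V powr (p / CARD('n))) \<le> ennreal (C x)"
    by blast
  show ?thesis
  proof (intro exI[of _ "Max (C ` X)"] allI impI, elim conjE)
    fix \<phi> assume \<phi>: "\<phi> \<in> smooth_functions A" "\<forall>x. 0 < \<phi> x" and fin: "finsler_metric A (scaled \<phi>)"
    interpret S: finsler_manifold A "scaled \<phi>" by standard (rule fin)
    define V where "V = finsler_volume A (scaled \<phi>)"
    have V: "V = measure (bh_measure A (scaled \<phi>)) UNIV" by (simp add: V_def finsler_volume_def)
    show "first_eigenvalue A (scaled \<phi>) p * ennreal (finsler_volume A (scaled \<phi>) powr (p / CARD('n))) \<le> ennreal (Max (C ` X))"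
    proof (cases "V = 0")
      \<comment> \<open>This includes infinite total mass, whose real-valued measure is \<open>0\<close>.\<close>
      case True
      then show ?thesis by (simp add: V_def)
    next
      case False
      then have V0: "0 < V" by (simp add: V zero_less_measure_iff)
      then have em: "emeasure (bh_measure A (scaled \<phi>)) UNIV = ennreal V"
        unfolding V by (intro emeasure_eq_ennreal_measure) (auto simp: measure_def V)
      interpret B: finite_measure "bh_measure A (scaled \<phi>)"
        by (rule finite_measureI) (use em in auto)
      have meas: "?S x \<in> sets (bh_measure A (scaled \<phi>))" for x
        using borel_chart_ball[OF ch(1)] by simp
      have "\<exists>x\<in>X. V / k \<le> measure (bh_measure A (scaled \<phi>)) (?S x)"
      proof (rule ccontr)
        assume "\<not> (\<exists>x\<in>X. V / k \<le> measure (bh_measure A (scaled \<phi>)) (?S x))"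
        then have lt: "measure (bh_measure A (scaled \<phi>)) (?S x) < V / k" if "x \<in> X" for x
          using that by (simp add: not_le)
        have "V \<le> measure (bh_measure A (scaled \<phi>)) (\<Union>x\<in>X. ?S x)"
          unfolding V using X meas by (intro B.finite_measure_mono) auto
        also have "\<dots> \<le> (\<Sum>x\<in>X. measure (bh_measure A (scaled \<phi>)) (?S x))"
          using X meas by (intro B.finite_measure_subadditive_finite) auto
        also have "\<dots> < (\<Sum>x\<in>X. V / k)"
          using X(1) Xne lt by (intro sum_strict_mono) auto
        also have "\<dots> = V" using k by (simp add: k_def)
        finally show False by simp
      qed
      then obtain x where x: "x \<in> X" "V / k \<le> measure (bh_measure A (scaled \<phi>)) (?S x)" by blast
      have "first_eigenvalue A (scaled \<phi>) p * ennreal (V powr (p / CARD('n))) \<le> ennreal (C x)"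
        by (rule C[OF \<phi> fin V0 em x(2)])
      also have "\<dots> \<le> ennreal (Max (C ` X))"
        using X(1) x(1) by (intro ennreal_leI Max_ge) auto
      finally show ?thesis by (simp add: V_def)
    qed
  qed
qed

end

theorem theorem1p1:
  fixes A :: "('m::{t2_space, second_countable_topology}, 'n::finite) chart set"
  assumes "smooth_atlas A"
    and "compact (UNIV :: 'm set)"
    and "connected (UNIV :: 'm set)"
  shows "\<exists>C :: nat \<Rightarrow> real \<Rightarrow> ereal \<Rightarrow> 'm finsler set \<Rightarrow> real.
    \<forall>(p::real) (F :: 'm finsler). 1 < p \<and> p \<le> real CARD('n) \<and> finsler_metric A F \<longrightarrow>
      first_eigenvalue A F p * ennreal (finsler_volume A F powr (p / real CARD('n)))
        \<le> ennreal (C CARD('n) p (reversibility A F) (conformal_class A F))"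
proof -
  interpret M: smooth_manifold A by standard (rule assms(1))
  let ?P = "\<lambda>p cls B. \<forall>F. finsler_metric A F \<and> conformal_class A F = cls \<longrightarrow>
      first_eigenvalue A F p * ennreal (finsler_volume A F powr (p / real CARD('n))) \<le> ennreal B"
  have refl: "F \<in> conformal_class A F" for F
    unfolding conformal_class_def using M.smooth_functions_const[of 1] by (auto intro!: exI[of _ "\<lambda>_. 1"])
  \<comment> \<open>Any representative \<open>F1\<close> of the class serves as the reference metric.\<close>
  have ex: "\<exists>B. ?P p cls B" if p: "1 < p" "p \<le> real CARD('n)" for p cls
  proof (cases "\<exists>F. finsler_metric A F \<and> conformal_class A F = cls")
    case True
    then obtain F1 where F1: "finsler_metric A F1" "conformal_class A F1 = cls" by blast
    interpret finsler_manifold A F1 by standard (rule F1(1))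
    obtain B where B: "\<forall>\<phi>. \<phi> \<in> smooth_functions A \<and> (\<forall>x. 0 < \<phi> x) \<and> finsler_metric A (scaled \<phi>) \<longrightarrow>
      first_eigenvalue A (scaled \<phi>) p * ennreal (finsler_volume A (scaled \<phi>) powr (p / CARD('n))) \<le> ennreal B"
      using conformal_eigenvalue_bound[OF assms(2) p] by blast
    have "?P p cls B"
    proof (intro allI impI, elim conjE)
      fix F assume F: "finsler_metric A F" "conformal_class A F = cls"
      then have "F \<in> conformal_class A F1" using refl[of F] F1(2) by simp
      then obtain \<phi> where "\<phi> \<in> smooth_functions A" "\<forall>x. 0 < \<phi> x" "F = scaled \<phi>"
        unfolding conformal_class_def by blast
      then show "first_eigenvalue A F p * ennreal (finsler_volume A F powr (p / real CARD('n))) \<le> ennreal B"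
        using B F(1) by blast
    qed
    then show ?thesis by blast
  qed blast
  show ?thesis
  proof (intro exI[of _ "\<lambda>n p \<kappa> cls. SOME B. ?P p cls B"] allI impI, elim conjE)
    fix p and F :: "'m finsler"
    assume "1 < p" "p \<le> real CARD('n)" and F: "finsler_metric A F"
    from someI_ex[OF ex[OF this(1,2), of "conformal_class A F"]]
    show "first_eigenvalue A F p * ennreal (finsler_volume A F powr (p / real CARD('n)))
        \<le> ennreal (SOME B. ?P p (conformal_class A F) B)"
      using F by blast
  qed
qed

end
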